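(* Let $(M^4,g,I,J)$ be a nondegenerate rank $2$ generalized Kähler-Ricci soliton on a real $4$-manifold, with canonical soliton vector fields $X_I,X_J$, and let $\mathfrak t=\mathrm{span}_{\mathbb R}\{X_I,X_J\}$. At points where $\dim\mathfrak t=2$ one has $I\mathfrak t=J\mathfrak t$.
   Context: For a metric $g$ with compatible complex structure $J$ on a real $4$-manifold: $\omega_J(X,Y)=g(JX,Y)$, $d^c_J=\sqrt{-1}(\bar\partial_J-\partial_J)$, Lee form $\theta_J$ defined by $d\omega_J=\theta_J\wedge\omega_J$. A generalized Kähler structure $(g,I,J)$ is a Riemannian metric with two compatible integrable complex structures with $d^c_I\omega_I=H=-d^c_J\omega_J$, $dH=0$. It is a generalized Kähler-Ricci soliton if there is a smooth $f$ with $\mathrm{Rc}^{\nabla^+}+\nabla^+\nabla^+f=0$, $\nabla^+=\nabla+\tfrac12g^{-1}H$ (equivalently $\mathrm{Rc}-\tfrac14H^2+\nabla^2f=0$ and $d^*(e^{-f}H)=0$, where $H^2(X,Y)=\sum_{i,j}H(X,e_i,e_j)H(Y,e_i,e_j)$). Canonical soliton vector fields: $X_I=\tfrac12I(\theta_I^\sharp-\nabla f)$, $X_J=\tfrac12J(\theta_J^\sharp-\nabla f)$. The rank is $\sup_{p\in M}\dim\mathrm{span}\{X_I(p),X_J(p)\}$. Nondegenerate means that the Poisson tensor $\sigma=\tfrac12[I,J]g^{-1}$ is everywhere invertible. At a point $p$, $\mathfrak t$ is identified with $\mathrm{span}\{X_I(p),X_J(p)\}\subset T_pM$. *)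

theory Defs
  imports "HOL-Analysis.Analysis"
begin

section \<open>Smooth 4-manifolds\<close>

text \<open>\<open>C\<^sup>k\<close> and \<open>C\<^sup>\<infinity>\<close> maps; meant for open \<open>S\<close>.\<close>

fun Ck_on :: "nat \<Rightarrow> 'a::real_normed_vector set \<Rightarrow> ('a \<Rightarrow> 'b::real_normed_vector) \<Rightarrow> bool" where
  "Ck_on 0 S F \<longleftrightarrow> continuous_on S F"
| "Ck_on (Suc k) S F \<longleftrightarrow>
     (\<forall>x\<in>S. F differentiable (at x)) \<and> (\<forall>v. Ck_on k S (\<lambda>x. frechet_derivative F (at x) v))"

definition smooth_on :: "'a::real_normed_vector set \<Rightarrow> ('a \<Rightarrow> 'b::real_normed_vector) \<Rightarrow> bool" where
  "smooth_on S F \<longleftrightarrow> (\<forall>k. Ck_on k S F)"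

record 'm chart =
  cdom :: "'m set"
  cmap :: "'m \<Rightarrow> real^4"
  cinv :: "real^4 \<Rightarrow> 'm"

definition cimg :: "'m chart \<Rightarrow> (real^4) set" where
  "cimg c = cmap c ` cdom c"

definition is_chart :: "'m::topological_space chart \<Rightarrow> bool" where
  "is_chart c \<longleftrightarrow> open (cdom c) \<and> open (cimg c) \<and> homeomorphism (cdom c) (cimg c) (cmap c) (cinv c)"

definition overlap :: "'m chart \<Rightarrow> 'm chart \<Rightarrow> (real^4) set" where
  "overlap c d = cmap c ` (cdom c \<inter> cdom d)"

definition transition :: "'m chart \<Rightarrow> 'm chart \<Rightarrow> real^4 \<Rightarrow> real^4" where
  "transition c d = cmap d \<circ> cinv c"

text \<open>The manifold is the union of the chart domains. It is Hausdorff and second countable by the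
  sort constraint; the atlas need not be maximal.\<close>

definition smooth_atlas :: "'m::{t2_space, second_countable_topology} chart set \<Rightarrow> bool" where
  "smooth_atlas A \<longleftrightarrow>
     (\<forall>c\<in>A. is_chart c) \<and> (\<forall>c\<in>A. \<forall>d\<in>A. smooth_on (overlap c d) (transition c d))"

section \<open>Tensor fields\<close>

text \<open>A tensor field is given by its components in every chart, as functions of the chart
  coordinates, subject to the transformation law on overlaps. The chart \<open>c\<close> identifies
  \<open>T\<^sub>pM\<close> with \<open>real^4\<close>; an endomorphism is the matrix acting by \<open>*v\<close>
  (entry \<open>$ k $ j\<close> is \<open>J\<^sup>k\<^sub>j\<close>) and a bilinear form the matrix of its values on the coordinate
  fields.\<close>

type_synonym 'm matrix_field = "'m chart \<Rightarrow> real^4 \<Rightarrow> real^4^4"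

definition smooth_bilinear_field :: "'m chart set \<Rightarrow> 'm matrix_field \<Rightarrow> bool" where
  "smooth_bilinear_field A b \<longleftrightarrow>
     (\<forall>c\<in>A. smooth_on (cimg c) (b c)) \<and>
     (\<forall>c\<in>A. \<forall>d\<in>A. \<forall>x\<in>overlap c d.
        b c x = transpose (jacobian (transition c d) (at x))
                  ** b d (transition c d x) ** jacobian (transition c d) (at x))"

definition smooth_endo_field :: "'m chart set \<Rightarrow> 'm matrix_field \<Rightarrow> bool" where
  "smooth_endo_field A K \<longleftrightarrow>
     (\<forall>c\<in>A. smooth_on (cimg c) (K c)) \<and>
     (\<forall>c\<in>A. \<forall>d\<in>A. \<forall>x\<in>overlap c d.
        jacobian (transition c d) (at x) ** K c x
          = K d (transition c d x) ** jacobian (transition c d) (at x))"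

definition smooth_function :: "'m chart set \<Rightarrow> ('m \<Rightarrow> real) \<Rightarrow> bool" where
  "smooth_function A f \<longleftrightarrow> (\<forall>c\<in>A. smooth_on (cimg c) (f \<circ> cinv c))"

definition riemannian_metric :: "'m chart set \<Rightarrow> 'm matrix_field \<Rightarrow> bool" where
  "riemannian_metric A g \<longleftrightarrow> smooth_bilinear_field A g \<and>
     (\<forall>c\<in>A. \<forall>x\<in>cimg c. transpose (g c x) = g c x \<and> (\<forall>v. v \<noteq> 0 \<longrightarrow> v \<bullet> (g c x *v v) > 0))"

section \<open>Calculus in a chart\<close>

definition pd :: "4 \<Rightarrow> (real^4 \<Rightarrow> 'b::real_normed_vector) \<Rightarrow> real^4 \<Rightarrow> 'b" where
  "pd i F x = frechet_derivative F (at x) (axis i 1)"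

definition lie_bracket :: "(real^4 \<Rightarrow> real^4) \<Rightarrow> (real^4 \<Rightarrow> real^4) \<Rightarrow> real^4 \<Rightarrow> real^4" where
  "lie_bracket X Y x = frechet_derivative Y (at x) (X x) - frechet_derivative X (at x) (Y x)"

definition nijenhuis ::
  "(real^4 \<Rightarrow> real^4^4) \<Rightarrow> (real^4 \<Rightarrow> real^4) \<Rightarrow> (real^4 \<Rightarrow> real^4) \<Rightarrow> real^4 \<Rightarrow> real^4" where
  "nijenhuis J X Y x =
     lie_bracket (\<lambda>y. J y *v X y) (\<lambda>y. J y *v Y y) x
     - J x *v lie_bracket (\<lambda>y. J y *v X y) Y x
     - J x *v lie_bracket X (\<lambda>y. J y *v Y y) x
     - lie_bracket X Y x"

text \<open>Differential forms: \<open>\<alpha> x i j\<close> is \<open>\<alpha>(\<partial>\<^sub>i, \<partial>\<^sub>j)\<close> at \<open>x\<close>, etc. The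
  values are real or complex.\<close>

type_synonym 'a cov2 = "4 \<Rightarrow> 4 \<Rightarrow> 'a"
type_synonym 'a cov3 = "4 \<Rightarrow> 4 \<Rightarrow> 4 \<Rightarrow> 'a"

definition ext_d2 :: "(real^4 \<Rightarrow> 'a::real_normed_vector cov2) \<Rightarrow> real^4 \<Rightarrow> 'a cov3" where
  "ext_d2 \<alpha> x i j k =
     pd i (\<lambda>y. \<alpha> y j k) x - pd j (\<lambda>y. \<alpha> y i k) x + pd k (\<lambda>y. \<alpha> y i j) x"

definition ext_d3 ::
  "(real^4 \<Rightarrow> 'a::real_normed_vector cov3) \<Rightarrow> real^4 \<Rightarrow> 4 \<Rightarrow> 4 \<Rightarrow> 4 \<Rightarrow> 4 \<Rightarrow> 'a" where
  "ext_d3 \<alpha> x i j k l =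
     pd i (\<lambda>y. \<alpha> y j k l) x - pd j (\<lambda>y. \<alpha> y i k l) x
     + pd k (\<lambda>y. \<alpha> y i j l) x - pd l (\<lambda>y. \<alpha> y i j k) x"

definition wedge12 :: "real^4 \<Rightarrow> real cov2 \<Rightarrow> real cov3" where
  "wedge12 \<theta> \<alpha> i j k = \<theta> $ i * \<alpha> j k - \<theta> $ j * \<alpha> i k + \<theta> $ k * \<alpha> i j"

section \<open>Type decomposition and the operator \<open>d\<^sup>c\<close>\<close>

text \<open>\<open>type_proj J True\<close> and \<open>type_proj J False\<close> are the projections of the complexified tangent
  space onto the \<open>\<i>\<close>- and \<open>-\<i>\<close>-eigenspaces of \<open>J\<close>. The \<open>(p,q)\<close>-part of a \<open>k\<close>-form (\<open>q = k - p\<close>)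
  is the sum, over the ways of choosing \<open>p\<close> of the \<open>k\<close> arguments, of the form with the chosen
  arguments projected to type \<open>(1,0)\<close> and the others to type \<open>(0,1)\<close>.\<close>

definition type_proj :: "real^4^4 \<Rightarrow> bool \<Rightarrow> 4 \<Rightarrow> 4 \<Rightarrow> complex" where
  "type_proj J h k i =
     (of_bool (k = i) + (if h then - \<i> else \<i>) * complex_of_real (J $ k $ i)) / 2"

definition type_part2 :: "real^4^4 \<Rightarrow> nat \<Rightarrow> complex cov2 \<Rightarrow> complex cov2" where
  "type_part2 J p \<alpha> i j =
     (\<Sum>(a, b) \<in> {(a, b). of_bool a + of_bool b = p}.
        \<Sum>k\<in>UNIV. \<Sum>l\<in>UNIV. type_proj J a k i * type_proj J b l j * \<alpha> k l)"

definition type_part3 :: "real^4^4 \<Rightarrow> nat \<Rightarrow> complex cov3 \<Rightarrow> complex cov3" where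
  "type_part3 J p \<alpha> i j k =
     (\<Sum>(a, b, c) \<in> {(a, b, c). of_bool a + of_bool b + of_bool c = p}.
        \<Sum>l\<in>UNIV. \<Sum>m\<in>UNIV. \<Sum>n\<in>UNIV.
          type_proj J a l i * type_proj J b m j * type_proj J c n k * \<alpha> l m n)"

text \<open>On \<open>(p,q)\<close>-forms, \<open>\<partial>\<close> and \<open>\<partial>-bar\<close> are the \<open>(p+1,q)\<close>- and \<open>(p,q+1)\<close>-parts of \<open>d\<close>.\<close>

definition del2 :: "(real^4 \<Rightarrow> real^4^4) \<Rightarrow> (real^4 \<Rightarrow> complex cov2) \<Rightarrow> real^4 \<Rightarrow> complex cov3" where
  "del2 J \<alpha> x i j k =
     (\<Sum>p\<le>2. type_part3 (J x) (p + 1) (ext_d2 (\<lambda>y. type_part2 (J y) p (\<alpha> y)) x) i j k)"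

definition delbar2 :: "(real^4 \<Rightarrow> real^4^4) \<Rightarrow> (real^4 \<Rightarrow> complex cov2) \<Rightarrow> real^4 \<Rightarrow> complex cov3" where
  "delbar2 J \<alpha> x i j k =
     (\<Sum>p\<le>2. type_part3 (J x) p (ext_d2 (\<lambda>y. type_part2 (J y) p (\<alpha> y)) x) i j k)"

definition dc2 :: "(real^4 \<Rightarrow> real^4^4) \<Rightarrow> (real^4 \<Rightarrow> real cov2) \<Rightarrow> real^4 \<Rightarrow> complex cov3" where
  "dc2 J \<alpha> x i j k =
     \<i> * (delbar2 J (\<lambda>y a b. complex_of_real (\<alpha> y a b)) x i j k
          - del2 J (\<lambda>y a b. complex_of_real (\<alpha> y a b)) x i j k)"

section \<open>Generalized Kaehler structures\<close>

definition compatible_complex_structure :: "'m chart set \<Rightarrow> 'm matrix_field \<Rightarrow> 'm matrix_field \<Rightarrow> bool"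
  where
  "compatible_complex_structure A g J \<longleftrightarrow> smooth_endo_field A J \<and>
     (\<forall>c\<in>A. \<forall>x\<in>cimg c.
        J c x ** J c x = - mat 1 \<and>
        transpose (J c x) ** g c x ** J c x = g c x \<and>
        (\<forall>i j. nijenhuis (J c) (\<lambda>_. axis i 1) (\<lambda>_. axis j 1) x = 0))"

text \<open>\<open>\<omega>\<^sub>J(X,Y) = g(JX,Y)\<close>\<close>

definition fundamental_form :: "'m matrix_field \<Rightarrow> 'm matrix_field \<Rightarrow> 'm chart \<Rightarrow> real^4 \<Rightarrow> real cov2" where
  "fundamental_form g J c x i j = (J c x *v axis i 1) \<bullet> (g c x *v axis j 1)"

text \<open>The Lee form is well defined because wedging with the nondegenerate form \<open>\<omega>\<^sub>J\<close> is an
  isomorphism from 1-forms to 3-forms in dimension 4.\<close>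

definition lee_form :: "'m matrix_field \<Rightarrow> 'm matrix_field \<Rightarrow> 'm chart \<Rightarrow> real^4 \<Rightarrow> real^4" where
  "lee_form g J c x =
     (THE \<theta>. ext_d2 (fundamental_form g J c) x = wedge12 \<theta> (fundamental_form g J c x))"

definition generalized_kahler ::
  "'m chart set \<Rightarrow> 'm matrix_field \<Rightarrow> 'm matrix_field \<Rightarrow> 'm matrix_field
     \<Rightarrow> ('m chart \<Rightarrow> real^4 \<Rightarrow> real cov3) \<Rightarrow> bool" where
  "generalized_kahler A g I J H \<longleftrightarrow>
     riemannian_metric A g \<and>
     compatible_complex_structure A g I \<and> compatible_complex_structure A g J \<and>
     (\<forall>c\<in>A. \<forall>x\<in>cimg c.
        (\<forall>i j k. dc2 (I c) (fundamental_form g I c) x i j k = complex_of_real (H c x i j k) \<and>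
                 complex_of_real (H c x i j k) = - dc2 (J c) (fundamental_form g J c) x i j k) \<and>
        (\<forall>i j k l. ext_d3 (H c) x i j k l = 0))"

text \<open>The Poisson tensor \<open>\<sigma> = \<onehalf>[I,J]g\<^sup>-\<^sup>1\<close>, as a map from covectors to vectors.\<close>

definition poisson_tensor ::
  "'m matrix_field \<Rightarrow> 'm matrix_field \<Rightarrow> 'm matrix_field \<Rightarrow> 'm chart \<Rightarrow> real^4 \<Rightarrow> real^4^4" where
  "poisson_tensor g I J c x =
     ((1/2) *\<^sub>R (I c x ** J c x - J c x ** I c x)) ** matrix_inv (g c x)"

definition nondegenerate_gk ::
  "'m chart set \<Rightarrow> 'm matrix_field \<Rightarrow> 'm matrix_field \<Rightarrow> 'm matrix_field \<Rightarrow> bool" where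
  "nondegenerate_gk A g I J \<longleftrightarrow> (\<forall>c\<in>A. \<forall>x\<in>cimg c. invertible (poisson_tensor g I J c x))"

section \<open>Bismut connection and solitons\<close>

text \<open>Connection coefficients: \<open>\<Gamma> x k i j\<close> is \<open>\<Gamma>\<^sup>k\<^sub>i\<^sub>j\<close>, where
  \<open>\<nabla>\<^bsub>\<partial>i\<^esub> \<partial>\<^sub>j = \<Sum>k. \<Gamma>\<^sup>k\<^sub>i\<^sub>j \<partial>\<^sub>k\<close>. First for the Levi-Civita connection, then for
  \<open>\<nabla>\<^sup>+\<close>, i.e. \<open>g(\<nabla>\<^sup>+\<^sub>XY,Z) = g(\<nabla>\<^sub>XY,Z) + \<onehalf>H(X,Y,Z)\<close>.\<close>

definition levi_civita :: "(real^4 \<Rightarrow> real^4^4) \<Rightarrow> real^4 \<Rightarrow> real cov3" where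
  "levi_civita g x k i j =
     (\<Sum>l\<in>UNIV. matrix_inv (g x) $ k $ l *
        (pd i (\<lambda>y. g y $ j $ l) x + pd j (\<lambda>y. g y $ i $ l) x - pd l (\<lambda>y. g y $ i $ j) x)) / 2"

definition bismut_plus :: "(real^4 \<Rightarrow> real^4^4) \<Rightarrow> (real^4 \<Rightarrow> real cov3) \<Rightarrow> real^4 \<Rightarrow> real cov3" where
  "bismut_plus g H x k i j =
     levi_civita g x k i j + (\<Sum>l\<in>UNIV. matrix_inv (g x) $ k $ l * H x i j l) / 2"

text \<open>\<open>curvature \<Gamma> x l i j k\<close> is the \<open>\<partial>\<^sub>l\<close>-component of \<open>R(\<partial>\<^sub>i,\<partial>\<^sub>j)\<partial>\<^sub>k\<close>, with
  \<open>R(X,Y) = [\<nabla>\<^sub>X,\<nabla>\<^sub>Y] - \<nabla>\<^bsub>[X,Y]\<^esub>\<close>; then \<open>Rc(Y,Z) = tr (X \<mapsto> R(X,Y)Z)\<close>.\<close>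

definition curvature :: "(real^4 \<Rightarrow> real cov3) \<Rightarrow> real^4 \<Rightarrow> 4 \<Rightarrow> 4 \<Rightarrow> 4 \<Rightarrow> 4 \<Rightarrow> real" where
  "curvature \<Gamma> x l i j k =
     pd i (\<lambda>y. \<Gamma> y l j k) x - pd j (\<lambda>y. \<Gamma> y l i k) x
     + (\<Sum>m\<in>UNIV. \<Gamma> x l i m * \<Gamma> x m j k - \<Gamma> x l j m * \<Gamma> x m i k)"

definition ricci :: "(real^4 \<Rightarrow> real cov3) \<Rightarrow> real^4 \<Rightarrow> real cov2" where
  "ricci \<Gamma> x j k = (\<Sum>i\<in>UNIV. curvature \<Gamma> x i i j k)"

text \<open>\<open>(\<nabla>\<nabla>u)(X,Y) = X(Yu) - (\<nabla>\<^sub>XY)u\<close>\<close>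

definition hessian :: "(real^4 \<Rightarrow> real cov3) \<Rightarrow> (real^4 \<Rightarrow> real) \<Rightarrow> real^4 \<Rightarrow> real cov2" where
  "hessian \<Gamma> u x i j = pd i (pd j u) x - (\<Sum>k\<in>UNIV. \<Gamma> x k i j * pd k u x)"

definition gk_ricci_soliton ::
  "'m chart set \<Rightarrow> 'm matrix_field \<Rightarrow> 'm matrix_field \<Rightarrow> 'm matrix_field
     \<Rightarrow> ('m chart \<Rightarrow> real^4 \<Rightarrow> real cov3) \<Rightarrow> ('m \<Rightarrow> real) \<Rightarrow> bool" where
  "gk_ricci_soliton A g I J H f \<longleftrightarrow>
     generalized_kahler A g I J H \<and> smooth_function A f \<and>
     (\<forall>c\<in>A. \<forall>x\<in>cimg c. \<forall>i j.
        ricci (bismut_plus (g c) (H c)) x i j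
        + hessian (bismut_plus (g c) (H c)) (f \<circ> cinv c) x i j = 0)"

definition sharp :: "'m matrix_field \<Rightarrow> 'm chart \<Rightarrow> real^4 \<Rightarrow> real^4 \<Rightarrow> real^4" where
  "sharp g c x \<alpha> = matrix_inv (g c x) *v \<alpha>"

definition gradient :: "'m matrix_field \<Rightarrow> ('m \<Rightarrow> real) \<Rightarrow> 'm chart \<Rightarrow> real^4 \<Rightarrow> real^4" where
  "gradient g f c x = sharp g c x (\<chi> i. pd i (f \<circ> cinv c) x)"

text \<open>\<open>X\<^sub>J\<close>; taking \<open>I\<close> for \<open>J\<close> gives \<open>X\<^sub>I\<close>.\<close>

definition soliton_field ::
  "'m matrix_field \<Rightarrow> 'm matrix_field \<Rightarrow> ('m \<Rightarrow> real) \<Rightarrow> 'm chart \<Rightarrow> real^4 \<Rightarrow> real^4" where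
  "soliton_field g J f c x =
     (1/2) *\<^sub>R (J c x *v (sharp g c x (lee_form g J c x) - gradient g f c x))"

text \<open>\<open>\<tt>\<close> at \<open>p\<close>, as a subspace of \<open>T\<^sub>pM\<close> identified with \<open>real^4\<close> by a chart \<open>c\<close> around \<open>p\<close>.\<close>

definition soliton_span ::
  "'m matrix_field \<Rightarrow> 'm matrix_field \<Rightarrow> 'm matrix_field \<Rightarrow> ('m \<Rightarrow> real) \<Rightarrow> 'm chart \<Rightarrow> 'm
     \<Rightarrow> (real^4) set" where
  "soliton_span g I J f c p =
     span {soliton_field g I f c (cmap c p), soliton_field g J f c (cmap c p)}"

text \<open>The dimension below does not depend on the chart around \<open>p\<close>, and it is at most 2, so this is
  the supremum over the points of the manifold.\<close>

definition soliton_rank ::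
  "'m chart set \<Rightarrow> 'm matrix_field \<Rightarrow> 'm matrix_field \<Rightarrow> 'm matrix_field \<Rightarrow> ('m \<Rightarrow> real) \<Rightarrow> nat" where
  "soliton_rank A g I J f = Sup {dim (soliton_span g I J f c p) | c p. c \<in> A \<and> p \<in> cdom c}"

end

theory Submission
  imports Defs
begin

text \<open>
  Let \<open>\<theta>\<close> be the Lee form of \<open>I\<close>. In dimension four \<open>d\<omega> = \<theta> \<and> \<omega>\<close>, so that \<open>d\<^sup>c\<omega> = - (\<theta> \<circ> I) \<and> \<omega>\<close>
  is up to sign the Hodge dual of \<open>\<theta>\<close>, the sign being given by the orientation of the complex
  structure. Nondegeneracy forces \<open>I\<close> and \<open>J\<close> to induce the same orientation (otherwise they commute),
  hence \<open>\<theta>\<^sub>J = - \<theta>\<close> and \<open>X\<^sub>I = \<onehalf> I(\<theta>\<^sup>\<sharp> - \<nabla>f)\<close>, \<open>X\<^sub>J = - \<onehalf> J(\<theta>\<^sup>\<sharp> + \<nabla>f)\<close>.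

  The skew part of the soliton equation is \<open>d\<^sup>*(e\<^sup>-\<^sup>f H) = 0\<close>. Contracted with \<open>\<omega>\<close> it says that
  \<open>df(I\<theta>\<^sup>\<sharp>)\<close> is a multiple of the divergence of \<open>I\<theta>\<^sup>\<sharp>\<close>, which is itself a multiple of \<open>d\<^sup>*\<omega>\<close>, so its
  divergence vanishes; similarly for \<open>J\<close>. From \<open>df(I\<theta>\<^sup>\<sharp>) = df(J\<theta>\<^sup>\<sharp>) = 0\<close> one reads off that \<open>I\<close> and \<open>J\<close> both map
  \<open>span {X\<^sub>I, X\<^sub>J}\<close> into its orthogonal complement, which has the same dimension.
\<close>

section \<open>Calculus of smooth functions\<close>

text \<open>The soliton equation does not yield a divergence at once: an error term is left, the
  contraction of \<open>H\<close> with the covariant derivative of \<omega>. As \<open>H\<close> is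
  totally skew, that term sees only d\<omega> = \<theta> \<and> \<omega>; it is therefore a multiple
  of the pairing of \<theta> with its own rotation by the complex structure, and vanishes. The
  central object is the bivector \<open>W\<close>, which is \<omega> with both indices raised and at
  the same time minus the inverse of \<omega>. The first description makes the Christoffel symbols
  cancel, the second inverts the map from \<theta> to \<theta> \<and> \<omega>. Orientation is
  measured by the sign of the Pfaffian of \<omega>, whose square is det g; this makes the comparison
  of the two Lee forms purely algebraic. Tensor identities are proved first for arrays of numbers:
  values and first derivatives at a point are separate variables, tied only by differentiated
  relations such as that of J^2 = -1. Analysis then enters through the product rule and the symmetry
  of second derivatives.\<close>

lemma Ck_on_cong:
  assumes "open S" "\<And>x. x \<in> S \<Longrightarrow> F x = G x" "Ck_on k S F"
  shows "Ck_on k S G"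
  using assms(2,3)
proof (induction k arbitrary: F G)
  case 0
  then show ?case using continuous_on_cong[of S S F G] by auto
next
  case (Suc k)
  have d: "(G has_derivative frechet_derivative F (at x)) (at x)" if "x \<in> S" for x
    using Suc.prems that has_derivative_transform_within_open[OF _ assms(1) that, of F _ UNIV G]
    by (auto simp: frechet_derivative_works)
  then have e: "frechet_derivative G (at x) = frechet_derivative F (at x)" if "x \<in> S" for x
    using frechet_derivative_at[OF d[OF that]] by simp
  have "Ck_on k S (\<lambda>x. frechet_derivative G (at x) v)" for v
    by (rule Suc.IH[of "\<lambda>x. frechet_derivative F (at x) v"]) (use e Suc.prems in auto)
  then show ?case using d by (auto simp: differentiable_def)
qed

lemma Ck_on_differentiable: "Ck_on (Suc k) S F \<Longrightarrow> x \<in> S \<Longrightarrow> F differentiable (at x)"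
  by simp

lemma Ck_on_mono: "Ck_on (Suc k) S F \<Longrightarrow> Ck_on k S F"
proof (induction k arbitrary: F)
  case 0
  then show ?case
    by (auto intro!: continuous_at_imp_continuous_on differentiable_imp_continuous_within)
qed auto

lemma Ck_on_const: "Ck_on k S (\<lambda>x. c)"
  by (induction k arbitrary: c) auto

lemma Ck_on_linear:
  assumes "open S" "bounded_linear L" "Ck_on k S F"
  shows "Ck_on k S (\<lambda>x. L (F x))"
  using assms(3)
proof (induction k arbitrary: F)
  case 0
  then show ?case using bounded_linear.continuous_on[OF assms(2)] by auto
next
  case (Suc k)
  have d: "((\<lambda>x. L (F x)) has_derivative (\<lambda>v. L (frechet_derivative F (at x) v))) (at x)"
    if "x \<in> S" for x
    using Suc.prems that bounded_linear.has_derivative[OF assms(2)] by (auto simp: frechet_derivative_works)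
  then have e: "frechet_derivative (\<lambda>x. L (F x)) (at x) = (\<lambda>v. L (frechet_derivative F (at x) v))"
    if "x \<in> S" for x
    using frechet_derivative_at[OF d[OF that]] by simp
  have "Ck_on k S (\<lambda>x. frechet_derivative (\<lambda>x. L (F x)) (at x) v)" for v
    by (rule Ck_on_cong[OF assms(1), of "\<lambda>x. L (frechet_derivative F (at x) v)"])
      (use e Suc in auto)
  then show ?case using d by (auto simp: differentiable_def)
qed

lemma Ck_on_add:
  assumes "open S" "Ck_on k S F" "Ck_on k S G"
  shows "Ck_on k S (\<lambda>x. F x + G x)"
  using assms(2,3)
proof (induction k arbitrary: F G)
  case 0
  then show ?case by (auto intro: continuous_on_add)
next
  case (Suc k)
  have d: "((\<lambda>x. F x + G x) has_derivative
      (\<lambda>v. frechet_derivative F (at x) v + frechet_derivative G (at x) v)) (at x)" if "x \<in> S" for x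
    using Suc.prems that by (auto simp: frechet_derivative_works intro!: has_derivative_add)
  then have e: "frechet_derivative (\<lambda>x. F x + G x) (at x)
      = (\<lambda>v. frechet_derivative F (at x) v + frechet_derivative G (at x) v)" if "x \<in> S" for x
    using frechet_derivative_at[OF d[OF that]] by simp
  have "Ck_on k S (\<lambda>x. frechet_derivative (\<lambda>x. F x + G x) (at x) v)" for v
    by (rule Ck_on_cong[OF assms(1),
          of "\<lambda>x. frechet_derivative F (at x) v + frechet_derivative G (at x) v"])
      (use e Suc in auto)
  then show ?case using d by (auto simp: differentiable_def)
qed

lemma Ck_on_mult:
  fixes F G :: "'a::real_normed_vector \<Rightarrow> real"
  assumes "open S" "Ck_on k S F" "Ck_on k S G"
  shows "Ck_on k S (\<lambda>x. F x * G x)"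
  using assms(2,3)
proof (induction k arbitrary: F G)
  case 0
  then show ?case by (auto intro: continuous_on_mult)
next
  case (Suc k)
  have d: "((\<lambda>x. F x * G x) has_derivative
      (\<lambda>v. F x * frechet_derivative G (at x) v + frechet_derivative F (at x) v * G x)) (at x)"
    if "x \<in> S" for x
    using Suc.prems that by (auto simp: frechet_derivative_works intro!: has_derivative_mult)
  then have e: "frechet_derivative (\<lambda>x. F x * G x) (at x)
      = (\<lambda>v. F x * frechet_derivative G (at x) v + frechet_derivative F (at x) v * G x)"
    if "x \<in> S" for x
    using frechet_derivative_at[OF d[OF that]] by simp
  \<comment> \<open>The product rule leaves undifferentiated factors, which the induction needs at
    the lower order \<open>k\<close>.\<close>
  have m: "Ck_on k S F" "Ck_on k S G" using Suc.prems Ck_on_mono by blast+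
  have "Ck_on k S (\<lambda>x. F x * frechet_derivative G (at x) v + frechet_derivative F (at x) v * G x)"
    for v
    using Suc.prems by (intro Ck_on_add[OF assms(1)] Suc.IH m) auto
  then have "Ck_on k S (\<lambda>x. frechet_derivative (\<lambda>x. F x * G x) (at x) v)" for v
    by (rule Ck_on_cong[OF assms(1), rotated]) (use e in auto)
  then show ?case using d by (auto simp: differentiable_def)
qed

text \<open>The derivative of 1/F is a product that contains 1/F again, so each order of
  differentiability bootstraps the next through \<open>Ck_on_mult\<close>.\<close>

lemma Ck_on_inverse:
  fixes F :: "'a::real_normed_vector \<Rightarrow> real"
  assumes "open S" "Ck_on k S F" "\<And>x. x \<in> S \<Longrightarrow> F x \<noteq> 0"
  shows "Ck_on k S (\<lambda>x. inverse (F x))"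
  using assms(2)
proof (induction k)
  case 0
  then show ?case using assms(3) by (auto intro: continuous_on_inverse)
next
  case (Suc k)
  have d: "((\<lambda>x. inverse (F x)) has_derivative
      (\<lambda>v. (-1) * (inverse (F x) * frechet_derivative F (at x) v * inverse (F x)))) (at x)"
    if "x \<in> S" for x
    using Deriv.has_derivative_inverse[of F x, OF assms(3)[OF that], of "frechet_derivative F (at x)" UNIV]
      Suc.prems that by (auto simp: frechet_derivative_works)
  then have e: "frechet_derivative (\<lambda>x. inverse (F x)) (at x)
      = (\<lambda>v. (-1) * (inverse (F x) * frechet_derivative F (at x) v * inverse (F x)))"
    if "x \<in> S" for x
    using frechet_derivative_at[OF d[OF that]] by simp
  have i: "Ck_on k S (\<lambda>x. inverse (F x))" using Suc Ck_on_mono by blast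
  have "Ck_on k S (\<lambda>x. (-1) * (inverse (F x) * frechet_derivative F (at x) v * inverse (F x)))"
    for v
    using Suc.prems by (intro Ck_on_mult[OF assms(1)] Ck_on_const i) auto
  then have "Ck_on k S (\<lambda>x. frechet_derivative (\<lambda>x. inverse (F x)) (at x) v)" for v
    by (rule Ck_on_cong[OF assms(1), rotated]) (use e in auto)
  then show ?case using d by (auto simp: differentiable_def)
qed

lemma smooth_on_const: "smooth_on S (\<lambda>x. c)"
  by (simp add: smooth_on_def Ck_on_const)

lemma smooth_on_linear:
  "open S \<Longrightarrow> bounded_linear L \<Longrightarrow> smooth_on S F \<Longrightarrow> smooth_on S (\<lambda>x. L (F x))"
  by (simp add: smooth_on_def Ck_on_linear)

lemma smooth_on_add:
  "open S \<Longrightarrow> smooth_on S F \<Longrightarrow> smooth_on S G \<Longrightarrow> smooth_on S (\<lambda>x. F x + G x)"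
  by (simp add: smooth_on_def Ck_on_add)

lemma smooth_on_mult:
  fixes F G :: "'a::real_normed_vector \<Rightarrow> real"
  shows "open S \<Longrightarrow> smooth_on S F \<Longrightarrow> smooth_on S G \<Longrightarrow> smooth_on S (\<lambda>x. F x * G x)"
  by (simp add: smooth_on_def Ck_on_mult)

lemma smooth_on_inverse:
  fixes F :: "'a::real_normed_vector \<Rightarrow> real"
  shows "open S \<Longrightarrow> smooth_on S F \<Longrightarrow> (\<And>x. x \<in> S \<Longrightarrow> F x \<noteq> 0) \<Longrightarrow> smooth_on S (\<lambda>x. inverse (F x))"
  by (simp add: smooth_on_def Ck_on_inverse)

lemma smooth_on_minus: "open S \<Longrightarrow> smooth_on S F \<Longrightarrow> smooth_on S (\<lambda>x. - F x)"
  by (rule smooth_on_linear[OF _ bounded_linear_minus[OF bounded_linear_ident]])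

lemma smooth_on_diff:
  "open S \<Longrightarrow> smooth_on S F \<Longrightarrow> smooth_on S G \<Longrightarrow> smooth_on S (\<lambda>x. F x - G x)"
  using smooth_on_add[of S F "\<lambda>x. - G x"] smooth_on_minus[of S G] by simp

lemma smooth_on_divide_const:
  fixes F :: "'a::real_normed_vector \<Rightarrow> real"
  shows "open S \<Longrightarrow> smooth_on S F \<Longrightarrow> smooth_on S (\<lambda>x. F x / c)"
  by (rule smooth_on_linear[OF _ bounded_linear_divide])

lemma smooth_on_sum:
  "open S \<Longrightarrow> (\<And>i. i \<in> I \<Longrightarrow> smooth_on S (F i)) \<Longrightarrow> smooth_on S (\<lambda>x. \<Sum>i\<in>I. F i x)"
  by (induction I rule: infinite_finite_induct) (auto intro: smooth_on_const smooth_on_add)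

lemma smooth_on_prod:
  fixes F :: "'i \<Rightarrow> 'a::real_normed_vector \<Rightarrow> real"
  shows "open S \<Longrightarrow> (\<And>i. i \<in> I \<Longrightarrow> smooth_on S (F i)) \<Longrightarrow> smooth_on S (\<lambda>x. \<Prod>i\<in>I. F i x)"
  by (induction I rule: infinite_finite_induct) (auto intro: smooth_on_const smooth_on_mult)

lemma smooth_on_cong:
  "open S \<Longrightarrow> (\<And>x. x \<in> S \<Longrightarrow> F x = G x) \<Longrightarrow> smooth_on S F \<Longrightarrow> smooth_on S G"
  unfolding smooth_on_def by (blast intro: Ck_on_cong)

lemma smooth_on_entry:
  fixes F :: "real^4 \<Rightarrow> real^4^4"
  assumes "open S" "smooth_on S F"
  shows "smooth_on S (\<lambda>x. F x $ i $ j)"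
  using smooth_on_linear[OF assms(1) bounded_linear_compose[OF bounded_linear_vec_nth bounded_linear_vec_nth] assms(2)]
  by (simp add: o_def)

lemma smooth_on_differentiable: "smooth_on S F \<Longrightarrow> x \<in> S \<Longrightarrow> F differentiable (at x)"
  unfolding smooth_on_def using Ck_on_differentiable by blast

lemma smooth_on_pd: "smooth_on S F \<Longrightarrow> smooth_on S (pd i F)"
  unfolding smooth_on_def pd_def by (metis Ck_on.simps(2))

section \<open>Inverse matrices and their smooth dependence on the matrix\<close>

lemma matrix_inv_mult:
  fixes A :: "real^'n^'n"
  assumes "invertible A"
  shows "A ** matrix_inv A = mat 1" "matrix_inv A ** A = mat 1"
proof -
  have "\<exists>B. A ** B = mat 1 \<and> B ** A = mat 1" using assms by (simp add: invertible_def)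
  from someI_ex[OF this] show "A ** matrix_inv A = mat 1" "matrix_inv A ** A = mat 1"
    by (simp_all add: matrix_inv_def)
qed

lemma mat_1_nth: "(mat 1 :: real^'n^'n) $ i $ j = of_bool (i = j)"
  by (simp add: mat_def)

lemma matrix_inv_right:
  fixes A :: "real^'n^'n"
  assumes "invertible A"
  shows "(\<Sum>k\<in>UNIV. A $ i $ k * matrix_inv A $ k $ j) = of_bool (i = j)"
proof -
  have "(\<Sum>k\<in>UNIV. A $ i $ k * matrix_inv A $ k $ j) = (A ** matrix_inv A) $ i $ j"
    by (simp add: matrix_matrix_mult_def)
  then show ?thesis by (simp only: matrix_inv_mult[OF assms] mat_1_nth)
qed

lemma matrix_inv_left:
  fixes A :: "real^'n^'n"
  assumes "invertible A"
  shows "(\<Sum>k\<in>UNIV. matrix_inv A $ i $ k * A $ k $ j) = of_bool (i = j)"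
proof -
  have "(\<Sum>k\<in>UNIV. matrix_inv A $ i $ k * A $ k $ j) = (matrix_inv A ** A) $ i $ j"
    by (simp add: matrix_matrix_mult_def)
  then show ?thesis by (simp only: matrix_inv_mult[OF assms] mat_1_nth)
qed

text \<open>\<open>matrix_inv\<close> is a choice operator, so its definition shows no regularity;
  Cramer's rule makes its entries quotients of polynomials in the entries of
  \<open>F\<close>.\<close>

lemma smooth_on_matrix_inv_entry:
  fixes F :: "real^4 \<Rightarrow> real^4^4"
  assumes S: "open S" and F: "\<And>i j. smooth_on S (\<lambda>x. F x $ i $ j)"
    and inv: "\<And>x. x \<in> S \<Longrightarrow> invertible (F x)"
  shows "smooth_on S (\<lambda>x. matrix_inv (F x) $ i $ j)"
proof -
  \<comment> \<open>Column \<open>i\<close> of \<open>F x\<close> is replaced by the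
    \<open>j\<close>-th basis vector: column \<open>j\<close> of the inverse solves the linear
    system with that right-hand side.\<close>
  let ?R = "\<lambda>x. \<chi> a b. if b = i then axis j 1 $ a else F x $ a $ b :: real^4^4"
  have det: "smooth_on S (\<lambda>x. det (G x))" if "\<And>i j. smooth_on S (\<lambda>x. G x $ i $ j)"
    for G :: "real^4 \<Rightarrow> real^4^4"
    unfolding det_def using that S
    by (intro smooth_on_sum smooth_on_mult smooth_on_const smooth_on_prod)
       auto
  have sm: "smooth_on S (\<lambda>x. det (?R x) * inverse (det (F x)))"
  proof (intro smooth_on_mult smooth_on_inverse det S F)
    show "smooth_on S (\<lambda>x. ?R x $ a $ b)" for a b
      using F smooth_on_const by (cases "b = i") auto
  qed (use inv invertible_det_nz in blast)
  have eq: "det (?R x) * inverse (det (F x)) = matrix_inv (F x) $ i $ j" if "x \<in> S" for x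
  proof -
    have "F x *v (\<chi> k. matrix_inv (F x) $ k $ j) = axis j 1"
      using matrix_inv_right[OF inv[OF that]]
      by (simp add: vec_eq_iff matrix_vector_mult_def axis_def)
    moreover have "det (F x) \<noteq> 0" using inv[OF that] invertible_det_nz by blast
    ultimately have "(\<chi> k. matrix_inv (F x) $ k $ j)
        = (\<chi> k. det (\<chi> a b. if b = k then axis j 1 $ a else F x $ a $ b) / det (F x))"
      using cramer[of "F x" "\<chi> k. matrix_inv (F x) $ k $ j" "axis j 1"] by blast
    then have "(\<chi> k. matrix_inv (F x) $ k $ j) $ i = det (?R x) / det (F x)"
      by (simp only: vec_lambda_beta)
    then show ?thesis by (simp add: divide_inverse)
  qed
  show ?thesis by (rule smooth_on_cong[OF S eq sm])
qed

section \<open>Partial derivatives and their symmetry\<close>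

lemma pd_cong:
  assumes "open S" "x \<in> S" "\<And>y. y \<in> S \<Longrightarrow> F y = G y"
  shows "pd i F x = pd i G x"
proof -
  have "(F has_derivative D) (at x) \<longleftrightarrow> (G has_derivative D) (at x)" for D
    using has_derivative_transform_within_open[OF _ assms(1,2), of F D UNIV G]
      has_derivative_transform_within_open[OF _ assms(1,2), of G D UNIV F] assms(3) by auto
  then show ?thesis by (simp add: pd_def frechet_derivative_def)
qed

lemma has_derivative_pd: "(F has_derivative D) (at x) \<Longrightarrow> pd i F x = D (axis i 1)"
  unfolding pd_def using frechet_derivative_at by metis

lemma pd_const [simp]: "pd i (\<lambda>y. c) x = 0"
  by (simp add: pd_def)

lemma pd_linear:
  assumes "bounded_linear L" "F differentiable (at x)"
  shows "pd i (\<lambda>y. L (F y)) x = L (pd i F x)"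
  using has_derivative_pd[OF bounded_linear.has_derivative[OF assms(1)], of F "frechet_derivative F (at x)"]
    assms(2) by (simp add: frechet_derivative_works pd_def)

lemma pd_add:
  assumes "F differentiable (at x)" "G differentiable (at x)"
  shows "pd i (\<lambda>y. F y + G y) x = pd i F x + pd i G x"
  using has_derivative_pd[OF has_derivative_add] assms
  by (simp add: frechet_derivative_works pd_def)

lemma pd_minus:
  "F differentiable (at x) \<Longrightarrow> pd i (\<lambda>y. - F y) x = - pd i F x"
  by (rule pd_linear[OF bounded_linear_minus[OF bounded_linear_ident]])

lemma pd_mult:
  fixes F G :: "real^4 \<Rightarrow> real"
  assumes "F differentiable (at x)" "G differentiable (at x)"
  shows "pd i (\<lambda>y. F y * G y) x = pd i F x * G x + F x * pd i G x"
  using has_derivative_pd[OF has_derivative_mult, of F _ x G] assms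
  by (simp add: frechet_derivative_works pd_def)

lemma pd_sum:
  assumes "finite I" "\<And>a. a \<in> I \<Longrightarrow> F a differentiable (at x)"
  shows "pd i (\<lambda>y. \<Sum>a\<in>I. F a y) x = (\<Sum>a\<in>I. pd i (F a) x)"
  using assms by (induction I rule: finite_induct) (auto simp: pd_add)

text \<open>The mean value theorem is used twice: in direction \<open>i\<close> on the increment of
  \<open>F\<close> along \<open>j\<close>, then in direction \<open>j\<close> on
  \<open>pd i F\<close>. This turns the quotient into a value of the mixed derivative at a nearby
  point, where continuity applies.\<close>

lemma second_difference_quotient:
  fixes F :: "real^4 \<Rightarrow> real"
  assumes S: "open S" "x \<in> S" and F: "smooth_on S F" and e: "e > 0"
  shows "\<exists>d>0. \<forall>h. 0 < h \<and> h < d \<longrightarrow>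
    \<bar>(F (x + h *\<^sub>R axis i 1 + h *\<^sub>R axis j 1) - F (x + h *\<^sub>R axis i 1) - F (x + h *\<^sub>R axis j 1) + F x) / h^2
      - pd j (pd i F) x\<bar> < e"
proof -
  let ?a = "axis i (1::real) :: real^4" and ?b = "axis j (1::real) :: real^4"
  have "continuous (at x) (pd j (pd i F))"
    using smooth_on_differentiable[OF smooth_on_pd[OF smooth_on_pd[OF F]] S(2)]
      differentiable_imp_continuous_within by blast
  then obtain d1 where d1: "d1 > 0" "\<And>y. dist y x < d1 \<Longrightarrow> dist (pd j (pd i F) y) (pd j (pd i F) x) < e"
    using e unfolding continuous_at_eps_delta by (meson dist_norm)
  obtain d2 where d2: "d2 > 0" "\<And>y. dist y x < d2 \<Longrightarrow> y \<in> S"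
    using S unfolding open_dist by meson
  have dist: "dist (x + s *\<^sub>R ?a + t *\<^sub>R ?b) x < min d1 d2"
    if "0 \<le> s" "s \<le> h" "0 \<le> t" "t \<le> h" "h < min d1 d2 / 2" for s t h
  proof -
    have "dist (x + s *\<^sub>R ?a + t *\<^sub>R ?b) x = norm (s *\<^sub>R ?a + t *\<^sub>R ?b)"
      by (simp add: dist_norm algebra_simps)
    also have "\<dots> \<le> s + t"
      using that norm_triangle_ineq[of "s *\<^sub>R ?a" "t *\<^sub>R ?b"] by (simp add: norm_axis_1)
    finally show ?thesis using that by auto
  qed
  have der: "((\<lambda>s. G (x + p + s *\<^sub>R axis k 1)) has_real_derivative pd k G (x + p + s *\<^sub>R axis k 1)) (at s)"
    if "smooth_on S G" "x + p + s *\<^sub>R axis k 1 \<in> S" for G p s k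
  proof -
    have "(G has_derivative frechet_derivative G (at (x + p + s *\<^sub>R axis k 1))) (at (x + p + s *\<^sub>R axis k 1))"
      using smooth_on_differentiable[OF that] frechet_derivative_works by blast
    moreover have "((\<lambda>s. x + p + s *\<^sub>R axis k 1) has_derivative (\<lambda>s. s *\<^sub>R axis k 1)) (at s)"
      by (auto intro!: derivative_eq_intros)
    ultimately have "((\<lambda>s. G (x + p + s *\<^sub>R axis k 1)) has_derivative
        (\<lambda>t. frechet_derivative G (at (x + p + s *\<^sub>R axis k 1)) (t *\<^sub>R axis k 1))) (at s)"
      using diff_chain_at[of "\<lambda>s. x + p + s *\<^sub>R axis k 1" _ s G] by (auto simp: o_def)
    then show ?thesis
      using linear_cmul[OF linear_frechet_derivative[OF smooth_on_differentiable[OF that]]]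
      by (simp add: has_field_derivative_def pd_def mult_commute_abs)
  qed
  show ?thesis
  proof (intro exI[of _ "min d1 d2 / 2"] conjI allI impI)
    fix h assume "0 < h \<and> h < min d1 d2 / 2"
    then have h: "0 < h" "h < min d1 d2 / 2" by auto
    have inS: "x + s *\<^sub>R ?a + t *\<^sub>R ?b \<in> S" if "0 \<le> s" "s \<le> h" "0 \<le> t" "t \<le> h" for s t
      using dist[OF that h(2)] d2 by auto
    \<comment> \<open>The summand 0 gives the second term the shape
      \<open>x + p + s *\<^sub>R axis k 1\<close> that \<open>der\<close> expects.\<close>
    let ?\<phi> = "\<lambda>s. F (x + h *\<^sub>R ?b + s *\<^sub>R ?a) - F (x + 0 + s *\<^sub>R ?a)"
    have "\<exists>s. 0 < s \<and> s < h \<and> ?\<phi> h - ?\<phi> 0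
       = (h - 0) * (pd i F (x + h *\<^sub>R ?b + s *\<^sub>R ?a) - pd i F (x + 0 + s *\<^sub>R ?a))"
      by (rule MVT2[OF h(1)], intro DERIV_diff der F)
        (use inS[of _ h] inS[of _ 0] h in \<open>auto simp: algebra_simps\<close>)
    then obtain s where s: "0 < s" "s < h" "?\<phi> h - ?\<phi> 0
       = h * (pd i F (x + h *\<^sub>R ?b + s *\<^sub>R ?a) - pd i F (x + 0 + s *\<^sub>R ?a))" by auto
    have "\<exists>t. 0 < t \<and> t < h \<and> pd i F (x + s *\<^sub>R ?a + h *\<^sub>R ?b) - pd i F (x + s *\<^sub>R ?a + 0 *\<^sub>R ?b)
       = (h - 0) * pd j (pd i F) (x + s *\<^sub>R ?a + t *\<^sub>R ?b)"
      by (rule MVT2[OF h(1)], intro der smooth_on_pd[OF F]) (use s inS[of s] in auto)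
    then obtain t where t: "0 < t" "t < h" "pd i F (x + s *\<^sub>R ?a + h *\<^sub>R ?b) - pd i F (x + s *\<^sub>R ?a)
       = h * pd j (pd i F) (x + s *\<^sub>R ?a + t *\<^sub>R ?b)" by auto
    have c: "x + h *\<^sub>R ?b + r *\<^sub>R ?a = x + r *\<^sub>R ?a + h *\<^sub>R ?b" for r by simp
    have "F (x + h *\<^sub>R ?a + h *\<^sub>R ?b) - F (x + h *\<^sub>R ?a) - F (x + h *\<^sub>R ?b) + F x
        = h^2 * pd j (pd i F) (x + s *\<^sub>R ?a + t *\<^sub>R ?b)"
      using s(3) t(3) unfolding c by (simp add: power2_eq_square)
    then have "(F (x + h *\<^sub>R ?a + h *\<^sub>R ?b) - F (x + h *\<^sub>R ?a) - F (x + h *\<^sub>R ?b) + F x) / h^2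
        = pd j (pd i F) (x + s *\<^sub>R ?a + t *\<^sub>R ?b)" using h by simp
    moreover have "dist (x + s *\<^sub>R ?a + t *\<^sub>R ?b) x < d1"
      using dist[OF _ _ _ _ h(2), of s t] s t by auto
    ultimately show "\<bar>(F (x + h *\<^sub>R ?a + h *\<^sub>R ?b) - F (x + h *\<^sub>R ?a) - F (x + h *\<^sub>R ?b) + F x) / h^2
      - pd j (pd i F) x\<bar> < e"
      using d1(2) by (simp add: dist_real_def)
  qed (use d1 d2 in auto)
qed

lemma pd_commute:
  fixes F :: "real^4 \<Rightarrow> real"
  assumes S: "open S" "x \<in> S" and F: "smooth_on S F"
  shows "pd i (pd j F) x = pd j (pd i F) x"
proof (rule ccontr)
  assume ne: "pd i (pd j F) x \<noteq> pd j (pd i F) x"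
  \<comment> \<open>Half the gap: for small \<open>h\<close> the difference quotient, symmetric in
    \<open>i\<close> and \<open>j\<close>, would lie strictly within \<open>e\<close> of both mixed
    derivatives.\<close>
  define e where "e = \<bar>pd i (pd j F) x - pd j (pd i F) x\<bar> / 2"
  have e: "e > 0" using ne by (simp add: e_def)
  let ?D = "\<lambda>i j h. (F (x + h *\<^sub>R axis i 1 + h *\<^sub>R axis j 1) - F (x + h *\<^sub>R axis i 1)
    - F (x + h *\<^sub>R axis j 1) + F x) / h^2"
  obtain d1 where d1: "d1 > 0" "\<And>h. 0 < h \<and> h < d1 \<Longrightarrow> \<bar>?D i j h - pd j (pd i F) x\<bar> < e"
    using second_difference_quotient[OF S F e, of i j] by blast
  obtain d2 where d2: "d2 > 0" "\<And>h. 0 < h \<and> h < d2 \<Longrightarrow> \<bar>?D j i h - pd i (pd j F) x\<bar> < e"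
    using second_difference_quotient[OF S F e, of j i] by blast
  define h where "h = min d1 d2 / 2"
  have h: "0 < h" "h < d1" "h < d2" using d1(1) d2(1) by (auto simp: h_def)
  have "?D i j h = ?D j i h" by (simp add: algebra_simps)
  then have "\<bar>pd i (pd j F) x - pd j (pd i F) x\<bar> < 2 * e"
    using d1(2)[of h] d2(2)[of h] h by linarith
  then show False by (simp add: e_def)
qed

section \<open>Hermitian linear algebra in dimension four\<close>

lemma sum_of_bool_mult [simp]:
  fixes f :: "'n::finite \<Rightarrow> 'a::comm_semiring_1"
  shows "(\<Sum>k\<in>UNIV. of_bool (k = i) * f k) = f i" "(\<Sum>k\<in>UNIV. of_bool (i = k) * f k) = f i"
    "(\<Sum>k\<in>UNIV. f k * of_bool (k = i)) = f i" "(\<Sum>k\<in>UNIV. f k * of_bool (i = k)) = f i"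
  by (simp_all add: of_bool_def if_distrib if_distribR sum.delta cong: if_cong)

section \<open>Alternating 3-forms on four coordinates\<close>

definition alternating3 :: "real cov3 \<Rightarrow> bool" where
  "alternating3 \<alpha> \<longleftrightarrow> (\<forall>i j k. \<alpha> i j k = - \<alpha> j i k \<and> \<alpha> i j k = - \<alpha> i k j)"

lemma alternating3_swap:
  assumes "alternating3 \<gamma>"
  shows "\<gamma> j i k = - \<gamma> i j k" "\<gamma> i k j = - \<gamma> i j k"
  using assms unfolding alternating3_def by metis+

lemma alternating3_perm:
  assumes "alternating3 \<gamma>"
  shows "\<gamma> i k j = - \<gamma> i j k" "\<gamma> j i k = - \<gamma> i j k" "\<gamma> j k i = \<gamma> i j k"
    "\<gamma> k i j = \<gamma> i j k" "\<gamma> k j i = - \<gamma> i j k"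
  using alternating3_swap(1)[OF assms, of j i k] alternating3_swap(2)[OF assms, of i k j]
    alternating3_swap(1)[OF assms, of k i j] alternating3_swap(2)[OF assms, of j k i]
    alternating3_swap(2)[OF assms, of k j i] by linarith+

text \<open>Oriented rewrite rules: each component is reduced to one with increasing indices, so
  that \<open>simp\<close> can decide identities of 3-forms component by component.\<close>

lemma alternating3_expand:
  assumes "alternating3 \<gamma>"
  shows "\<gamma> i i k = 0" "\<gamma> i k k = 0" "\<gamma> i k i = 0"
    "\<gamma> 1 3 2 = - \<gamma> 1 2 3" "\<gamma> 2 1 3 = - \<gamma> 1 2 3" "\<gamma> 2 3 1 = \<gamma> 1 2 3"
    "\<gamma> 3 1 2 = \<gamma> 1 2 3" "\<gamma> 3 2 1 = - \<gamma> 1 2 3"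
    "\<gamma> 1 4 2 = - \<gamma> 1 2 4" "\<gamma> 2 1 4 = - \<gamma> 1 2 4" "\<gamma> 2 4 1 = \<gamma> 1 2 4"
    "\<gamma> 4 1 2 = \<gamma> 1 2 4" "\<gamma> 4 2 1 = - \<gamma> 1 2 4"
    "\<gamma> 1 4 3 = - \<gamma> 1 3 4" "\<gamma> 3 1 4 = - \<gamma> 1 3 4" "\<gamma> 3 4 1 = \<gamma> 1 3 4"
    "\<gamma> 4 1 3 = \<gamma> 1 3 4" "\<gamma> 4 3 1 = - \<gamma> 1 3 4"
    "\<gamma> 2 4 3 = - \<gamma> 2 3 4" "\<gamma> 3 2 4 = - \<gamma> 2 3 4" "\<gamma> 3 4 2 = \<gamma> 2 3 4"
    "\<gamma> 4 2 3 = \<gamma> 2 3 4" "\<gamma> 4 3 2 = - \<gamma> 2 3 4"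
proof -
  show "\<gamma> i i k = 0" "\<gamma> i k k = 0" "\<gamma> i k i = 0"
    using alternating3_perm(2)[OF assms, of i i k] alternating3_perm(1)[OF assms, of i k k]
      alternating3_perm(5)[OF assms, of i k i] by linarith+
qed (rule alternating3_perm[OF assms])+

lemma alternating3_eqI:
  assumes a: "alternating3 \<alpha>" "alternating3 \<beta>"
    and eq: "\<alpha> 1 2 3 = \<beta> 1 2 3" "\<alpha> 1 2 4 = \<beta> 1 2 4" "\<alpha> 1 3 4 = \<beta> 1 3 4" "\<alpha> 2 3 4 = \<beta> 2 3 4"
  shows "\<alpha> = \<beta>"
proof -
  have "\<forall>i j k. \<alpha> i j k = \<beta> i j k"
    unfolding forall_4
    by (simp add: alternating3_expand[OF a(1)] alternating3_expand[OF a(2)] eq)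
  then show ?thesis by blast
qed

lemma alternating3_wedge12:
  assumes "\<And>i j. \<omega> i j = - \<omega> j i"
  shows "alternating3 (wedge12 \<theta> \<omega>)"
  unfolding alternating3_def wedge12_def
proof (intro allI conjI)
  show "\<theta> $ i * \<omega> j k - \<theta> $ j * \<omega> i k + \<theta> $ k * \<omega> i j = - (\<theta> $ j * \<omega> i k - \<theta> $ i * \<omega> j k + \<theta> $ k * \<omega> j i)"
    for i j k using assms[of i j] by (simp add: algebra_simps)
  show "\<theta> $ i * \<omega> j k - \<theta> $ j * \<omega> i k + \<theta> $ k * \<omega> i j = - (\<theta> $ i * \<omega> k j - \<theta> $ k * \<omega> i j + \<theta> $ j * \<omega> i k)"
    for i j k using assms[of j k] by (simp add: algebra_simps)
qed

section \<open>Nondegenerate 2-forms and the map from \<theta> to \<theta> \<and> \<omega>\<close>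

definition pfaffian :: "real cov2 \<Rightarrow> real" where
  "pfaffian \<omega> = \<omega> 1 2 * \<omega> 3 4 - \<omega> 1 3 * \<omega> 2 4 + \<omega> 1 4 * \<omega> 2 3"

text \<open>The inverse of a skew \<open>4 \<times> 4\<close> matrix is, up to sign, its Hodge dual divided by the Pfaffian.\<close>

definition skew_dual :: "real cov2 \<Rightarrow> real cov2" where
  "skew_dual \<omega> a b =
    (if (a, b) = (1, 2) then \<omega> 3 4 else if (a, b) = (1, 3) then - \<omega> 2 4
     else if (a, b) = (1, 4) then \<omega> 2 3 else if (a, b) = (2, 3) then \<omega> 1 4
     else if (a, b) = (2, 4) then - \<omega> 1 3 else if (a, b) = (3, 4) then \<omega> 1 2
     else if (a, b) = (2, 1) then - \<omega> 3 4 else if (a, b) = (3, 1) then \<omega> 2 4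
     else if (a, b) = (4, 1) then - \<omega> 2 3 else if (a, b) = (3, 2) then - \<omega> 1 4
     else if (a, b) = (4, 2) then \<omega> 1 3 else if (a, b) = (4, 3) then - \<omega> 1 2 else 0)"

lemma skew_expand:
  fixes \<omega> :: "real cov2"
  assumes "\<And>i j. \<omega> i j = - \<omega> j i"
  shows "\<omega> i i = 0" "\<omega> 2 1 = - \<omega> 1 2" "\<omega> 3 1 = - \<omega> 1 3" "\<omega> 4 1 = - \<omega> 1 4"
    "\<omega> 3 2 = - \<omega> 2 3" "\<omega> 4 2 = - \<omega> 2 4" "\<omega> 4 3 = - \<omega> 3 4"
proof -
  show "\<omega> i i = 0" using assms[of i i] by linarith
qed (rule assms)+

text \<open>\<open>skew_dual\<close> is linear and the Pfaffian quadratic, so this is the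
  polarization of the inverse formula \<open>skew_dual_mult\<close>; the constant is minus the
  polarized Pfaffian. It will yield a linear relation between \<open>I ** J\<close> and
  \<open>J ** I\<close>.\<close>

lemma skew_dual_polarized:
  fixes \<omega> \<eta> :: "real cov2"
  assumes "\<And>i j. \<omega> i j = - \<omega> j i" "\<And>i j. \<eta> i j = - \<eta> j i"
  shows "\<exists>c. \<forall>i k. (\<Sum>j\<in>UNIV. skew_dual \<omega> i j * \<eta> j k) + (\<Sum>j\<in>UNIV. skew_dual \<eta> i j * \<omega> j k)
    = c * of_bool (i = k)"
proof -
  note s = skew_expand[of \<omega>, OF assms(1)] skew_expand[of \<eta>, OF assms(2)]
  show ?thesis
    by (rule exI[of _ "- (\<omega> 1 2 * \<eta> 3 4 - \<omega> 1 3 * \<eta> 2 4 + \<omega> 1 4 * \<eta> 2 3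
          + \<eta> 1 2 * \<omega> 3 4 - \<eta> 1 3 * \<omega> 2 4 + \<eta> 1 4 * \<omega> 2 3)"])
      (simp add: forall_4 sum_4 skew_dual_def s algebra_simps)
qed

lemma skew_dual_mult:
  fixes \<omega> :: "real cov2"
  assumes "\<And>i j. \<omega> i j = - \<omega> j i"
  shows "(\<Sum>j\<in>UNIV. skew_dual \<omega> i j * \<omega> j k) = - pfaffian \<omega> * of_bool (i = k)"
proof -
  note s = skew_expand[of \<omega>, OF assms]
  have "\<forall>i k. (\<Sum>j\<in>UNIV. skew_dual \<omega> i j * \<omega> j k) = - pfaffian \<omega> * of_bool (i = k)"
    by (simp add: forall_4 sum_4 skew_dual_def pfaffian_def s algebra_simps)
  then show ?thesis by blast
qed

text \<open>The bivector is minus the inverse of the form, the sign that results from raising both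
  indices of \<omega> with a Hermitian metric.\<close>

locale skew_inverse =
  fixes \<omega> W :: "real cov2"
  assumes skew: "\<omega> i j = - \<omega> j i" and skew_W: "W i j = - W j i"
    and W_\<omega>: "(\<Sum>b\<in>UNIV. W a b * \<omega> b c) = - of_bool (a = c)"
begin

lemma \<omega>_W: "(\<Sum>b\<in>UNIV. \<omega> a b * W b c) = - of_bool (a = c)"
proof -
  have "(\<Sum>b\<in>UNIV. \<omega> a b * W b c) = (\<Sum>b\<in>UNIV. W c b * \<omega> b a)"
    by (rule sum.cong) (use skew skew_W in \<open>metis minus_mult_minus mult.commute\<close>)+
  then show ?thesis using W_\<omega>[of c a] by (auto simp: eq_commute)
qed

text \<open>The triple product of \<open>skew_dual \<omega>\<close>, \<omega> and \<open>W\<close>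
  is bracketed in the two possible ways.\<close>

lemma skew_dual_eq: "skew_dual \<omega> a c = pfaffian \<omega> * W a c"
proof -
  have "(\<Sum>j\<in>UNIV. \<Sum>b\<in>UNIV. skew_dual \<omega> a b * \<omega> b j * W j c)
      = (\<Sum>j\<in>UNIV. - pfaffian \<omega> * of_bool (a = j) * W j c)"
    by (simp add: sum_distrib_right[symmetric] skew_dual_mult[of \<omega>, OF skew])
  also have "\<dots> = - pfaffian \<omega> * W a c" by (simp add: mult.assoc sum_distrib_left[symmetric] sum_negf)
  finally have "(\<Sum>j\<in>UNIV. \<Sum>b\<in>UNIV. skew_dual \<omega> a b * \<omega> b j * W j c) = - pfaffian \<omega> * W a c" .
  moreover have "(\<Sum>j\<in>UNIV. \<Sum>b\<in>UNIV. skew_dual \<omega> a b * \<omega> b j * W j c) = - skew_dual \<omega> a c"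
    by (subst sum.swap) (simp add: mult.assoc sum_distrib_left[symmetric] \<omega>_W sum_negf)
  ultimately show ?thesis by simp
qed

lemma pfaffian_nonzero: "pfaffian \<omega> \<noteq> 0"
proof
  assume "pfaffian \<omega> = 0"
  then have z: "skew_dual \<omega> a b = 0" for a b by (simp add: skew_dual_eq)
  have "\<omega> 1 2 = 0" "\<omega> 1 3 = 0" "\<omega> 1 4 = 0"
    using z[of 3 4] z[of 2 4] z[of 2 3] by (simp_all add: skew_dual_def)
  then show False using \<omega>_W[of 1 1] by (simp add: sum_4 skew_expand[of \<omega>, OF skew])
qed

text \<open>The three terms of the wedge product contribute -1, -1 and 4, the last being the full
  trace of \<open>W\<close> against \<omega>. The nonzero total is what makes wedging with \<omega>
  injective.\<close>

lemma wedge12_contract: "(\<Sum>a\<in>UNIV. \<Sum>b\<in>UNIV. W a b * wedge12 \<theta> \<omega> a b c) = 2 * \<theta> $ c"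
proof -
  have tr: "(\<Sum>a\<in>UNIV. \<Sum>b\<in>UNIV. W a b * \<omega> a b) = 4"
  proof -
    have "(\<Sum>b\<in>UNIV. W a b * \<omega> a b) = 1" for a
      using W_\<omega>[of a a] by (simp add: skew[of a] sum_negf)
    then show ?thesis by simp
  qed
  have 1: "(\<Sum>a\<in>UNIV. \<Sum>b\<in>UNIV. W a b * (\<theta> $ a * \<omega> b c)) = - \<theta> $ c"
    by (simp add: mult.left_commute[of "W _ _"] sum_distrib_left[symmetric] W_\<omega> sum_negf)
  have 2: "(\<Sum>a\<in>UNIV. \<Sum>b\<in>UNIV. W a b * (\<theta> $ b * \<omega> a c)) = \<theta> $ c"
  proof -
    have "(\<Sum>a\<in>UNIV. W a b * (\<theta> $ b * \<omega> a c)) = \<theta> $ b * of_bool (b = c)" for b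
      using W_\<omega>[of b c]
      by (simp add: skew_W[of _ b] mult.left_commute[of "W _ _"] sum_distrib_left[symmetric] sum_negf)
    then show ?thesis by (subst sum.swap) simp
  qed
  have 3: "(\<Sum>a\<in>UNIV. \<Sum>b\<in>UNIV. W a b * (\<theta> $ c * \<omega> a b)) = 4 * \<theta> $ c"
    by (simp add: mult.left_commute[of "W _ _"] sum_distrib_left[symmetric] tr)
  show ?thesis
    using 1 2 3 by (simp add: wedge12_def ring_distribs sum.distrib sum_subtractf)
qed

text \<open>1-forms and 3-forms both have four components, so the injective map given by wedging
  with \<omega> is onto, and \<open>wedge12_contract\<close> dictates the preimage.\<close>

lemma alternating3_eq_wedge12:
  assumes \<alpha>: "alternating3 \<alpha>"
  shows "\<alpha> = wedge12 (\<chi> c. (\<Sum>a\<in>UNIV. \<Sum>b\<in>UNIV. W a b * \<alpha> a b c) / 2) \<omega>"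
proof -
  define \<theta> :: "real^4" where "\<theta> = (\<chi> c. (\<Sum>a\<in>UNIV. \<Sum>b\<in>UNIV. W a b * \<alpha> a b c) / 2)"
  \<comment> \<open>Multiplied by the Pfaffian, \<open>W\<close> becomes the polynomial
    \<open>skew_dual\<close>; the four remaining identities are then free of denominators.\<close>
  have t: "pfaffian \<omega> * \<theta> $ c = (\<Sum>a\<in>UNIV. \<Sum>b\<in>UNIV. skew_dual \<omega> a b * \<alpha> a b c) / 2" for c
    by (simp add: \<theta>_def skew_dual_eq sum_distrib_left mult.assoc)
  have t1: "pfaffian \<omega> * \<theta> $ 1 = \<omega> 1 4 * \<alpha> 1 2 3 - \<omega> 1 3 * \<alpha> 1 2 4 + \<omega> 1 2 * \<alpha> 1 3 4"
   and t2: "pfaffian \<omega> * \<theta> $ 2 = \<omega> 2 4 * \<alpha> 1 2 3 - \<omega> 2 3 * \<alpha> 1 2 4 + \<omega> 1 2 * \<alpha> 2 3 4"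
   and t3: "pfaffian \<omega> * \<theta> $ 3 = \<omega> 3 4 * \<alpha> 1 2 3 - \<omega> 2 3 * \<alpha> 1 3 4 + \<omega> 1 3 * \<alpha> 2 3 4"
   and t4: "pfaffian \<omega> * \<theta> $ 4 = \<omega> 3 4 * \<alpha> 1 2 4 - \<omega> 2 4 * \<alpha> 1 3 4 + \<omega> 1 4 * \<alpha> 2 3 4"
    by (simp_all add: t sum_4 skew_dual_def alternating3_expand[OF \<alpha>] field_simps)
  have *: "pfaffian \<omega> * wedge12 \<theta> \<omega> i j k = (pfaffian \<omega> * \<theta> $ i) * \<omega> j k
      - (pfaffian \<omega> * \<theta> $ j) * \<omega> i k + (pfaffian \<omega> * \<theta> $ k) * \<omega> i j" for i j k
    by (simp add: wedge12_def algebra_simps)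
  have "\<alpha> = wedge12 \<theta> \<omega>"
  proof (rule alternating3_eqI[OF \<alpha> alternating3_wedge12[OF skew]])
    have "pfaffian \<omega> * \<alpha> 1 2 3 = pfaffian \<omega> * wedge12 \<theta> \<omega> 1 2 3"
      "pfaffian \<omega> * \<alpha> 1 2 4 = pfaffian \<omega> * wedge12 \<theta> \<omega> 1 2 4"
      "pfaffian \<omega> * \<alpha> 1 3 4 = pfaffian \<omega> * wedge12 \<theta> \<omega> 1 3 4"
      "pfaffian \<omega> * \<alpha> 2 3 4 = pfaffian \<omega> * wedge12 \<theta> \<omega> 2 3 4"
      unfolding * t1 t2 t3 t4 by (simp_all add: pfaffian_def algebra_simps)
    then show "\<alpha> 1 2 3 = wedge12 \<theta> \<omega> 1 2 3" "\<alpha> 1 2 4 = wedge12 \<theta> \<omega> 1 2 4"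
      "\<alpha> 1 3 4 = wedge12 \<theta> \<omega> 1 3 4" "\<alpha> 2 3 4 = wedge12 \<theta> \<omega> 2 3 4"
      using pfaffian_nonzero by auto
  qed
  then show ?thesis by (simp add: \<theta>_def)
qed

lemma the_wedge12:
  assumes "alternating3 \<alpha>"
  shows "(THE \<theta>. \<alpha> = wedge12 \<theta> \<omega>) = (\<chi> c. (\<Sum>a\<in>UNIV. \<Sum>b\<in>UNIV. W a b * \<alpha> a b c) / 2)"
proof (rule the_equality)
  show "\<alpha> = wedge12 (\<chi> c. (\<Sum>a\<in>UNIV. \<Sum>b\<in>UNIV. W a b * \<alpha> a b c) / 2) \<omega>"
    by (rule alternating3_eq_wedge12[OF assms])
  show "\<theta> = (\<chi> c. (\<Sum>a\<in>UNIV. \<Sum>b\<in>UNIV. W a b * \<alpha> a b c) / 2)" if "\<alpha> = wedge12 \<theta> \<omega>" for \<theta>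
    using wedge12_contract[of \<theta>] unfolding that by (simp add: vec_eq_iff)
qed

end

section \<open>The operator \<open>d\<^sup>c\<close> on the fundamental form\<close>

text \<open>The value of a complex covector on J applied to the \<open>i\<close>-th coordinate
  field; nested uses insert J into several arguments of a tensor.\<close>

definition slot_J :: "real^4^4 \<Rightarrow> 4 \<Rightarrow> (4 \<Rightarrow> complex) \<Rightarrow> complex" where
  "slot_J J i \<beta> = (\<Sum>k\<in>UNIV. complex_of_real (J $ k $ i) * \<beta> k)"

lemma slot_J_linear: "slot_J J i (\<lambda>k. (\<beta> k + s * \<gamma> k) / 2) = (slot_J J i \<beta> + s * slot_J J i \<gamma>) / 2"
  by (simp add: slot_J_def sum_distrib_left sum_divide_distrib flip: sum.distrib)
    (simp add: field_simps)

lemma of_real_slot_J: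
  "slot_J J i (\<lambda>k. complex_of_real (\<beta> k)) = complex_of_real (\<Sum>k\<in>UNIV. J $ k $ i * \<beta> k)"
  by (simp add: slot_J_def)

lemma sum_type_proj:
  "(\<Sum>k\<in>UNIV. type_proj J a k i * \<beta> k) = (\<beta> i + (if a then - \<i> else \<i>) * slot_J J i \<beta>) / 2"
proof -
  have "(\<Sum>k\<in>UNIV. type_proj J a k i * \<beta> k)
    = (\<Sum>k\<in>UNIV. (of_bool (k = i) * \<beta> k + (if a then - \<i> else \<i>) * (complex_of_real (J $ k $ i) * \<beta> k)) / 2)"
    by (rule sum.cong) (simp_all add: type_proj_def field_simps)
  then show ?thesis
    by (simp only: slot_J_def sum_divide_distrib[symmetric] sum.distrib sum_of_bool_mult sum_distrib_left)
qed

text \<open>The hypotheses say that \<alpha> has type (1,1). With two arguments projected to the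
  same type, \<open>s a * s b\<close> is -1 and everything cancels; with opposite types it is 1, and
  the two choices add up to \<alpha>.\<close>

lemma type_part2_expand:
  fixes \<alpha> :: "real cov2"
  assumes inv: "\<And>i j. (\<Sum>k\<in>UNIV. J $ k $ i * (\<Sum>l\<in>UNIV. J $ l $ j * \<alpha> k l)) = \<alpha> i j"
    and anti: "\<And>i j. (\<Sum>l\<in>UNIV. J $ l $ j * \<alpha> i l) = - (\<Sum>k\<in>UNIV. J $ k $ i * \<alpha> k j)"
  shows "type_part2 J 0 (\<lambda>i j. complex_of_real (\<alpha> i j)) = (\<lambda>i j. 0)"
    "type_part2 J 1 (\<lambda>i j. complex_of_real (\<alpha> i j)) = (\<lambda>i j. complex_of_real (\<alpha> i j))"
    "type_part2 J 2 (\<lambda>i j. complex_of_real (\<alpha> i j)) = (\<lambda>i j. 0)"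
proof -
  define s where "s a = (if a then - \<i> else \<i>)" for a
  have e: "(\<Sum>k\<in>UNIV. \<Sum>l\<in>UNIV. type_proj J a k i * type_proj J b l j * complex_of_real (\<alpha> k l))
      = ((1 + s a * s b) * complex_of_real (\<alpha> i j)
         + (s a - s b) * slot_J J i (\<lambda>k. complex_of_real (\<alpha> k j))) / 4" (is "?l = ?r") for a b i j
  proof -
    have anti': "slot_J J j (\<lambda>l. complex_of_real (\<alpha> i l)) = - slot_J J i (\<lambda>k. complex_of_real (\<alpha> k j))" for i j
      by (simp only: of_real_slot_J anti of_real_minus)
    have inv': "slot_J J i (\<lambda>k. slot_J J j (\<lambda>l. complex_of_real (\<alpha> k l))) = complex_of_real (\<alpha> i j)" for i j
      by (simp only: of_real_slot_J inv)
    have "?l = (\<Sum>k\<in>UNIV. type_proj J a k i * (\<Sum>l\<in>UNIV. type_proj J b l j * complex_of_real (\<alpha> k l)))"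
      by (simp add: sum_distrib_left mult.assoc)
    also have "\<dots> = ((complex_of_real (\<alpha> i j) + s b * slot_J J j (\<lambda>l. complex_of_real (\<alpha> i l))) / 2
        + s a * ((slot_J J i (\<lambda>k. complex_of_real (\<alpha> k j)) + s b * complex_of_real (\<alpha> i j)) / 2)) / 2"
      by (simp only: sum_type_proj slot_J_linear inv' s_def)
    also have "\<dots> = ?r" unfolding anti' by (simp add: field_simps)
    finally show ?thesis .
  qed
  have S: "{(a, b). of_bool a + of_bool b = (0::nat)} = {(False, False)}"
    "{(a, b). of_bool a + of_bool b = (1::nat)} = {(True, False), (False, True)}"
    "{(a, b). of_bool a + of_bool b = (2::nat)} = {(True, True)}"
    by (auto split: if_splits simp: of_bool_def)
  show "type_part2 J 0 (\<lambda>i j. complex_of_real (\<alpha> i j)) = (\<lambda>i j. 0)"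
    "type_part2 J 1 (\<lambda>i j. complex_of_real (\<alpha> i j)) = (\<lambda>i j. complex_of_real (\<alpha> i j))"
    "type_part2 J 2 (\<lambda>i j. complex_of_real (\<alpha> i j)) = (\<lambda>i j. 0)"
    unfolding type_part2_def S by (simp_all add: e fun_eq_iff) (simp_all add: s_def field_simps)
qed

text \<open>J acts on 3-forms as a derivation and by pullback. Both actions are multiplication by
  \<i> on type (2,1) and by -\<i> on type (1,2), but on type (3,0) they are 3\<i> and -\<i>, and on
  type (0,3) the conjugates. Agreement of the two therefore excludes the extreme types, and \<i>
  times the (1,2)-part minus the (2,1)-part is minus the common value.\<close>

lemma type_part3_difference:
  fixes A :: "real cov3"
  assumes 1: "\<And>i j k. (\<Sum>l\<in>UNIV. J $ l $ i * A l j k) + (\<Sum>m\<in>UNIV. J $ m $ j * A i m k)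
      + (\<Sum>n\<in>UNIV. J $ n $ k * A i j n) = B i j k"
    and 2: "\<And>i j k. (\<Sum>l\<in>UNIV. J $ l $ i * (\<Sum>m\<in>UNIV. J $ m $ j * (\<Sum>n\<in>UNIV. J $ n $ k * A l m n))) = B i j k"
  shows "\<i> * (type_part3 J 1 (\<lambda>i j k. complex_of_real (A i j k)) i j k
      - type_part3 J 2 (\<lambda>i j k. complex_of_real (A i j k)) i j k) = - complex_of_real (B i j k)"
proof -
  define s where "s a = (if a then - \<i> else \<i>)" for a
  let ?A = "\<lambda>l m n. complex_of_real (A l m n)"
  define A1 where "A1 = slot_J J i (\<lambda>l. ?A l j k)"
  define A2 where "A2 = slot_J J j (\<lambda>m. ?A i m k)"
  define A3 where "A3 = slot_J J k (\<lambda>n. ?A i j n)"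
  define A12 where "A12 = slot_J J i (\<lambda>l. slot_J J j (\<lambda>m. ?A l m k))"
  define A13 where "A13 = slot_J J i (\<lambda>l. slot_J J k (\<lambda>n. ?A l j n))"
  define A23 where "A23 = slot_J J j (\<lambda>m. slot_J J k (\<lambda>n. ?A i m n))"
  have B1: "A1 + A2 + A3 = complex_of_real (B i j k)"
    unfolding A1_def A2_def A3_def of_real_slot_J of_real_add[symmetric] 1 ..
  have B2: "slot_J J i (\<lambda>l. slot_J J j (\<lambda>m. slot_J J k (\<lambda>n. ?A l m n))) = complex_of_real (B i j k)"
    by (simp only: of_real_slot_J 2)
  have e: "(\<Sum>l\<in>UNIV. \<Sum>m\<in>UNIV. \<Sum>n\<in>UNIV.
          type_proj J a l i * type_proj J b m j * type_proj J c n k * ?A l m n)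
      = (?A i j k + s a * A1 + s b * A2 + s c * A3
        + s a * s b * A12 + s a * s c * A13 + s b * s c * A23
        + s a * s b * s c * complex_of_real (B i j k)) / 8" (is "?l = ?r") for a b c
  proof -
    have "?l = (\<Sum>l\<in>UNIV. type_proj J a l i * (\<Sum>m\<in>UNIV. type_proj J b m j *
        (\<Sum>n\<in>UNIV. type_proj J c n k * ?A l m n)))"
      by (simp add: sum_distrib_left mult.assoc)
    also have "\<dots> = (((?A i j k + s c * A3) / 2 + s b * ((A2 + s c * A23) / 2)) / 2
        + s a * (((A1 + s c * A13) / 2 + s b * ((A12 + s c * complex_of_real (B i j k)) / 2)) / 2)) / 2"
      by (simp only: sum_type_proj slot_J_linear B2 s_def A1_def A2_def A3_def A12_def A13_def A23_def)
    also have "\<dots> = ?r" by (simp add: field_simps)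
    finally show ?thesis .
  qed
  have S: "{(a, b, c). of_bool a + of_bool b + of_bool c = (1::nat)}
      = {(True, False, False), (False, True, False), (False, False, True)}"
    "{(a, b, c). of_bool a + of_bool b + of_bool c = (2::nat)}
      = {(True, True, False), (True, False, True), (False, True, True)}"
    by (auto split: if_splits simp: of_bool_def)
  have "\<i> * (type_part3 J 1 (\<lambda>i j k. ?A i j k) i j k - type_part3 J 2 (\<lambda>i j k. ?A i j k) i j k)
      = - (A1 + A2 + A3) / 4 - 3 / 4 * complex_of_real (B i j k)"
    unfolding type_part3_def S by (simp add: e) (simp add: s_def field_simps)
  also have "\<dots> = - complex_of_real (B i j k)"
    unfolding B1 by (simp add: field_simps)
  finally show ?thesis .
qed

lemma of_real_ext_d2:
  fixes \<omega> :: "real^4 \<Rightarrow> real cov2"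
  assumes "\<And>i j. (\<lambda>y. \<omega> y i j) differentiable (at x)"
  shows "ext_d2 (\<lambda>y a b. complex_of_real (\<omega> y a b)) x
    = (\<lambda>i j k. complex_of_real (ext_d2 \<omega> x i j k))"
  by (simp add: fun_eq_iff ext_d2_def pd_linear[OF bounded_linear_of_real assms])

text \<open>For a form of type (1,1) only \<open>p = 1\<close> survives in \<open>del2\<close> and
  \<open>delbar2\<close>, which become the (2,1)- and (1,2)-parts of d\<omega>. The type conditions
  are assumed on a neighbourhood because the projections stand under the derivative.\<close>

lemma dc2_type_11:
  fixes \<omega> :: "real^4 \<Rightarrow> real cov2"
  assumes U: "open U" "x \<in> U" and diff: "\<And>i j. (\<lambda>y. \<omega> y i j) differentiable (at x)"
    and inv: "\<And>y i j. y \<in> U \<Longrightarrow> (\<Sum>k\<in>UNIV. J y $ k $ i * (\<Sum>l\<in>UNIV. J y $ l $ j * \<omega> y k l)) = \<omega> y i j"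
    and anti: "\<And>y i j. y \<in> U \<Longrightarrow> (\<Sum>l\<in>UNIV. J y $ l $ j * \<omega> y i l) = - (\<Sum>k\<in>UNIV. J y $ k $ i * \<omega> y k j)"
  shows "dc2 J \<omega> x i j k = \<i> * (type_part3 (J x) 1 (\<lambda>i j k. complex_of_real (ext_d2 \<omega> x i j k)) i j k
      - type_part3 (J x) 2 (\<lambda>i j k. complex_of_real (ext_d2 \<omega> x i j k)) i j k)"
proof -
  have cong: "ext_d2 \<alpha> x = ext_d2 \<beta> x" if "\<And>y. y \<in> U \<Longrightarrow> \<alpha> y = \<beta> y" for \<alpha> \<beta> :: "real^4 \<Rightarrow> complex cov2"
    unfolding ext_d2_def fun_eq_iff by (auto intro!: arg_cong2[of _ _ _ _ "(+)"] arg_cong2[of _ _ _ _ "(-)"] pd_cong[OF U] simp: that)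
  have z: "ext_d2 (\<lambda>y i j. 0) x = (\<lambda>i j k. 0 :: complex)" by (simp add: ext_d2_def fun_eq_iff)
  let ?c = "\<lambda>y a b. complex_of_real (\<omega> y a b)"
  have d0: "ext_d2 (\<lambda>y. type_part2 (J y) 0 (?c y)) x = (\<lambda>i j k. 0)"
    by (subst z[symmetric], rule cong) (rule type_part2_expand(1)[OF inv anti])
  have d2: "ext_d2 (\<lambda>y. type_part2 (J y) 2 (?c y)) x = (\<lambda>i j k. 0)"
    by (subst z[symmetric], rule cong) (rule type_part2_expand(3)[OF inv anti])
  have d1: "ext_d2 (\<lambda>y. type_part2 (J y) 1 (?c y)) x = (\<lambda>i j k. complex_of_real (ext_d2 \<omega> x i j k))"
    by (subst of_real_ext_d2[OF diff, symmetric], rule cong) (rule type_part2_expand(2)[OF inv anti])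
  have t0: "type_part3 J' p (\<lambda>i j k. 0) i j k = 0" for J' p by (simp add: type_part3_def)
  have S: "(\<Sum>p\<le>2. f p) = f 0 + f 1 + f (2::nat)" for f :: "nat \<Rightarrow> complex"
    by (simp add: numeral_2_eq_2)
  have "del2 J ?c x i j k = type_part3 (J x) 2 (\<lambda>i j k. complex_of_real (ext_d2 \<omega> x i j k)) i j k"
    unfolding del2_def S d0 d1 d2 t0 by (simp add: numeral_2_eq_2)
  moreover have "delbar2 J ?c x i j k = type_part3 (J x) 1 (\<lambda>i j k. complex_of_real (ext_d2 \<omega> x i j k)) i j k"
    unfolding delbar2_def S d0 d1 d2 t0 by simp
  ultimately show ?thesis by (simp add: dc2_def)
qed

section \<open>Hermitian metrics at a point\<close>

lemma matrix_mul_lneg: "(- A) ** B = - (A ** (B :: real^'n^'m))"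
  by (simp add: matrix_matrix_mult_def vec_eq_iff sum_negf)

lemma matrix_mul_rneg: "A ** (- B) = - (A ** (B :: real^'n^'m))"
  by (simp add: matrix_matrix_mult_def vec_eq_iff sum_negf)

lemma matrix_vector_mul_lneg: "(- A) *v v = - ((A :: real^'n^'m) *v v)"
  by (simp add: matrix_vector_mult_def vec_eq_iff sum_negf)

lemma matrix_vector_mul_rneg: "A *v (- v) = - ((A :: real^'n^'m) *v v)"
  by (simp add: matrix_vector_mult_def vec_eq_iff sum_negf)

lemma matrix_mul_add_left: "(A + B) ** C = A ** C + B ** (C :: real^'n^'m)"
  by (simp add: matrix_matrix_mult_def vec_eq_iff sum.distrib distrib_right)

lemma matrix_mul_scaleR_left: "(r *\<^sub>R A) ** B = r *\<^sub>R (A ** (B :: real^'n^'m))"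
  by (simp add: matrix_matrix_mult_def vec_eq_iff sum_distrib_left mult.assoc)

lemma matrix_mul_scaleR_right: "A ** (r *\<^sub>R B) = r *\<^sub>R (A ** (B :: real^'n^'m))"
  by (simp add: matrix_matrix_mult_def vec_eq_iff sum_distrib_left mult.left_commute)

lemma transpose_uminus: "transpose (- A) = - transpose (A :: real^'n^'m)"
  by (simp add: transpose_def vec_eq_iff)

lemma skew_matrix_nth:
  assumes "transpose A = - (A :: real^'n^'n)"
  shows "A $ i $ j = - A $ j $ i"
  using arg_cong[OF assms, of "\<lambda>A. A $ j $ i"] by (simp add: transpose_def)

section \<open>The 2-form and the bivector of a Hermitian structure\<close>

definition hermitian_form :: "real^4^4 \<Rightarrow> real^4^4 \<Rightarrow> real cov2" where
  "hermitian_form g J i j = (J *v axis i 1) \<bullet> (g *v axis j 1)"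

text \<open>This is \<omega> with both indices raised by the metric
  (\<open>raise_form_both\<close>), and also minus the inverse of \<omega>.\<close>

definition hermitian_bivector :: "real^4^4 \<Rightarrow> real^4^4 \<Rightarrow> real cov2" where
  "hermitian_bivector g J i j = (matrix_inv g ** transpose J) $ i $ j"

locale hermitian =
  fixes g J :: "real^4^4"
  assumes sym: "transpose g = g"
    and pos: "v \<noteq> 0 \<Longrightarrow> v \<bullet> (g *v v) > 0"
    and J_J: "J ** J = - mat 1"
    and J_g_J: "transpose J ** g ** J = g"
begin

lemma invertible: "invertible g"
proof -
  have "v = 0" if "g *v v = 0" for v
    using pos[of v] that by fastforce
  then show ?thesis by (simp add: invertible_left_inverse matrix_left_invertible_ker)
qed

lemma sym_nth: "g $ i $ j = g $ j $ i"
  using arg_cong[OF sym, of "\<lambda>A. A $ j $ i"] by (simp add: transpose_def)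

lemma sym_inv: "transpose (matrix_inv g) = matrix_inv g"
proof -
  have "transpose (matrix_inv g) ** g = transpose (g ** matrix_inv g)"
    by (simp add: matrix_transpose_mul sym)
  then have 1: "transpose (matrix_inv g) ** g = mat 1"
    by (simp add: matrix_inv_mult[OF invertible])
  have "transpose (matrix_inv g) = transpose (matrix_inv g) ** (g ** matrix_inv g)"
    by (simp add: matrix_inv_mult[OF invertible])
  also have "\<dots> = matrix_inv g" by (simp add: matrix_mul_assoc 1)
  finally show ?thesis .
qed

lemma sym_inv_nth: "matrix_inv g $ i $ j = matrix_inv g $ j $ i"
  using arg_cong[OF sym_inv, of "\<lambda>A. A $ j $ i"] by (simp add: transpose_def)

lemma tJ_tJ: "transpose J ** transpose J = - mat 1"
  by (simp add: matrix_transpose_mul[symmetric] J_J transpose_uminus)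

lemma tJ_g: "transpose J ** g = - (g ** J)"
proof -
  have "g ** J = transpose J ** g ** (J ** J)"
    by (simp only: matrix_mul_assoc J_g_J)
  also have "\<dots> = - (transpose J ** g)"
    by (simp only: J_J matrix_mul_rneg matrix_mul_rid)
  finally show ?thesis by simp
qed

lemma inv_tJ: "matrix_inv g ** transpose J = - (J ** matrix_inv g)"
proof -
  have "matrix_inv g ** transpose J = matrix_inv g ** (transpose J ** g) ** matrix_inv g"
    by (metis matrix_mul_assoc matrix_inv_mult(1)[OF invertible] matrix_mul_rid)
  also have "\<dots> = - (matrix_inv g ** g ** J ** matrix_inv g)"
    by (simp only: tJ_g matrix_mul_rneg matrix_mul_lneg matrix_mul_assoc)
  finally show ?thesis by (simp add: matrix_inv_mult[OF invertible])
qed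

lemma form_matrix: "hermitian_form g J i j = (transpose J ** g) $ i $ j"
  by (simp add: hermitian_form_def matrix_vector_mult_basis column_def inner_vec_def
      matrix_matrix_mult_def transpose_def)

lemma form_sum: "hermitian_form g J i j = (\<Sum>m\<in>UNIV. J $ m $ i * g $ m $ j)"
  by (simp add: form_matrix matrix_matrix_mult_def transpose_def)

lemma bivector_sum: "hermitian_bivector g J a b = (\<Sum>p\<in>UNIV. matrix_inv g $ a $ p * J $ b $ p)"
  by (simp add: hermitian_bivector_def matrix_matrix_mult_def transpose_def)

lemma bivector_sum': "hermitian_bivector g J a b = - (\<Sum>p\<in>UNIV. J $ a $ p * matrix_inv g $ p $ b)"
  by (simp add: hermitian_bivector_def inv_tJ) (simp add: matrix_matrix_mult_def)

lemma form_J_left: "(\<Sum>k\<in>UNIV. J $ k $ i * hermitian_form g J k j) = - g $ i $ j"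
proof -
  have "(\<Sum>k\<in>UNIV. J $ k $ i * hermitian_form g J k j) = (transpose J ** (transpose J ** g)) $ i $ j"
    by (simp add: form_matrix) (simp add: matrix_matrix_mult_def transpose_def)
  also have "\<dots> = - g $ i $ j"
    by (simp add: matrix_mul_assoc tJ_tJ matrix_mul_lneg)
  finally show ?thesis .
qed

lemma form_J_right: "(\<Sum>k\<in>UNIV. J $ k $ j * hermitian_form g J i k) = g $ i $ j"
proof -
  have "(\<Sum>k\<in>UNIV. J $ k $ j * hermitian_form g J i k) = (transpose J ** g ** J) $ i $ j"
    unfolding form_matrix by (simp add: matrix_matrix_mult_def[of _ J] mult.commute)
  then show ?thesis by (simp add: J_g_J)
qed

text \<open>The metric and its inverse cancel in the product of bivector and form up to a factor J^2
  = -1, which is the source of the sign in \<open>skew_inverse\<close>.\<close>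

sublocale skew_inverse "hermitian_form g J" "hermitian_bivector g J"
proof
  have "transpose (transpose J ** g) = - (transpose J ** g)"
    by (simp only: matrix_transpose_mul transpose_transpose sym) (simp add: tJ_g)
  then show "hermitian_form g J i j = - hermitian_form g J j i" for i j
    unfolding form_matrix by (rule skew_matrix_nth)
  have "transpose (matrix_inv g ** transpose J) = - (matrix_inv g ** transpose J)"
    by (simp only: matrix_transpose_mul transpose_transpose sym_inv) (simp add: inv_tJ)
  then show "hermitian_bivector g J i j = - hermitian_bivector g J j i" for i j
    unfolding hermitian_bivector_def by (rule skew_matrix_nth)
  have "(matrix_inv g ** transpose J) ** (transpose J ** g) = matrix_inv g ** (transpose J ** transpose J) ** g"
    by (simp only: matrix_mul_assoc)
  also have "\<dots> = - mat 1"
    by (simp add: tJ_tJ matrix_mul_rneg matrix_mul_lneg matrix_inv_mult[OF invertible])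
  finally have W: "(matrix_inv g ** transpose J) ** (transpose J ** g) = - mat 1" .
  show "(\<Sum>b\<in>UNIV. hermitian_bivector g J a b * hermitian_form g J b c) = - of_bool (a = c)" for a c
    using arg_cong[OF W, of "\<lambda>A. A $ a $ c"]
    by (simp only: matrix_matrix_mult_def[of "matrix_inv g ** transpose J"] vec_lambda_beta
        hermitian_bivector_def form_matrix vector_uminus_component mat_1_nth)
qed

lemma covector_J: "(\<theta> v* J) $ i = (\<Sum>l\<in>UNIV. J $ l $ i * \<theta> $ l)"
  by (simp add: vector_matrix_mult_def mult.commute)

text \<open>Since \<omega> has type (1,1), J annihilates it as a derivation and preserves it under
  pullback; either way \<theta> is merely replaced by its composition with J. These are the two
  hypotheses of \<open>type_part3_difference\<close>.\<close>

lemma wedge12_slot_J: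
  fixes \<theta> :: "real^4"
  defines "A \<equiv> wedge12 \<theta> (hermitian_form g J)" and "B \<equiv> wedge12 (\<theta> v* J) (hermitian_form g J)"
  shows "(\<Sum>l\<in>UNIV. J $ l $ i * A l j k) + (\<Sum>m\<in>UNIV. J $ m $ j * A i m k)
      + (\<Sum>n\<in>UNIV. J $ n $ k * A i j n) = B i j k"
    and "(\<Sum>l\<in>UNIV. J $ l $ i * (\<Sum>m\<in>UNIV. J $ m $ j * (\<Sum>n\<in>UNIV. J $ n $ k * A l m n))) = B i j k"
proof -
  let ?\<omega> = "hermitian_form g J" and ?\<eta> = "\<theta> v* J"
  have sumJ: "(\<Sum>l\<in>UNIV. J $ l $ i * (x l * a - y l * b + z l * c))
      = (\<Sum>l\<in>UNIV. J $ l $ i * x l) * a - (\<Sum>l\<in>UNIV. J $ l $ i * y l) * b + (\<Sum>l\<in>UNIV. J $ l $ i * z l) * c"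
    for i x y z a b c
    by (simp add: ring_distribs sum.distrib sum_subtractf sum_distrib_right mult.assoc)
  note fs = form_sum[symmetric]
  have 1: "(\<Sum>l\<in>UNIV. J $ l $ i * A l j k) = ?\<eta> $ i * ?\<omega> j k + \<theta> $ j * g $ i $ k - \<theta> $ k * g $ i $ j" for i j k
    using sumJ[of i "\<lambda>l. \<theta> $ l" "?\<omega> j k" "\<lambda>l. ?\<omega> l k" "\<theta> $ j" "\<lambda>l. ?\<omega> l j" "\<theta> $ k"]
    by (simp add: A_def wedge12_def covector_J form_J_left mult.commute[of "\<theta> $ _"])
  have 2: "(\<Sum>m\<in>UNIV. J $ m $ j * A i m k) = - \<theta> $ i * g $ j $ k - ?\<eta> $ j * ?\<omega> i k + \<theta> $ k * g $ i $ j" for i j k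
    using sumJ[of j "\<lambda>m. ?\<omega> m k" "\<theta> $ i" "\<lambda>m. \<theta> $ m" "?\<omega> i k" "\<lambda>m. ?\<omega> i m" "\<theta> $ k"]
    by (simp add: A_def wedge12_def covector_J form_J_left form_J_right mult.commute[of "\<theta> $ _"])
  have 3: "(\<Sum>n\<in>UNIV. J $ n $ k * A i j n) = \<theta> $ i * g $ j $ k - \<theta> $ j * g $ i $ k + ?\<eta> $ k * ?\<omega> i j" for i j k
    using sumJ[of k "\<lambda>n. ?\<omega> j n" "\<theta> $ i" "\<lambda>n. ?\<omega> i n" "\<theta> $ j" "\<lambda>n. \<theta> $ n" "?\<omega> i j"]
    by (simp add: A_def wedge12_def covector_J form_J_right mult.commute[of "\<theta> $ _"])
  show "(\<Sum>l\<in>UNIV. J $ l $ i * A l j k) + (\<Sum>m\<in>UNIV. J $ m $ j * A i m k)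
      + (\<Sum>n\<in>UNIV. J $ n $ k * A i j n) = B i j k"
    unfolding 1 2 3 by (simp add: B_def wedge12_def)
  have 4: "(\<Sum>m\<in>UNIV. J $ m $ j * (\<theta> $ l * g $ m $ k - \<theta> $ m * g $ l $ k + ?\<eta> $ k * ?\<omega> l m))
      = \<theta> $ l * ?\<omega> j k - ?\<eta> $ j * g $ l $ k + ?\<eta> $ k * g $ l $ j" for l j k
    using sumJ[of j "\<lambda>m. g $ m $ k" "\<theta> $ l" "\<lambda>m. \<theta> $ m" "g $ l $ k" "\<lambda>m. ?\<omega> l m" "?\<eta> $ k"]
    by (simp only: covector_J[symmetric] form_J_right fs mult.commute[of "?\<eta> $ k"] mult.commute[of "\<theta> $ l"])
  have 5: "(\<Sum>l\<in>UNIV. J $ l $ i * (\<theta> $ l * ?\<omega> j k - ?\<eta> $ j * g $ l $ k + ?\<eta> $ k * g $ l $ j)) = B i j k"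
    using sumJ[of i "\<lambda>l. \<theta> $ l" "?\<omega> j k" "\<lambda>l. g $ l $ k" "?\<eta> $ j" "\<lambda>l. g $ l $ j" "?\<eta> $ k"]
    by (simp only: B_def wedge12_def covector_J[symmetric] fs mult.commute[of "?\<eta> $ k"] mult.commute[of "?\<eta> $ j"])
  show "(\<Sum>l\<in>UNIV. J $ l $ i * (\<Sum>m\<in>UNIV. J $ m $ j * (\<Sum>n\<in>UNIV. J $ n $ k * A l m n))) = B i j k"
    unfolding 3 4 5 ..
qed

end

section \<open>Two Hermitian structures for the same metric\<close>

text \<open>The vector \<open>v\<close> with \<open>\<alpha> = \<iota>\<^sub>v(dx\<^sup>1 \<and> dx\<^sup>2 \<and> dx\<^sup>3 \<and> dx\<^sup>4)\<close>.\<close>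

definition dual_vector :: "real cov3 \<Rightarrow> 4 \<Rightarrow> real" where
  "dual_vector \<alpha> a = (if a = 1 then \<alpha> 2 3 4 else if a = 2 then - \<alpha> 1 3 4
     else if a = 3 then \<alpha> 1 2 4 else - \<alpha> 1 2 3)"

lemma dual_vector_wedge12:
  fixes \<omega> :: "real cov2"
  assumes "\<And>i j. \<omega> i j = - \<omega> j i"
  shows "dual_vector (wedge12 \<eta> \<omega>) a = (\<Sum>b\<in>UNIV. skew_dual \<omega> a b * \<eta> $ b)"
proof -
  have "\<forall>a. dual_vector (wedge12 \<eta> \<omega>) a = (\<Sum>b\<in>UNIV. skew_dual \<omega> a b * \<eta> $ b)"
    by (simp add: forall_4 sum_4 dual_vector_def skew_dual_def wedge12_def skew_expand[of \<omega>, OF assms]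
        algebra_simps)
  then show ?thesis by blast
qed

context hermitian
begin

lemma bivector_covector_J:
  "(\<Sum>b\<in>UNIV. hermitian_bivector g J a b * (\<theta> v* J) $ b) = - (matrix_inv g *v \<theta>) $ a"
proof -
  have "(\<Sum>b\<in>UNIV. hermitian_bivector g J a b * (\<theta> v* J) $ b)
      = ((matrix_inv g ** transpose J) *v (transpose J *v \<theta>)) $ a"
    by (simp only: matrix_vector_mult_def[of "matrix_inv g ** transpose J"] vec_lambda_beta
        hermitian_bivector_def transpose_matrix_vector)
  also have "\<dots> = - (matrix_inv g *v \<theta>) $ a"
    by (simp only: matrix_vector_mul_assoc matrix_mul_assoc[symmetric] tJ_tJ matrix_mul_rneg matrix_mul_rid)
      (simp add: matrix_vector_mult_def sum_negf)
  finally show ?thesis .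
qed

text \<open>The Pfaffian is a square root of det g, so this is the Hodge star identity between the
  3-form and \<theta>; its sign is the orientation defined by J.\<close>

lemma dual_vector_J:
  "dual_vector (wedge12 (\<theta> v* J) (hermitian_form g J)) a
    = - (pfaffian (hermitian_form g J) * (matrix_inv g *v \<theta>) $ a)"
  by (simp only: dual_vector_wedge12[OF skew] skew_dual_eq mult.assoc sum_distrib_left[symmetric]
      bivector_covector_J mult_minus_right)

end

text \<open>With \<open>a\<close> and \<open>b\<close> the Pfaffians for \<open>I\<close> and
  \<open>J\<close>, polarization gives a IJ + b JI = c. The same relation holds with IJ and JI
  interchanged, so a - b annihilates the commutator.\<close>

lemma pfaffian_eq_of_noncommuting:
  assumes "hermitian g I" "hermitian g J" and nc: "I ** J \<noteq> J ** I"
  shows "pfaffian (hermitian_form g I) = pfaffian (hermitian_form g J)"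
proof -
  interpret I: hermitian g I by fact
  interpret J: hermitian g J by fact
  let ?a = "pfaffian (hermitian_form g I)" and ?b = "pfaffian (hermitian_form g J)"
  \<comment> \<open>Moving the transposes of \<open>K\<close> and \<open>L\<close> across the metric
    produces two signs that cancel, and the metric disappears.\<close>
  have prod: "(\<Sum>j\<in>UNIV. skew_dual (hermitian_form g K) i j * hermitian_form g L j k)
      = pfaffian (hermitian_form g K) * (K ** L) $ i $ k" if K: "hermitian g K" and L: "hermitian g L" for K L i k
  proof -
    interpret K: hermitian g K by fact
    interpret L: hermitian g L by fact
    have "(matrix_inv g ** transpose K) ** (transpose L ** g) = (K ** matrix_inv g) ** (g ** L)"
      by (simp only: K.inv_tJ L.tJ_g matrix_mul_lneg matrix_mul_rneg minus_minus)
    also have "\<dots> = K ** (matrix_inv g ** g) ** L" by (simp only: matrix_mul_assoc)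
    also have "\<dots> = K ** L" by (simp only: matrix_inv_mult(2)[OF K.invertible] matrix_mul_rid)
    finally have *: "(matrix_inv g ** transpose K) ** (transpose L ** g) = K ** L" .
    show ?thesis
      by (simp only: K.skew_dual_eq mult.assoc sum_distrib_left[symmetric] hermitian_bivector_def
          L.form_matrix *[symmetric] matrix_matrix_mult_def[of "matrix_inv g ** transpose K"] vec_lambda_beta)
  qed
  obtain c where c: "?a * (I ** J) $ i $ k + ?b * (J ** I) $ i $ k = c * of_bool (i = k)" for i k
    using skew_dual_polarized[of "hermitian_form g I" "hermitian_form g J", OF I.skew J.skew]
    unfolding prod[OF assms(1,2)] prod[OF assms(2,1)] by blast
  have c1: "?a *\<^sub>R (I ** J) + ?b *\<^sub>R (J ** I) = c *\<^sub>R mat 1"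
    using c by (simp add: vec_eq_iff mat_1_nth)
  text \<open>Conjugation by \<open>I\<close> interchanges \<open>I J\<close> and \<open>J I\<close>.\<close>
  have "I ** (?a *\<^sub>R (I ** J) + ?b *\<^sub>R (J ** I)) ** I = c *\<^sub>R (I ** I)"
    by (simp only: c1 matrix_mul_scaleR_left matrix_mul_scaleR_right matrix_mul_rid)
  moreover have "I ** (?a *\<^sub>R (I ** J) + ?b *\<^sub>R (J ** I)) ** I
      = ?a *\<^sub>R ((I ** I) ** (J ** I)) + ?b *\<^sub>R (I ** J ** (I ** I))"
    by (simp only: matrix_add_ldistrib matrix_mul_add_left matrix_mul_scaleR_left
        matrix_mul_scaleR_right matrix_mul_assoc)
  ultimately have conj: "?a *\<^sub>R (- (J ** I)) + ?b *\<^sub>R (- (I ** J)) = c *\<^sub>R (- mat 1)"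
    by (simp only: I.J_J matrix_mul_lneg matrix_mul_rneg matrix_mul_lid matrix_mul_rid)
  obtain i k where ik: "(I ** J) $ i $ k \<noteq> (J ** I) $ i $ k"
    using nc by (auto simp: vec_eq_iff)
  have "?a * (J ** I) $ i $ k + ?b * (I ** J) $ i $ k = c * of_bool (i = k)"
    using arg_cong[OF conj, of "\<lambda>A. A $ i $ k"]
    by (simp only: vector_add_component vector_scaleR_component vector_uminus_component mat_1_nth
        real_scaleR_def mult_minus_right)
  then have "(?a - ?b) * ((I ** J) $ i $ k - (J ** I) $ i $ k) = 0"
    using c[of i k] by (simp only: left_diff_distrib right_diff_distrib)
  then show ?thesis using ik by simp
qed

text \<open>Both expressions for \<open>H\<close> are read through \<open>dual_vector\<close>: each
  gives the metric dual of its Lee form times a Pfaffian, and the two Pfaffians are equal and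
  nonzero.\<close>

lemma opposite_lee_forms:
  assumes I: "hermitian g I" and J: "hermitian g J" and nc: "I ** J \<noteq> J ** I"
    and eq: "\<And>i j k. wedge12 (\<theta> v* I) (hermitian_form g I) i j k = - wedge12 (\<eta> v* J) (hermitian_form g J) i j k"
  shows "matrix_inv g *v \<eta> = - (matrix_inv g *v \<theta>)"
proof -
  interpret I: hermitian g I by fact
  interpret J: hermitian g J by fact
  have "dual_vector (wedge12 (\<theta> v* I) (hermitian_form g I)) a
      = - dual_vector (wedge12 (\<eta> v* J) (hermitian_form g J)) a" for a
    by (simp add: dual_vector_def eq)
  then have "pfaffian (hermitian_form g I) * (matrix_inv g *v \<theta>) $ a
      = - (pfaffian (hermitian_form g I) * (matrix_inv g *v \<eta>) $ a)" for a
    unfolding I.dual_vector_J J.dual_vector_J pfaffian_eq_of_noncommuting[OF I J nc]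
    by (metis minus_minus)
  then have "pfaffian (hermitian_form g I) * ((matrix_inv g *v \<theta>) $ a + (matrix_inv g *v \<eta>) $ a) = 0" for a
    by (simp add: distrib_left)
  then show ?thesis
    using I.pfaffian_nonzero by (simp add: vec_eq_iff eq_neg_iff_add_eq_0 add.commute)
qed

text \<open>Both images are the \<open>g\<close>-orthogonal complement of the span.\<close>

lemma image_span_eq:
  fixes g I J :: "real^4^4" and q w :: "real^4"
  assumes I: "hermitian g I" and J: "hermitian g J"
    and orth: "w \<bullet> (g *v (I *v q)) = 0" "w \<bullet> (g *v (J *v q)) = 0"
    and X: "X = (1/2) *\<^sub>R (I *v (q - w))" and Y: "Y = (1/2) *\<^sub>R (J *v (- q - w))"
    and dim: "dim (span {X, Y}) = 2"
  shows "(*v) I ` span {X, Y} = (*v) J ` span {X, Y}"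
proof -
  interpret I: hermitian g I by fact
  interpret J: hermitian g J by fact
  \<comment> \<open>Euclidean orthogonality to the image under \<open>g\<close> is
    \<open>g\<close>-orthogonality to the span, so the dimension formula for Euclidean complements
    applies.\<close>
  define P where "P = {y \<in> UNIV. \<forall>x \<in> (*v) g ` span {X, Y}. orthogonal x y}"
  have sym: "u \<bullet> (g *v v) = v \<bullet> (g *v u)" for u v
    by (metis I.sym dot_lmul_matrix inner_commute transpose_matrix_vector)
  have skew: "u \<bullet> (g *v (K *v v)) = - (v \<bullet> (g *v (K *v u)))" if "hermitian g K" for K u v
  proof -
    interpret K: hermitian g K by fact
    have "u \<bullet> (g *v (K *v v)) = - (u \<bullet> ((transpose K ** g) *v v))"
      by (simp only: K.tJ_g matrix_vector_mul_assoc) (simp add: matrix_vector_mult_def sum_negf inner_vec_def)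
    also have "u \<bullet> ((transpose K ** g) *v v) = (K *v u) \<bullet> (g *v v)"
      by (metis dot_lmul_matrix inner_commute matrix_vector_mul_assoc transpose_matrix_vector)
    finally show ?thesis by (simp add: sym)
  qed
  have skew0: "u \<bullet> (g *v (K *v u)) = 0" if "hermitian g K" for K u
    using skew[OF that, of u u] by simp
  have KK: "K *v (K *v u) = - u" if "hermitian g K" for K u
    using hermitian.J_J[OF that] by (simp add: matrix_vector_mul_assoc matrix_vector_mul_lneg)
  \<comment> \<open>Up to a factor this is the pairing of \<open>q + w\<close> with I(q - w): the
    diagonal terms vanish, and the mixed ones are both equal to
    \<open>w \<bullet> (g *v (I *v q))\<close> because I is skew.\<close>
  have XJY: "X \<bullet> (g *v (J *v Y)) = 0"
  proof -
    have "J *v Y = (1/2) *\<^sub>R (q + w)"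
      unfolding Y by (simp add: matrix_vector_mult_scaleR KK[OF J])
    then have "X \<bullet> (g *v (J *v Y)) = (1/4) * ((q + w) \<bullet> (g *v (I *v (q - w))))"
      unfolding X by (subst sym) (simp add: matrix_vector_mult_scaleR)
    also have "\<dots> = 0"
      using orth(1) skew[OF I, of q w] skew0[OF I]
      by (simp add: inner_add_left matrix_vector_mult_diff_distrib inner_diff_right)
    finally show ?thesis .
  qed
  have YIX: "Y \<bullet> (g *v (I *v X)) = 0"
  proof -
    have "I *v X = (1/2) *\<^sub>R (w - q)"
      unfolding X by (simp add: matrix_vector_mult_scaleR KK[OF I] algebra_simps)
    then have "Y \<bullet> (g *v (I *v X)) = (1/4) * ((w - q) \<bullet> (g *v (J *v (- q - w))))"
      unfolding Y by (subst sym) (simp add: matrix_vector_mult_scaleR)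
    also have "\<dots> = 0"
      using orth(2) skew[OF J, of q w] skew0[OF J]
      by (simp add: inner_diff_left matrix_vector_mult_diff_distrib inner_diff_right matrix_vector_mul_rneg)
    finally show ?thesis .
  qed
  \<comment> \<open>As \<open>K\<close> is skew, X is automatically orthogonal to K X and Y to K Y,
    so one mixed pairing gives the inclusion. Equality follows since image and complement both have
    dimension 2 in dimension 4.\<close>
  have image_K: "(*v) K ` span {X, Y} = P" if K: "hermitian g K"
    and XKY: "X \<bullet> (g *v (K *v Y)) = 0" for K
  proof -
    have YKX: "Y \<bullet> (g *v (K *v X)) = 0" using XKY skew[OF K, of X Y] by simp
    have inj: "inj ((*v) K)"
      by (rule inj_on_inverseI[of _ "\<lambda>v. - (K *v v)"]) (simp add: KK[OF K])
    have inj_g: "inj ((*v) g)"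
      by (rule inj_matrix_vector_mult[OF I.invertible])
    have sub: "subspace P"
      unfolding P_def subspace_def orthogonal_def by (auto simp: inner_add_right)
    have "dim P + dim ((*v) g ` span {X, Y}) = dim (UNIV :: (real^4) set)"
      unfolding P_def
      by (rule dim_subspace_orthogonal_to_vectors)
        (auto intro: linear_subspace_image matrix_vector_mul_linear)
    moreover have "dim ((*v) g ` span {X, Y}) = 2"
      using dim_image_eq[OF matrix_vector_mul_linear inj_on_subset[OF inj_g subset_UNIV]] dim by metis
    ultimately have dimP: "dim P = 2" by simp
    have le: "(*v) K ` span {X, Y} \<subseteq> P"
    proof
      fix y assume "y \<in> (*v) K ` span {X, Y}"
      then obtain a b where y: "y = K *v (a *\<^sub>R X + b *\<^sub>R Y)"
        by (auto simp: span_insert span_breakdown_eq algebra_simps)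
      have "orthogonal (g *v u) y" if u: "u \<in> span {X, Y}" for u
      proof -
        obtain c d where u: "u = c *\<^sub>R X + d *\<^sub>R Y"
          using u by (auto simp: span_insert span_breakdown_eq algebra_simps)
        have "(g *v u) \<bullet> y = u \<bullet> (g *v y)" by (subst sym) (rule inner_commute)
        also have "\<dots> = 0"
          unfolding u y using XKY YKX skew0[OF K]
          by (simp add: matrix_vector_right_distrib matrix_vector_mult_scaleR inner_add_left inner_add_right)
        finally show ?thesis by (simp add: orthogonal_def)
      qed
      then show "y \<in> P" by (auto simp: P_def)
    qed
    have "dim ((*v) K ` span {X, Y}) = 2"
      using dim_image_eq[OF matrix_vector_mul_linear inj_on_subset[OF inj subset_UNIV]] dim by metis
    then show ?thesis
      using subspace_dim_equal[OF _ sub le] dimP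
      by (auto intro: linear_subspace_image matrix_vector_mul_linear)
  qed
  have "X \<bullet> (g *v (I *v Y)) = 0" using YIX skew[OF I, of X Y] by simp
  then show ?thesis using image_K[OF I] image_K[OF J XJY] by simp
qed

section \<open>The skew part of the Ricci tensor of a connection with torsion\<close>

lemma sum_skew_zero:
  fixes f :: "'n::finite \<Rightarrow> 'n \<Rightarrow> real"
  assumes "\<And>a b. f a b = - f b a"
  shows "(\<Sum>a\<in>UNIV. \<Sum>b\<in>UNIV. f a b) = 0"
proof -
  have "(\<Sum>a\<in>UNIV. \<Sum>b\<in>UNIV. f a b) = (\<Sum>a\<in>UNIV. \<Sum>b\<in>UNIV. - f b a)"
    by (intro sum.cong refl assms)
  also have "\<dots> = - (\<Sum>b\<in>UNIV. \<Sum>a\<in>UNIV. f b a)" by (subst sum.swap) (simp add: sum_negf)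
  finally show ?thesis by simp
qed

text \<open>Antisymmetrization in \<open>j\<close> and \<open>k\<close> removes the Hessian of the
  function, the derivatives of the Levi-Civita part and, by \<open>d\<kappa>\<close>, the derivative
  of the trace of the connection.\<close>

lemma skew_ricci_hessian:
  fixes L T G :: "real cov3" and dL dT dG :: "4 \<Rightarrow> real cov3" and h :: "real cov2" and u \<kappa> :: "4 \<Rightarrow> real"
  assumes G: "\<And>k i j. G k i j = L k i j + T k i j / 2"
    and dG: "\<And>a k i j. dG a k i j = dL a k i j + dT a k i j / 2"
    and L: "\<And>k i j. L k i j = L k j i" and T: "\<And>k i j. T k i j = - T k j i"
    and dL: "\<And>a k i j. dL a k i j = dL a k j i" and dT: "\<And>a k i j. dT a k i j = - dT a k j i"
    and \<kappa>: "\<And>m. (\<Sum>i\<in>UNIV. G i i m) = \<kappa> m"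
    and d\<kappa>: "\<And>j k. (\<Sum>i\<in>UNIV. dG j i i k) = (\<Sum>i\<in>UNIV. dG k i i j)"
    and h: "\<And>j k. h j k = h k j"
    and eq: "\<And>j k. (\<Sum>i\<in>UNIV. dG i i j k - dG j i i k + (\<Sum>m\<in>UNIV. G i i m * G m j k - G i j m * G m i k))
        + (h j k - (\<Sum>m\<in>UNIV. G m j k * u m)) = 0"
  shows "(\<Sum>i\<in>UNIV. dT i i j k) + (\<Sum>m\<in>UNIV. \<kappa> m * T m j k)
      - (\<Sum>i\<in>UNIV. \<Sum>m\<in>UNIV. L i j m * T m i k) + (\<Sum>i\<in>UNIV. \<Sum>m\<in>UNIV. L i k m * T m i j)
      = (\<Sum>m\<in>UNIV. T m j k * u m)"
proof -
  have R: "(\<Sum>i\<in>UNIV. \<Sum>m\<in>UNIV. G i i m * G m j k) = (\<Sum>m\<in>UNIV. \<kappa> m * G m j k)" for j k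
    by (subst sum.swap) (simp only: sum_distrib_right[symmetric] \<kappa>)
  have e: "(\<Sum>i\<in>UNIV. dG i i j k) - (\<Sum>i\<in>UNIV. dG j i i k) + (\<Sum>m\<in>UNIV. \<kappa> m * G m j k)
      - (\<Sum>i\<in>UNIV. \<Sum>m\<in>UNIV. G i j m * G m i k) + (h j k - (\<Sum>m\<in>UNIV. G m j k * u m)) = 0" for j k
    using eq[of j k] by (simp add: sum.distrib sum_subtractf R[symmetric])
  have 1: "(\<Sum>i\<in>UNIV. dG i i j k) - (\<Sum>i\<in>UNIV. dG i i k j) = (\<Sum>i\<in>UNIV. dT i i j k)"
    by (simp only: sum_subtractf[symmetric])
      (rule sum.cong, use dL[of _ _ k j] dT[of _ _ k j] in \<open>simp_all add: dG\<close>)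
  have T': "T m k j = - T m j k" "L m k j = L m j k" for m using T[of m k j] L[of m k j] by auto
  have 2: "(\<Sum>m\<in>UNIV. \<kappa> m * G m j k) - (\<Sum>m\<in>UNIV. \<kappa> m * G m k j) = (\<Sum>m\<in>UNIV. \<kappa> m * T m j k)"
    by (simp only: sum_subtractf[symmetric]) (rule sum.cong, simp_all add: G T' algebra_simps)
  have 3: "(\<Sum>m\<in>UNIV. G m j k * u m) - (\<Sum>m\<in>UNIV. G m k j * u m) = (\<Sum>m\<in>UNIV. T m j k * u m)"
    by (simp only: sum_subtractf[symmetric]) (rule sum.cong, simp_all add: G T' algebra_simps)
  have 4: "(\<Sum>i\<in>UNIV. \<Sum>m\<in>UNIV. G i j m * G m i k) - (\<Sum>i\<in>UNIV. \<Sum>m\<in>UNIV. G i k m * G m i j)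
      = (\<Sum>i\<in>UNIV. \<Sum>m\<in>UNIV. L i j m * T m i k) - (\<Sum>i\<in>UNIV. \<Sum>m\<in>UNIV. L i k m * T m i j)"
  proof -
    \<comment> \<open>After this relabelling the two quadratic sums match term by term: products of
      two Christoffel symbols or of two torsions cancel, and only mixed products remain.\<close>
    have "(\<Sum>i\<in>UNIV. \<Sum>m\<in>UNIV. G i k m * G m i j) = (\<Sum>i\<in>UNIV. \<Sum>m\<in>UNIV. G m k i * G i m j)"
      by (rule sum.swap)
    then have "(\<Sum>i\<in>UNIV. \<Sum>m\<in>UNIV. G i j m * G m i k) - (\<Sum>i\<in>UNIV. \<Sum>m\<in>UNIV. G i k m * G m i j)
      = (\<Sum>i\<in>UNIV. \<Sum>m\<in>UNIV. G i j m * G m i k - G m k i * G i m j)"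
      by (simp only: sum_subtractf)
    also have "\<dots> = (\<Sum>i\<in>UNIV. \<Sum>m\<in>UNIV. L i j m * T m i k + T i j m * L m i k)"
    proof (intro sum.cong refl)
      fix i m
      have a: "G m k i = L m i k - T m i k / 2" using L[of m k i] T[of m k i] by (simp add: G)
      have b: "G i m j = L i j m - T i j m / 2" using L[of i m j] T[of i m j] by (simp add: G)
      show "G i j m * G m i k - G m k i * G i m j = L i j m * T m i k + T i j m * L m i k"
        unfolding a b by (simp add: G field_simps)
    qed
    also have "\<dots> = (\<Sum>i\<in>UNIV. \<Sum>m\<in>UNIV. L i j m * T m i k) + (\<Sum>i\<in>UNIV. \<Sum>m\<in>UNIV. T i j m * L m i k)"
      by (simp only: sum.distrib)
    also have "(\<Sum>i\<in>UNIV. \<Sum>m\<in>UNIV. T i j m * L m i k) = (\<Sum>m\<in>UNIV. \<Sum>i\<in>UNIV. T i j m * L m i k)"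
      by (rule sum.swap)
    also have "\<dots> = (\<Sum>i\<in>UNIV. \<Sum>m\<in>UNIV. - (L i k m * T m i j))"
    proof (intro sum.cong refl)
      fix i m show "T m j i * L i m k = - (L i k m * T m i j)"
        using L[of i m k] T[of m j i] by simp
    qed
    finally show ?thesis by (simp add: sum_negf)
  qed
  from e[of j k] e[of k j] 1 2 3 4 d\<kappa>[of j k] h[of j k] show ?thesis by linarith
qed

text \<open>The two Christoffel terms differ by exchanging \<open>j\<close> and \<open>k\<close>, so
  against the skew \<open>W\<close> they become equal up to sign; hence the factor 2.\<close>

lemma skew_ricci_hessian_contracted:
  fixes L T :: "real cov3" and dT :: "4 \<Rightarrow> real cov3" and W :: "real cov2" and u \<kappa> :: "4 \<Rightarrow> real"
  assumes W: "\<And>j k. W j k = - W k j"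
    and eq: "\<And>j k. (\<Sum>i\<in>UNIV. dT i i j k) + (\<Sum>m\<in>UNIV. \<kappa> m * T m j k)
      - (\<Sum>i\<in>UNIV. \<Sum>m\<in>UNIV. L i j m * T m i k) + (\<Sum>i\<in>UNIV. \<Sum>m\<in>UNIV. L i k m * T m i j)
      = (\<Sum>m\<in>UNIV. T m j k * u m)"
    and Z: "\<And>m. Z m = (\<Sum>j\<in>UNIV. \<Sum>k\<in>UNIV. T m j k * W j k)"
  shows "(\<Sum>i\<in>UNIV. \<Sum>j\<in>UNIV. \<Sum>k\<in>UNIV. dT i i j k * W j k) + (\<Sum>m\<in>UNIV. \<kappa> m * Z m)
      - 2 * (\<Sum>j\<in>UNIV. \<Sum>k\<in>UNIV. W j k * (\<Sum>i\<in>UNIV. \<Sum>m\<in>UNIV. L i j m * T m i k))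
      = (\<Sum>m\<in>UNIV. Z m * u m)"
proof -
  have mv: "(\<Sum>j\<in>UNIV. \<Sum>k\<in>UNIV. W j k * (\<Sum>m\<in>UNIV. F m j k)) = (\<Sum>m\<in>UNIV. \<Sum>j\<in>UNIV. \<Sum>k\<in>UNIV. F m j k * W j k)"
    for F :: "4 \<Rightarrow> 4 \<Rightarrow> 4 \<Rightarrow> real"
  proof -
    have "(\<Sum>k\<in>UNIV. W j k * (\<Sum>m\<in>UNIV. F m j k)) = (\<Sum>m\<in>UNIV. \<Sum>k\<in>UNIV. F m j k * W j k)" for j
      by (subst sum.swap) (simp add: sum_distrib_left mult.commute)
    then show ?thesis by (simp only:) (rule sum.swap)
  qed
  let ?S = "\<lambda>j k. \<Sum>i\<in>UNIV. \<Sum>m\<in>UNIV. L i j m * T m i k"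
  have sk: "(\<Sum>j\<in>UNIV. \<Sum>k\<in>UNIV. W j k * ?S k j) = - (\<Sum>j\<in>UNIV. \<Sum>k\<in>UNIV. W j k * ?S j k)"
  proof -
    have "(\<Sum>j\<in>UNIV. \<Sum>k\<in>UNIV. W j k * ?S k j) = (\<Sum>k\<in>UNIV. \<Sum>j\<in>UNIV. W j k * ?S k j)" by (rule sum.swap)
    also have "\<dots> = (\<Sum>k\<in>UNIV. \<Sum>j\<in>UNIV. - (W k j * ?S k j))"
    proof (intro sum.cong refl)
      fix k j show "W j k * ?S k j = - (W k j * ?S k j)" by (simp add: W[of j k])
    qed
    finally show ?thesis by (simp only: sum_negf)
  qed
  have "(\<Sum>j\<in>UNIV. \<Sum>k\<in>UNIV. W j k * ((\<Sum>i\<in>UNIV. dT i i j k) + (\<Sum>m\<in>UNIV. \<kappa> m * T m j k) - ?S j k + ?S k j))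
      = (\<Sum>j\<in>UNIV. \<Sum>k\<in>UNIV. W j k * (\<Sum>m\<in>UNIV. T m j k * u m))"
    by (simp only: eq)
  moreover have "(\<Sum>j\<in>UNIV. \<Sum>k\<in>UNIV. W j k * (\<Sum>m\<in>UNIV. T m j k * u m)) = (\<Sum>m\<in>UNIV. Z m * u m)"
    unfolding mv unfolding Z sum_distrib_right by (intro sum.cong refl) (simp add: mult_ac)
  moreover have "(\<Sum>j\<in>UNIV. \<Sum>k\<in>UNIV. W j k * (\<Sum>m\<in>UNIV. \<kappa> m * T m j k)) = (\<Sum>m\<in>UNIV. \<kappa> m * Z m)"
    unfolding mv unfolding Z sum_distrib_left by (intro sum.cong refl) (simp add: mult_ac)
  moreover have "(\<Sum>j\<in>UNIV. \<Sum>k\<in>UNIV. W j k * (\<Sum>i\<in>UNIV. dT i i j k)) = (\<Sum>i\<in>UNIV. \<Sum>j\<in>UNIV. \<Sum>k\<in>UNIV. dT i i j k * W j k)"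
    by (rule mv)
  ultimately show ?thesis
    using sk by (simp add: distrib_left right_diff_distrib sum.distrib sum_subtractf)
qed

text \<open>The two sums on the left make up \<open>T\<^sup>i\<^sub>j\<^sub>k \<nabla>\<^sub>iW\<^sup>j\<^sup>k\<close>; since \<open>\<nabla>g = 0\<close> and \<open>T\<close> is totally
  skew, no Christoffel symbols survive when the indices of \<open>W\<close> are lowered.\<close>

lemma torsion_bivector_derivative:
  fixes gi W :: "real cov2" and dg d\<omega> dW L T H :: "real cov3"
  assumes gi: "\<And>i j. gi i j = gi j i" and dg: "\<And>a i j. dg a i j = dg a j i"
    and W: "\<And>i j. W i j = - W j i"
    and H: "\<And>i j k. H i j k = - H k j i" "\<And>i j k. H i j k = - H j i k"
    and L: "\<And>k i j. L k i j = (\<Sum>l\<in>UNIV. gi k l * (dg i j l + dg j i l - dg l i j)) / 2"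
    and T: "\<And>k i j. T k i j = (\<Sum>l\<in>UNIV. gi k l * H i j l)"
    and dW: "\<And>i j k. dW i j k = (\<Sum>p\<in>UNIV. \<Sum>q\<in>UNIV. gi j p * d\<omega> i p q * gi q k)
        - (\<Sum>a\<in>UNIV. \<Sum>b\<in>UNIV. gi j b * dg i b a * W a k)
        - (\<Sum>a\<in>UNIV. \<Sum>b\<in>UNIV. W j a * dg i a b * gi b k)"
  shows "(\<Sum>i\<in>UNIV. \<Sum>j\<in>UNIV. \<Sum>k\<in>UNIV. T i j k * dW i j k)
      + 2 * (\<Sum>j\<in>UNIV. \<Sum>k\<in>UNIV. W j k * (\<Sum>i\<in>UNIV. \<Sum>m\<in>UNIV. L i j m * T m i k))
      = (\<Sum>i\<in>UNIV. \<Sum>j\<in>UNIV. \<Sum>k\<in>UNIV. T i j k * (\<Sum>p\<in>UNIV. \<Sum>q\<in>UNIV. gi j p * d\<omega> i p q * gi q k))"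
proof -
  have Tsk: "T k i j = - T k j i" for k i j
    unfolding T by (simp add: H(2)[of i j] sum_negf)
  \<comment> \<open>The torsion with its first lower index raised; total skewness of
    \<open>H\<close> makes it skew in the two upper indices.\<close>
  define Q where "Q i b k = (\<Sum>j\<in>UNIV. gi b j * T i j k)" for i b k
  have Q: "Q i b k = - Q b i k" for i b k
  proof -
    have "Q i b k = (\<Sum>j\<in>UNIV. \<Sum>l\<in>UNIV. gi b j * (gi i l * H j k l))"
      by (simp add: Q_def T sum_distrib_left)
    also have "\<dots> = (\<Sum>l\<in>UNIV. \<Sum>j\<in>UNIV. - (gi i l * (gi b j * H l k j)))"
    proof (subst sum.swap, intro sum.cong refl)
      fix l j show "gi b j * (gi i l * H j k l) = - (gi i l * (gi b j * H l k j))"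
        by (simp add: H(1)[of j])
    qed
    also have "\<dots> = - Q b i k"
      by (simp add: Q_def T sum_distrib_left sum_negf)
    finally show ?thesis .
  qed
  \<comment> \<open>Of the three metric derivatives in a Christoffel symbol, skewness of
    \<open>Q\<close> kills the one symmetric in \<open>m\<close> and \<open>p\<close> and merges the
    other two.\<close>
  have B: "(\<Sum>i\<in>UNIV. \<Sum>m\<in>UNIV. L i j m * T m i k) = (\<Sum>m\<in>UNIV. \<Sum>p\<in>UNIV. Q m p k * dg m p j)" for j k
  proof -
    have "(\<Sum>i\<in>UNIV. L i j m * T m i k)
      = (\<Sum>p\<in>UNIV. Q m p k * (dg j m p + dg m j p - dg p j m)) / 2" for m
    proof -
      have "(\<Sum>i\<in>UNIV. L i j m * T m i k)
        = (\<Sum>i\<in>UNIV. \<Sum>p\<in>UNIV. gi p i * T m i k * (dg j m p + dg m j p - dg p j m)) / 2"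
        unfolding sum_divide_distrib[of _ UNIV]
      proof (rule sum.cong[OF refl])
        fix i
        have "(\<Sum>l\<in>UNIV. gi i l * (dg j m l + dg m j l - dg l j m)) * T m i k
            = (\<Sum>p\<in>UNIV. gi p i * T m i k * (dg j m p + dg m j p - dg p j m))"
          unfolding sum_distrib_right
        proof (rule sum.cong[OF refl])
          fix p show "gi i p * (dg j m p + dg m j p - dg p j m) * T m i k
            = gi p i * T m i k * (dg j m p + dg m j p - dg p j m)"
            using gi[of i p] by simp
        qed
        then show "L i j m * T m i k
            = (\<Sum>p\<in>UNIV. gi p i * T m i k * (dg j m p + dg m j p - dg p j m) / 2)"
          by (simp add: L sum_divide_distrib[symmetric])
      qed
      also have "\<dots> = (\<Sum>p\<in>UNIV. Q m p k * (dg j m p + dg m j p - dg p j m)) / 2"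
        by (subst sum.swap) (simp only: Q_def sum_distrib_right)
      finally show ?thesis .
    qed
    then have "(\<Sum>i\<in>UNIV. \<Sum>m\<in>UNIV. L i j m * T m i k)
      = (\<Sum>m\<in>UNIV. \<Sum>p\<in>UNIV. Q m p k * (dg j m p + dg m j p - dg p j m)) / 2"
      by (subst sum.swap) (simp only: sum_divide_distrib)
    also have "(\<Sum>m\<in>UNIV. \<Sum>p\<in>UNIV. Q m p k * (dg j m p + dg m j p - dg p j m))
      = (\<Sum>m\<in>UNIV. \<Sum>p\<in>UNIV. Q m p k * dg j m p) + (\<Sum>m\<in>UNIV. \<Sum>p\<in>UNIV. Q m p k * dg m p j)
        - (\<Sum>m\<in>UNIV. \<Sum>p\<in>UNIV. Q m p k * dg p m j)"
      by (simp only: distrib_left right_diff_distrib sum.distrib sum_subtractf dg[of _ j])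
    also have "(\<Sum>m\<in>UNIV. \<Sum>p\<in>UNIV. Q m p k * dg j m p) = 0"
    proof (rule sum_skew_zero)
      fix m p show "Q m p k * dg j m p = - (Q p m k * dg j p m)"
        by (simp add: Q[of m p] dg[of j m p])
    qed
    also have "(\<Sum>m\<in>UNIV. \<Sum>p\<in>UNIV. Q m p k * dg p m j) = (\<Sum>m\<in>UNIV. \<Sum>p\<in>UNIV. - (Q m p k * dg m p j))"
    proof (subst sum.swap, intro sum.cong refl)
      fix m p show "Q p m k * dg m p j = - (Q m p k * dg m p j)"
        by (simp add: Q[of p m])
    qed
    finally show ?thesis by (simp add: sum_negf)
  qed
  have C1: "(\<Sum>i\<in>UNIV. \<Sum>j\<in>UNIV. \<Sum>k\<in>UNIV. T i j k * (\<Sum>a\<in>UNIV. \<Sum>b\<in>UNIV. gi j b * dg i b a * W a k))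
      = (\<Sum>j\<in>UNIV. \<Sum>k\<in>UNIV. W j k * (\<Sum>i\<in>UNIV. \<Sum>m\<in>UNIV. L i j m * T m i k))"
  proof -
    have "(\<Sum>j\<in>UNIV. T i j k * (\<Sum>a\<in>UNIV. \<Sum>b\<in>UNIV. gi j b * dg i b a * W a k))
        = (\<Sum>a\<in>UNIV. W a k * (\<Sum>b\<in>UNIV. Q i b k * dg i b a))" for i k
    proof -
      have "(\<Sum>j\<in>UNIV. T i j k * (\<Sum>a\<in>UNIV. \<Sum>b\<in>UNIV. gi j b * dg i b a * W a k))
        = (\<Sum>j\<in>UNIV. \<Sum>a\<in>UNIV. \<Sum>b\<in>UNIV. W a k * (gi b j * T i j k * dg i b a))"
        unfolding sum_distrib_left
      proof (intro sum.cong refl)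
        fix j a b show "T i j k * (gi j b * dg i b a * W a k) = W a k * (gi b j * T i j k * dg i b a)"
          by (simp add: gi[of j b])
      qed
      also have "\<dots> = (\<Sum>a\<in>UNIV. \<Sum>j\<in>UNIV. \<Sum>b\<in>UNIV. W a k * (gi b j * T i j k * dg i b a))"
        by (rule sum.swap)
      also have "\<dots> = (\<Sum>a\<in>UNIV. \<Sum>b\<in>UNIV. \<Sum>j\<in>UNIV. W a k * (gi b j * T i j k * dg i b a))"
        by (intro sum.cong refl sum.swap)
      also have "\<dots> = (\<Sum>a\<in>UNIV. W a k * (\<Sum>b\<in>UNIV. Q i b k * dg i b a))"
        by (simp only: Q_def sum_distrib_left sum_distrib_right)
      finally show ?thesis .
    qed
    then have "(\<Sum>j\<in>UNIV. \<Sum>k\<in>UNIV. T i j k * (\<Sum>a\<in>UNIV. \<Sum>b\<in>UNIV. gi j b * dg i b a * W a k))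
        = (\<Sum>a\<in>UNIV. \<Sum>k\<in>UNIV. W a k * (\<Sum>b\<in>UNIV. Q i b k * dg i b a))" for i
      by (subst sum.swap) (simp only:, rule sum.swap)
    then have "(\<Sum>i\<in>UNIV. \<Sum>j\<in>UNIV. \<Sum>k\<in>UNIV. T i j k * (\<Sum>a\<in>UNIV. \<Sum>b\<in>UNIV. gi j b * dg i b a * W a k))
        = (\<Sum>i\<in>UNIV. \<Sum>a\<in>UNIV. \<Sum>k\<in>UNIV. W a k * (\<Sum>b\<in>UNIV. Q i b k * dg i b a))"
      by (simp only:)
    also have "\<dots> = (\<Sum>a\<in>UNIV. \<Sum>i\<in>UNIV. \<Sum>k\<in>UNIV. W a k * (\<Sum>b\<in>UNIV. Q i b k * dg i b a))"
      by (rule sum.swap)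
    also have "\<dots> = (\<Sum>a\<in>UNIV. \<Sum>k\<in>UNIV. \<Sum>i\<in>UNIV. W a k * (\<Sum>b\<in>UNIV. Q i b k * dg i b a))"
      by (intro sum.cong refl sum.swap)
    also have "\<dots> = (\<Sum>a\<in>UNIV. \<Sum>k\<in>UNIV. W a k * (\<Sum>i\<in>UNIV. \<Sum>b\<in>UNIV. Q i b k * dg i b a))"
      by (simp only: sum_distrib_left)
    finally show ?thesis by (simp only: B)
  qed
  \<comment> \<open>Exchanging \<open>j\<close> and \<open>k\<close> turns the second metric
    correction in \<open>dW\<close> into the first. By \<open>C1\<close> each of them cancels one
    copy of the Christoffel term.\<close>
  have C2: "(\<Sum>j\<in>UNIV. \<Sum>k\<in>UNIV. T i j k * (\<Sum>a\<in>UNIV. \<Sum>b\<in>UNIV. W j a * dg i a b * gi b k))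
      = (\<Sum>j\<in>UNIV. \<Sum>k\<in>UNIV. T i j k * (\<Sum>a\<in>UNIV. \<Sum>b\<in>UNIV. gi j b * dg i b a * W a k))" for i
  proof (rule trans[OF sum.swap], intro sum.cong refl)
    fix j k :: 4
    have "(\<Sum>a\<in>UNIV. \<Sum>b\<in>UNIV. W k a * dg i a b * gi b j) = - (\<Sum>a\<in>UNIV. \<Sum>b\<in>UNIV. gi j b * dg i b a * W a k)"
      unfolding sum_negf[symmetric]
    proof (intro sum.cong refl)
      fix a b show "W k a * dg i a b * gi b j = - (gi j b * dg i b a * W a k)"
        using W[of k a] dg[of i a b] gi[of b j] by simp
    qed
    then show "T i k j * (\<Sum>a\<in>UNIV. \<Sum>b\<in>UNIV. W k a * dg i a b * gi b j)
      = T i j k * (\<Sum>a\<in>UNIV. \<Sum>b\<in>UNIV. gi j b * dg i b a * W a k)"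
      using Tsk[of i k j] by simp
  qed
  show ?thesis
    unfolding dW right_diff_distrib sum_subtractf using C1 C2 by simp
qed

section \<open>First derivatives of the Hermitian structure\<close>

context hermitian
begin

lemma raise_form: "(\<Sum>l\<in>UNIV. matrix_inv g $ i $ l * hermitian_form g J k l) = J $ i $ k"
proof -
  have "(\<Sum>l\<in>UNIV. matrix_inv g $ i $ l * hermitian_form g J k l)
    = (\<Sum>m\<in>UNIV. \<Sum>l\<in>UNIV. J $ m $ k * (matrix_inv g $ i $ l * g $ l $ m))"
    unfolding form_sum sum_distrib_left
  proof (rule trans[OF sum.swap], intro sum.cong refl)
    fix m l show "matrix_inv g $ i $ l * (J $ m $ k * g $ m $ l) = J $ m $ k * (matrix_inv g $ i $ l * g $ l $ m)"
      by (simp add: sym_nth[of m l])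
  qed
  then show ?thesis by (simp add: sum_distrib_left[symmetric] matrix_inv_left[OF invertible])
qed

lemma raise_form_both:
  "(\<Sum>p\<in>UNIV. \<Sum>q\<in>UNIV. matrix_inv g $ j $ p * hermitian_form g J p q * matrix_inv g $ q $ k)
    = hermitian_bivector g J j k"
proof -
  have "(\<Sum>q\<in>UNIV. matrix_inv g $ j $ p * hermitian_form g J p q * matrix_inv g $ q $ k)
      = matrix_inv g $ j $ p * J $ k $ p" for p
  proof -
    have "(\<Sum>q\<in>UNIV. matrix_inv g $ j $ p * hermitian_form g J p q * matrix_inv g $ q $ k)
      = (\<Sum>q\<in>UNIV. matrix_inv g $ j $ p * (matrix_inv g $ k $ q * hermitian_form g J p q))"
    proof (intro sum.cong refl)
      fix q show "matrix_inv g $ j $ p * hermitian_form g J p q * matrix_inv g $ q $ k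
          = matrix_inv g $ j $ p * (matrix_inv g $ k $ q * hermitian_form g J p q)"
        by (simp add: sym_inv_nth[of q k])
    qed
    then show ?thesis by (simp add: sum_distrib_left[symmetric] raise_form)
  qed
  then show ?thesis by (simp add: bivector_sum)
qed

lemma J_J_nth: "(\<Sum>m\<in>UNIV. J $ a $ m * J $ m $ b) = - of_bool (a = b)"
  using arg_cong[OF J_J, of "\<lambda>A. A $ a $ b"]
  by (simp only: matrix_matrix_mult_def vec_lambda_beta vector_uminus_component mat_1_nth)

lemma bivector_lower: "(\<Sum>b\<in>UNIV. hermitian_bivector g J a b * g $ b $ m) = - J $ a $ m"
proof -
  have "(\<Sum>b\<in>UNIV. hermitian_bivector g J a b * g $ b $ m)
    = - (\<Sum>p\<in>UNIV. \<Sum>b\<in>UNIV. J $ a $ p * (matrix_inv g $ p $ b * g $ b $ m))"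
    by (subst sum.swap) (simp add: bivector_sum' sum_distrib_right mult.assoc sum_negf)
  then show ?thesis by (simp add: sum_distrib_left[symmetric] matrix_inv_left[OF invertible])
qed

lemma J_bivector: "(\<Sum>a\<in>UNIV. J $ m $ a * hermitian_bivector g J a b) = matrix_inv g $ m $ b"
proof -
  have "(\<Sum>a\<in>UNIV. J $ m $ a * hermitian_bivector g J a b)
    = - (\<Sum>p\<in>UNIV. \<Sum>a\<in>UNIV. J $ m $ a * J $ a $ p * matrix_inv g $ p $ b)"
    by (subst sum.swap) (simp add: bivector_sum' sum_distrib_left mult.assoc sum_negf)
  then show ?thesis by (simp add: sum_distrib_right[symmetric] J_J_nth sum_negf)
qed

lemma raise_covector_J:
  "(\<Sum>l\<in>UNIV. matrix_inv g $ m $ l * (\<theta> v* J) $ l) = (\<Sum>c\<in>UNIV. hermitian_bivector g J m c * \<theta> $ c)"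
  unfolding covector_J bivector_sum sum_distrib_left sum_distrib_right
  by (rule trans[OF sum.swap]) (simp add: mult.assoc)

lemma bivector_skew_pairing: "(\<Sum>m\<in>UNIV. \<Sum>c\<in>UNIV. hermitian_bivector g J m c * \<theta> $ c * \<theta> $ m) = 0"
proof (rule sum_skew_zero)
  fix m c show "hermitian_bivector g J m c * \<theta> $ c * \<theta> $ m = - (hermitian_bivector g J c m * \<theta> $ m * \<theta> $ c)"
    by (simp add: skew_W[of m c])
qed

text \<open>The terms with \<open>dJ\<close> sum to minus the trace of J dJ, which vanishes because
  J^2 is constant. In other words, det \<omega> and det g have the same logarithmic
  derivative.\<close>

lemma trace_form_derivative:
  fixes dg d\<omega> dJ :: "4 \<Rightarrow> 4 \<Rightarrow> real"
  assumes d\<omega>: "\<And>a b. d\<omega> a b = (\<Sum>m\<in>UNIV. dJ m a * g $ m $ b + J $ m $ a * dg m b)"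
    and dJ: "\<And>a b. (\<Sum>m\<in>UNIV. dJ a m * J $ m $ b + J $ a $ m * dJ m b) = 0"
  shows "(\<Sum>a\<in>UNIV. \<Sum>b\<in>UNIV. hermitian_bivector g J a b * d\<omega> a b)
    = (\<Sum>m\<in>UNIV. \<Sum>b\<in>UNIV. matrix_inv g $ m $ b * dg m b)"
proof -
  let ?W = "hermitian_bivector g J"
  have 1: "(\<Sum>a\<in>UNIV. \<Sum>b\<in>UNIV. \<Sum>m\<in>UNIV. ?W a b * (dJ m a * g $ m $ b)) = 0"
  proof -
    have "(\<Sum>b\<in>UNIV. \<Sum>m\<in>UNIV. ?W a b * (dJ m a * g $ m $ b)) = (\<Sum>m\<in>UNIV. - (J $ a $ m * dJ m a))" for a
    proof -
      have "(\<Sum>b\<in>UNIV. \<Sum>m\<in>UNIV. ?W a b * (dJ m a * g $ m $ b))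
          = (\<Sum>m\<in>UNIV. \<Sum>b\<in>UNIV. dJ m a * (?W a b * g $ b $ m))"
      proof (rule trans[OF sum.swap], intro sum.cong refl)
        fix m b show "?W a b * (dJ m a * g $ m $ b) = dJ m a * (?W a b * g $ b $ m)"
          by (simp add: sym_nth[of m b])
      qed
      also have "\<dots> = (\<Sum>m\<in>UNIV. - (J $ a $ m * dJ m a))"
        by (simp only: sum_distrib_left[symmetric] bivector_lower) (simp add: mult.commute)
      finally show ?thesis .
    qed
    then have "(\<Sum>a\<in>UNIV. \<Sum>b\<in>UNIV. \<Sum>m\<in>UNIV. ?W a b * (dJ m a * g $ m $ b))
        = - (\<Sum>a\<in>UNIV. \<Sum>m\<in>UNIV. J $ a $ m * dJ m a)" by (simp add: sum_negf)
    moreover have "(\<Sum>a\<in>UNIV. \<Sum>m\<in>UNIV. J $ a $ m * dJ m a) = 0"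
    proof -
      have "(\<Sum>a\<in>UNIV. \<Sum>m\<in>UNIV. dJ a m * J $ m $ a) = (\<Sum>a\<in>UNIV. \<Sum>m\<in>UNIV. J $ a $ m * dJ m a)"
        by (rule trans[OF sum.swap]) (simp add: mult.commute)
      moreover have "(\<Sum>a\<in>UNIV. \<Sum>m\<in>UNIV. dJ a m * J $ m $ a + J $ a $ m * dJ m a) = 0"
        by (simp only: dJ) simp
      ultimately show ?thesis by (simp add: sum.distrib)
    qed
    ultimately show ?thesis by simp
  qed
  have 2: "(\<Sum>a\<in>UNIV. \<Sum>b\<in>UNIV. \<Sum>m\<in>UNIV. ?W a b * (J $ m $ a * dg m b))
      = (\<Sum>m\<in>UNIV. \<Sum>b\<in>UNIV. matrix_inv g $ m $ b * dg m b)"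
  proof -
    have "(\<Sum>a\<in>UNIV. \<Sum>m\<in>UNIV. ?W a b * (J $ m $ a * dg m b)) = (\<Sum>m\<in>UNIV. matrix_inv g $ m $ b * dg m b)" for b
    proof -
      have "(\<Sum>a\<in>UNIV. \<Sum>m\<in>UNIV. ?W a b * (J $ m $ a * dg m b))
          = (\<Sum>m\<in>UNIV. \<Sum>a\<in>UNIV. J $ m $ a * ?W a b * dg m b)"
        by (rule trans[OF sum.swap]) (simp add: mult_ac)
      then show ?thesis by (simp add: sum_distrib_right[symmetric] J_bivector)
    qed
    then have "(\<Sum>b\<in>UNIV. \<Sum>a\<in>UNIV. \<Sum>m\<in>UNIV. ?W a b * (J $ m $ a * dg m b))
        = (\<Sum>b\<in>UNIV. \<Sum>m\<in>UNIV. matrix_inv g $ m $ b * dg m b)" by simp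
    then show ?thesis by (subst sum.swap) (simp only:, rule sum.swap)
  qed
  show ?thesis
    unfolding d\<omega> using 1 2 by (simp add: sum_distrib_left distrib_left sum.distrib)
qed

lemma torsion_contraction:
  assumes T: "\<And>m j k. T m j k = (\<Sum>l\<in>UNIV. matrix_inv g $ m $ l * (\<epsilon> * wedge12 \<eta> (hermitian_form g J) j k l))"
  shows "(\<Sum>j\<in>UNIV. \<Sum>k\<in>UNIV. T m j k * hermitian_bivector g J j k)
    = 2 * \<epsilon> * (\<Sum>l\<in>UNIV. matrix_inv g $ m $ l * \<eta> $ l)"
proof -
  let ?W = "hermitian_bivector g J" and ?A = "wedge12 \<eta> (hermitian_form g J)"
  have "(\<Sum>j\<in>UNIV. \<Sum>k\<in>UNIV. T m j k * ?W j k)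
      = (\<Sum>j\<in>UNIV. \<Sum>k\<in>UNIV. \<Sum>l\<in>UNIV. matrix_inv g $ m $ l * \<epsilon> * (?W j k * ?A j k l))"
    unfolding T sum_distrib_right by (intro sum.cong refl) (simp add: mult_ac)
  also have "\<dots> = (\<Sum>j\<in>UNIV. \<Sum>l\<in>UNIV. \<Sum>k\<in>UNIV. matrix_inv g $ m $ l * \<epsilon> * (?W j k * ?A j k l))"
    by (intro sum.cong refl sum.swap)
  also have "\<dots> = (\<Sum>l\<in>UNIV. \<Sum>j\<in>UNIV. \<Sum>k\<in>UNIV. matrix_inv g $ m $ l * \<epsilon> * (?W j k * ?A j k l))"
    by (rule sum.swap)
  also have "\<dots> = (\<Sum>l\<in>UNIV. matrix_inv g $ m $ l * \<epsilon> * (2 * \<eta> $ l))"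
    by (simp only: sum_distrib_left[symmetric] wedge12_contract)
  finally show ?thesis by (simp add: sum_distrib_left mult_ac)
qed

text \<open>The right-hand side is the divergence of the bivector \<open>-\<omega>\<^sup>-\<^sup>1\<close>.\<close>

lemma torsion_contraction_divergence:
  fixes dg d\<omega> dJ dW :: "real cov3"
  assumes T: "\<And>m j k. T m j k = (\<Sum>l\<in>UNIV. matrix_inv g $ m $ l * (\<epsilon> * wedge12 (\<theta> v* J) (hermitian_form g J) j k l))"
    and \<theta>: "\<And>a b c. d\<omega> a b c - d\<omega> b a c + d\<omega> c a b = wedge12 \<theta> (hermitian_form g J) a b c"
    and d\<omega>: "\<And>c a b. d\<omega> c a b = (\<Sum>m\<in>UNIV. dJ c m a * g $ m $ b + J $ m $ a * dg c m b)"
    and dJ: "\<And>c a b. (\<Sum>m\<in>UNIV. dJ c a m * J $ m $ b + J $ a $ m * dJ c m b) = 0"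
    and dW: "\<And>i a c. (\<Sum>b\<in>UNIV. dW i a b * hermitian_form g J b c + hermitian_bivector g J a b * d\<omega> i b c) = 0"
    and \<kappa>: "\<And>c. \<kappa> c = (\<Sum>m\<in>UNIV. \<Sum>b\<in>UNIV. matrix_inv g $ m $ b * dg c m b) / 2"
  shows "(\<Sum>j\<in>UNIV. \<Sum>k\<in>UNIV. T m j k * hermitian_bivector g J j k)
    = - 2 * \<epsilon> * ((\<Sum>a\<in>UNIV. dW a a m) + (\<Sum>a\<in>UNIV. \<kappa> a * hermitian_bivector g J a m))"
proof -
  let ?W = "hermitian_bivector g J" and ?\<omega> = "hermitian_form g J"
  \<comment> \<open>The Riemannian divergence of the bivector: for the metric of interest \<kappa>
    is the logarithmic derivative of the volume density.\<close>
  define V where "V b = (\<Sum>a\<in>UNIV. dW a a b) + (\<Sum>a\<in>UNIV. \<kappa> a * ?W a b)" for b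
  have 1: "(\<Sum>a\<in>UNIV. \<Sum>b\<in>UNIV. ?W a b * d\<omega> a b c) = - (\<Sum>b\<in>UNIV. (\<Sum>a\<in>UNIV. dW a a b) * ?\<omega> b c)" for c
  proof -
    have "(\<Sum>b\<in>UNIV. ?W a b * d\<omega> a b c) = - (\<Sum>b\<in>UNIV. dW a a b * ?\<omega> b c)" for a
      using dW[of a a c] by (simp add: sum.distrib)
    then show ?thesis
      by (simp only: sum_negf) (simp only: sum_distrib_right, subst sum.swap, rule refl)
  qed
  have 2: "(\<Sum>a\<in>UNIV. \<Sum>b\<in>UNIV. ?W a b * d\<omega> b a c) = - (\<Sum>a\<in>UNIV. \<Sum>b\<in>UNIV. ?W a b * d\<omega> a b c)" for c
    unfolding sum_negf[symmetric]
  proof (rule trans[OF sum.swap], intro sum.cong refl)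
    fix a b show "?W b a * d\<omega> a b c = - (?W a b * d\<omega> a b c)" by (simp add: skew_W[of b a])
  qed
  have 3: "(\<Sum>a\<in>UNIV. \<Sum>b\<in>UNIV. ?W a b * d\<omega> c a b) = 2 * \<kappa> c" for c
    using trace_form_derivative[of "d\<omega> c" "dJ c" "dg c", OF d\<omega> dJ] by (simp add: \<kappa>)
  \<comment> \<open>Tracing d\<omega> = \<theta> \<and> \<omega> against \<open>W\<close> isolates
    \<theta>; by fact \<open>1\<close> the derivative is then shifted from \<omega> to
    \<open>W\<close>.\<close>
  have "2 * \<theta> $ c = (\<Sum>a\<in>UNIV. \<Sum>b\<in>UNIV. ?W a b * (d\<omega> a b c - d\<omega> b a c + d\<omega> c a b))" for c
    by (simp only: \<theta> wedge12_contract)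
  then have \<theta>W: "2 * \<theta> $ c = - 2 * (\<Sum>b\<in>UNIV. (\<Sum>a\<in>UNIV. dW a a b) * ?\<omega> b c) + 2 * \<kappa> c" for c
    using 1[of c] 2[of c] 3[of c] by (simp add: distrib_left right_diff_distrib sum.distrib sum_subtractf)
  have \<kappa>W: "(\<Sum>b\<in>UNIV. (\<Sum>a\<in>UNIV. \<kappa> a * ?W a b) * ?\<omega> b c) = - \<kappa> c" for c
  proof -
    have "(\<Sum>b\<in>UNIV. (\<Sum>a\<in>UNIV. \<kappa> a * ?W a b) * ?\<omega> b c) = (\<Sum>a\<in>UNIV. \<Sum>b\<in>UNIV. \<kappa> a * (?W a b * ?\<omega> b c))"
      unfolding sum_distrib_right by (rule trans[OF sum.swap]) (simp add: mult.assoc)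
    then show ?thesis by (simp add: sum_distrib_left[symmetric] W_\<omega> sum_negf)
  qed
  have \<theta>V: "\<theta> $ c = - (\<Sum>b\<in>UNIV. V b * ?\<omega> b c)" for c
    using \<theta>W[of c] \<kappa>W[of c] by (simp add: V_def distrib_right sum.distrib)
  have "(\<Sum>c\<in>UNIV. ?W m c * \<theta> $ c) = (\<Sum>c\<in>UNIV. \<Sum>b\<in>UNIV. V b * (?W m c * ?\<omega> c b))"
    unfolding \<theta>V sum_negf[symmetric] sum_distrib_left
  proof (intro sum.cong refl)
    fix b c show "?W m c * - (V b * ?\<omega> b c) = V b * (?W m c * ?\<omega> c b)" by (simp add: skew[of b c])
  qed
  also have "\<dots> = - V m"
    by (subst sum.swap) (simp add: sum_distrib_left[symmetric] W_\<omega> sum_negf)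
  finally show ?thesis
    unfolding torsion_contraction[of T \<epsilon> "\<theta> v* J", OF T] raise_covector_J
    by (simp add: V_def ring_distribs)
qed

text \<open>The torsion with all indices up is totally skew, so only the alternating part d\<omega>
  = \<theta> \<and> \<omega> of the derivative counts. The result is proportional to the pairing of
  \<theta> with its composition with J, which is zero.\<close>

lemma torsion_form_derivative_zero:
  fixes d\<omega> :: "real cov3"
  assumes T: "\<And>m j k. T m j k = (\<Sum>l\<in>UNIV. matrix_inv g $ m $ l * (\<epsilon> * wedge12 (\<theta> v* J) (hermitian_form g J) j k l))"
    and \<theta>: "\<And>a b c. d\<omega> a b c - d\<omega> b a c + d\<omega> c a b = wedge12 \<theta> (hermitian_form g J) a b c"
    and d\<omega>: "\<And>a b c. d\<omega> a b c = - d\<omega> a c b"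
  shows "(\<Sum>i\<in>UNIV. \<Sum>j\<in>UNIV. \<Sum>k\<in>UNIV. T i j k *
      (\<Sum>p\<in>UNIV. \<Sum>q\<in>UNIV. matrix_inv g $ j $ p * d\<omega> i p q * matrix_inv g $ q $ k)) = 0"
proof -
  let ?W = "hermitian_bivector g J" and ?\<omega> = "hermitian_form g J" and ?\<eta> = "\<theta> v* J"
    and ?gi = "\<lambda>i j. matrix_inv g $ i $ j"
  define u where "u i = (\<Sum>l\<in>UNIV. ?gi i l * ?\<eta> $ l)" for i
  have T': "T i j k = \<epsilon> * (?\<eta> $ j * J $ i $ k - ?\<eta> $ k * J $ i $ j + u i * ?\<omega> j k)" for i j k
  proof -
    have "T i j k = (\<Sum>l\<in>UNIV. \<epsilon> * (?\<eta> $ j * (?gi i l * ?\<omega> k l) - ?\<eta> $ k * (?gi i l * ?\<omega> j l) + (?gi i l * ?\<eta> $ l) * ?\<omega> j k))"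
      unfolding T wedge12_def by (intro sum.cong refl) (simp add: algebra_simps)
    also have "\<dots> = \<epsilon> * (?\<eta> $ j * J $ i $ k - ?\<eta> $ k * J $ i $ j + u i * ?\<omega> j k)"
      by (simp only: sum_distrib_left[symmetric] sum.distrib sum_subtractf sum_distrib_right[symmetric] raise_form u_def)
    finally show ?thesis .
  qed
  have u': "(\<Sum>j\<in>UNIV. ?\<eta> $ j * ?gi j p) = u p" for p
    unfolding u_def by (intro sum.cong refl) (simp add: sym_inv_nth[of p] mult.commute)
  have JW: "(\<Sum>k\<in>UNIV. J $ i $ k * ?gi k q) = ?W q i" for i q
    using bivector_sum'[of i q] skew_W[of i q] by simp
  \<comment> \<open>The right-hand side is \<epsilon> times the wedge product of the vector
    \<open>u\<close> with the bivector, written as a cyclic sum.\<close>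
  have N: "(\<Sum>j\<in>UNIV. \<Sum>k\<in>UNIV. T i j k * (?gi j p * ?gi k q)) = \<epsilon> * (u p * ?W q i + u q * ?W i p + u i * ?W p q)" for i p q
  proof -
    have "(\<Sum>j\<in>UNIV. \<Sum>k\<in>UNIV. T i j k * (?gi j p * ?gi k q))
      = \<epsilon> * ((\<Sum>j\<in>UNIV. \<Sum>k\<in>UNIV. (?\<eta> $ j * ?gi j p) * (J $ i $ k * ?gi k q))
          - (\<Sum>j\<in>UNIV. \<Sum>k\<in>UNIV. (J $ i $ j * ?gi j p) * (?\<eta> $ k * ?gi k q))
          + u i * (\<Sum>j\<in>UNIV. \<Sum>k\<in>UNIV. ?gi p j * ?\<omega> j k * ?gi k q))"
      unfolding T' sum_distrib_left sum_subtractf[symmetric] sum.distrib[symmetric]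
    proof (intro sum.cong refl)
      fix j k show "\<epsilon> * (?\<eta> $ j * J $ i $ k - ?\<eta> $ k * J $ i $ j + u i * ?\<omega> j k) * (?gi j p * ?gi k q)
        = \<epsilon> * (?\<eta> $ j * ?gi j p * (J $ i $ k * ?gi k q) - J $ i $ j * ?gi j p * (?\<eta> $ k * ?gi k q)
            + u i * (?gi p j * ?\<omega> j k * ?gi k q))"
        unfolding sym_inv_nth[of p j] by (simp add: algebra_simps)
    qed
    also have "\<dots> = \<epsilon> * (u p * ?W q i - ?W p i * u q + u i * ?W p q)"
      by (simp only: sum_product[symmetric] u' JW raise_form_both)
    also have "\<dots> = \<epsilon> * (u p * ?W q i + u q * ?W i p + u i * ?W p q)"
      by (simp add: skew_W[of p i])
    finally show ?thesis .
  qed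
  have "(\<Sum>j\<in>UNIV. \<Sum>k\<in>UNIV. T i j k * (\<Sum>p\<in>UNIV. \<Sum>q\<in>UNIV. ?gi j p * d\<omega> i p q * ?gi q k))
      = (\<Sum>p\<in>UNIV. \<Sum>q\<in>UNIV. \<epsilon> * (u p * ?W q i + u q * ?W i p + u i * ?W p q) * d\<omega> i p q)" for i
  proof -
    have "(\<Sum>j\<in>UNIV. \<Sum>k\<in>UNIV. T i j k * (\<Sum>p\<in>UNIV. \<Sum>q\<in>UNIV. ?gi j p * d\<omega> i p q * ?gi q k))
      = (\<Sum>(j, k)\<in>UNIV \<times> UNIV. \<Sum>(p, q)\<in>UNIV \<times> UNIV. T i j k * (?gi j p * ?gi k q) * d\<omega> i p q)"
      unfolding sum.cartesian_product[symmetric] sum_distrib_left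
    proof (intro sum.cong refl)
      fix j k p q show "T i j k * (?gi j p * d\<omega> i p q * ?gi q k) = T i j k * (?gi j p * ?gi k q) * d\<omega> i p q"
        unfolding sym_inv_nth[of q k] by simp
    qed
    also have "\<dots> = (\<Sum>(p, q)\<in>UNIV \<times> UNIV. \<Sum>(j, k)\<in>UNIV \<times> UNIV. T i j k * (?gi j p * ?gi k q) * d\<omega> i p q)"
      unfolding case_prod_unfold by (rule sum.swap)
    also have "\<dots> = (\<Sum>p\<in>UNIV. \<Sum>q\<in>UNIV. (\<Sum>j\<in>UNIV. \<Sum>k\<in>UNIV. T i j k * (?gi j p * ?gi k q)) * d\<omega> i p q)"
      unfolding sum.cartesian_product[symmetric] sum_distrib_right ..
    finally show ?thesis by (simp only: N)
  qed
  then have "(\<Sum>i\<in>UNIV. \<Sum>j\<in>UNIV. \<Sum>k\<in>UNIV. T i j k * (\<Sum>p\<in>UNIV. \<Sum>q\<in>UNIV. ?gi j p * d\<omega> i p q * ?gi q k))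
      = (\<Sum>i\<in>UNIV. \<Sum>p\<in>UNIV. \<Sum>q\<in>UNIV. \<epsilon> * (u p * ?W q i + u q * ?W i p + u i * ?W p q) * d\<omega> i p q)"
    by simp
  also have "\<dots> = \<epsilon> * ((\<Sum>i\<in>UNIV. \<Sum>p\<in>UNIV. \<Sum>q\<in>UNIV. u p * ?W q i * d\<omega> i p q)
      + (\<Sum>i\<in>UNIV. \<Sum>p\<in>UNIV. \<Sum>q\<in>UNIV. u q * ?W i p * d\<omega> i p q)
      + (\<Sum>i\<in>UNIV. \<Sum>p\<in>UNIV. \<Sum>q\<in>UNIV. u i * ?W p q * d\<omega> i p q))"
    unfolding sum.distrib[symmetric] sum_distrib_left by (simp only: mult.assoc distrib_right)
  also have "(\<Sum>i\<in>UNIV. \<Sum>p\<in>UNIV. \<Sum>q\<in>UNIV. u p * ?W q i * d\<omega> i p q)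
      = (\<Sum>c\<in>UNIV. u c * (\<Sum>a\<in>UNIV. \<Sum>b\<in>UNIV. ?W a b * d\<omega> a b c))"
    unfolding sum_distrib_left
  proof (rule trans[OF sum.swap], intro sum.cong refl)
    fix c a b show "u c * ?W b a * d\<omega> a c b = u c * (?W a b * d\<omega> a b c)"
      by (simp add: skew_W[of b a] d\<omega>[of a c b])
  qed
  also have "(\<Sum>i\<in>UNIV. \<Sum>p\<in>UNIV. \<Sum>q\<in>UNIV. u q * ?W i p * d\<omega> i p q)
      = (\<Sum>c\<in>UNIV. u c * (\<Sum>a\<in>UNIV. \<Sum>b\<in>UNIV. ?W a b * d\<omega> a b c))"
  proof -
    have "(\<Sum>i\<in>UNIV. \<Sum>p\<in>UNIV. \<Sum>q\<in>UNIV. u q * ?W i p * d\<omega> i p q)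
      = (\<Sum>i\<in>UNIV. \<Sum>q\<in>UNIV. \<Sum>p\<in>UNIV. u q * ?W i p * d\<omega> i p q)"
      by (intro sum.cong refl sum.swap)
    also have "\<dots> = (\<Sum>q\<in>UNIV. \<Sum>i\<in>UNIV. \<Sum>p\<in>UNIV. u q * ?W i p * d\<omega> i p q)"
      by (rule sum.swap)
    finally show ?thesis by (simp add: sum_distrib_left mult.assoc)
  qed
  also have "(\<Sum>i\<in>UNIV. \<Sum>p\<in>UNIV. \<Sum>q\<in>UNIV. u i * ?W p q * d\<omega> i p q)
      = (\<Sum>c\<in>UNIV. u c * (\<Sum>a\<in>UNIV. \<Sum>b\<in>UNIV. ?W a b * d\<omega> c a b))"
    by (simp add: sum_distrib_left mult.assoc)
  finally have *: "(\<Sum>i\<in>UNIV. \<Sum>j\<in>UNIV. \<Sum>k\<in>UNIV. T i j k * (\<Sum>p\<in>UNIV. \<Sum>q\<in>UNIV. ?gi j p * d\<omega> i p q * ?gi q k))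
      = \<epsilon> * (\<Sum>c\<in>UNIV. u c * (2 * (\<Sum>a\<in>UNIV. \<Sum>b\<in>UNIV. ?W a b * d\<omega> a b c) + (\<Sum>a\<in>UNIV. \<Sum>b\<in>UNIV. ?W a b * d\<omega> c a b)))"
    by (simp add: distrib_left sum.distrib mult.left_commute[of _ 2] flip: sum_distrib_left)
  have sw: "(\<Sum>a\<in>UNIV. \<Sum>b\<in>UNIV. ?W a b * d\<omega> b a c) = - (\<Sum>a\<in>UNIV. \<Sum>b\<in>UNIV. ?W a b * d\<omega> a b c)" for c
    unfolding sum_negf[symmetric]
  proof (rule trans[OF sum.swap], intro sum.cong refl)
    fix a b show "?W b a * d\<omega> a b c = - (?W a b * d\<omega> a b c)" by (simp add: skew_W[of b a])
  qed
  have "2 * (\<Sum>a\<in>UNIV. \<Sum>b\<in>UNIV. ?W a b * d\<omega> a b c) + (\<Sum>a\<in>UNIV. \<Sum>b\<in>UNIV. ?W a b * d\<omega> c a b) = 2 * \<theta> $ c" for c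
  proof -
    have "2 * \<theta> $ c = (\<Sum>a\<in>UNIV. \<Sum>b\<in>UNIV. ?W a b * (d\<omega> a b c - d\<omega> b a c + d\<omega> c a b))"
      by (simp only: \<theta> wedge12_contract)
    then show ?thesis
      using sw[of c] by (simp add: distrib_left right_diff_distrib sum.distrib sum_subtractf)
  qed
  then have "(\<Sum>i\<in>UNIV. \<Sum>j\<in>UNIV. \<Sum>k\<in>UNIV. T i j k * (\<Sum>p\<in>UNIV. \<Sum>q\<in>UNIV. ?gi j p * d\<omega> i p q * ?gi q k))
      = 2 * \<epsilon> * (\<Sum>c\<in>UNIV. u c * \<theta> $ c)"
    unfolding * by (simp add: sum_distrib_left mult_ac)
  \<comment> \<open>The vector \<open>u\<close> is the skew bivector applied to \<theta>
    itself.\<close>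
  moreover have "(\<Sum>c\<in>UNIV. u c * \<theta> $ c) = 0"
    using bivector_skew_pairing[of \<theta>] unfolding u_def raise_covector_J by (simp add: sum_distrib_right)
  ultimately show ?thesis by simp
qed

end

section \<open>Solitons on a coordinate domain\<close>

text \<open>The structure seen in one chart, which suffices because the conclusion is local;
  \<open>I\<close> and \<open>J\<close> become two interpretations sharing the same metric.\<close>

locale hermitian_domain =
  fixes U :: "(real^4) set" and g J :: "real^4 \<Rightarrow> real^4^4"
  assumes open_U: "open U" and smooth_g: "smooth_on U g" and smooth_J: "smooth_on U J"
    and hermitian: "x \<in> U \<Longrightarrow> hermitian (g x) (J x)"
begin

abbreviation gi :: "4 \<Rightarrow> 4 \<Rightarrow> real^4 \<Rightarrow> real" where "gi i j \<equiv> \<lambda>y. matrix_inv (g y) $ i $ j"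
abbreviation \<omega> :: "4 \<Rightarrow> 4 \<Rightarrow> real^4 \<Rightarrow> real" where "\<omega> i j \<equiv> \<lambda>y. hermitian_form (g y) (J y) i j"
abbreviation W :: "4 \<Rightarrow> 4 \<Rightarrow> real^4 \<Rightarrow> real" where "W i j \<equiv> \<lambda>y. hermitian_bivector (g y) (J y) i j"

lemmas smooth_intros = smooth_on_const smooth_on_add[OF open_U] smooth_on_diff[OF open_U]
  smooth_on_minus[OF open_U] smooth_on_mult[OF open_U] smooth_on_sum[OF open_U]
  smooth_on_divide_const[OF open_U] smooth_on_pd

lemma smooth_entries [intro]:
  "smooth_on U (\<lambda>y. g y $ i $ j)" "smooth_on U (\<lambda>y. J y $ i $ j)" "smooth_on U (gi i j)"
proof -
  show g: "smooth_on U (\<lambda>y. g y $ i $ j)" for i j by (rule smooth_on_entry[OF open_U smooth_g])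
  show "smooth_on U (\<lambda>y. J y $ i $ j)" by (rule smooth_on_entry[OF open_U smooth_J])
  show "smooth_on U (gi i j)"
    by (rule smooth_on_matrix_inv_entry[OF open_U g hermitian.invertible[OF hermitian]])
qed

lemma smooth_form: "smooth_on U (\<omega> i j)"
proof -
  have "smooth_on U (\<lambda>y. \<Sum>m\<in>UNIV. J y $ m $ i * g y $ m $ j)" by (intro smooth_intros smooth_entries)
  then show ?thesis
    by (rule smooth_on_cong[OF open_U, rotated]) (simp add: hermitian.form_sum[OF hermitian])
qed

lemma smooth_bivector: "smooth_on U (W i j)"
proof -
  have "smooth_on U (\<lambda>y. \<Sum>p\<in>UNIV. gi i p y * J y $ j $ p)" by (intro smooth_intros smooth_entries)
  then show ?thesis
    by (rule smooth_on_cong[OF open_U, rotated]) (simp add: hermitian.bivector_sum[OF hermitian])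
qed

section \<open>Differentiated algebraic relations\<close>

lemma pd_sum_mult:
  fixes F G :: "'i::finite \<Rightarrow> real^4 \<Rightarrow> real"
  assumes "x \<in> U" "\<And>a. smooth_on U (F a)" "\<And>a. smooth_on U (G a)"
  shows "pd c (\<lambda>y. \<Sum>a\<in>UNIV. F a y * G a y) x
    = (\<Sum>a\<in>UNIV. pd c (F a) x * G a x + F a x * pd c (G a) x)"
proof -
  have "pd c (\<lambda>y. \<Sum>a\<in>UNIV. F a y * G a y) x = (\<Sum>a\<in>UNIV. pd c (\<lambda>y. F a y * G a y) x)"
    by (rule pd_sum, simp, rule smooth_on_differentiable[OF smooth_on_mult[OF open_U assms(2,3)] assms(1)])
  also have "\<dots> = (\<Sum>a\<in>UNIV. pd c (F a) x * G a x + F a x * pd c (G a) x)"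
    by (intro sum.cong refl pd_mult smooth_on_differentiable[OF _ assms(1)] assms)
  finally show ?thesis .
qed

text \<open>Differentiates a matrix identity with constant right-hand side; it serves for J^2 = -1,
  for the inverse metric and for the inverse relation between \<open>W\<close> and \<omega>.\<close>

lemma pd_sum_mult_const:
  fixes F G :: "'i::finite \<Rightarrow> real^4 \<Rightarrow> real"
  assumes x: "x \<in> U" and s: "\<And>a. smooth_on U (F a)" "\<And>a. smooth_on U (G a)"
    and eq: "\<And>y. y \<in> U \<Longrightarrow> (\<Sum>a\<in>UNIV. F a y * G a y) = k"
  shows "(\<Sum>a\<in>UNIV. pd c (F a) x * G a x + F a x * pd c (G a) x) = 0"
proof -
  have "pd c (\<lambda>y. \<Sum>a\<in>UNIV. F a y * G a y) x = pd c (\<lambda>y. k) x"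
    by (rule pd_cong[OF open_U x eq])
  then show ?thesis by (simp add: pd_sum_mult[OF x s])
qed

lemma pd_metric_sym: "x \<in> U \<Longrightarrow> pd c (\<lambda>y. g y $ i $ j) x = pd c (\<lambda>y. g y $ j $ i) x"
  by (rule pd_cong[OF open_U]) (auto simp: hermitian.sym_nth[OF hermitian, of _ i])

lemma pd_form_skew: "x \<in> U \<Longrightarrow> pd c (\<omega> i j) x = - pd c (\<omega> j i) x"
proof -
  assume x: "x \<in> U"
  have "pd c (\<omega> i j) x = pd c (\<lambda>y. - \<omega> j i y) x"
  proof (rule pd_cong[OF open_U x])
    fix y assume y: "y \<in> U"
    interpret hermitian "g y" "J y" by (rule hermitian[OF y])
    show "\<omega> i j y = - \<omega> j i y" by (rule skew)
  qed
  then show ?thesis by (simp add: pd_minus smooth_on_differentiable[OF smooth_form x])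
qed

lemma pd_bivector_skew: "x \<in> U \<Longrightarrow> pd c (W i j) x = - pd c (W j i) x"
proof -
  assume x: "x \<in> U"
  have "pd c (W i j) x = pd c (\<lambda>y. - W j i y) x"
  proof (rule pd_cong[OF open_U x])
    fix y assume y: "y \<in> U"
    interpret hermitian "g y" "J y" by (rule hermitian[OF y])
    show "W i j y = - W j i y" by (rule skew_W)
  qed
  then show ?thesis by (simp add: pd_minus smooth_on_differentiable[OF smooth_bivector x])
qed

lemma pd_J_J:
  assumes x: "x \<in> U"
  shows "(\<Sum>m\<in>UNIV. pd c (\<lambda>y. J y $ a $ m) x * J x $ m $ b + J x $ a $ m * pd c (\<lambda>y. J y $ m $ b) x) = 0"
  by (rule pd_sum_mult_const[OF x smooth_entries(2) smooth_entries(2)])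
    (rule hermitian.J_J_nth[OF hermitian])

lemma pd_form:
  assumes x: "x \<in> U"
  shows "pd c (\<omega> a b) x
    = (\<Sum>m\<in>UNIV. pd c (\<lambda>y. J y $ m $ a) x * g x $ m $ b + J x $ m $ a * pd c (\<lambda>y. g y $ m $ b) x)"
proof -
  have "pd c (\<omega> a b) x = pd c (\<lambda>y. \<Sum>m\<in>UNIV. J y $ m $ a * g y $ m $ b) x"
    by (rule pd_cong[OF open_U x]) (rule hermitian.form_sum[OF hermitian])
  then show ?thesis by (simp only: pd_sum_mult[OF x smooth_entries(2) smooth_entries(1)])
qed

lemma pd_bivector_form:
  assumes x: "x \<in> U"
  shows "(\<Sum>b\<in>UNIV. pd i (W a b) x * \<omega> b c x + W a b x * pd i (\<omega> b c) x) = 0"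
proof (rule pd_sum_mult_const[OF x smooth_bivector smooth_form])
  fix y assume y: "y \<in> U"
  interpret hermitian "g y" "J y" by (rule hermitian[OF y])
  show "(\<Sum>b\<in>UNIV. W a b y * \<omega> b c y) = - of_bool (a = c)" by (rule W_\<omega>)
qed

lemma pd_inverse_metric:
  assumes x: "x \<in> U"
  shows "pd c (gi i j) x = - (\<Sum>a\<in>UNIV. \<Sum>b\<in>UNIV. gi i a x * pd c (\<lambda>y. g y $ a $ b) x * gi b j x)"
proof -
  interpret hermitian "g x" "J x" by (rule hermitian[OF x])
  have z: "(\<Sum>a\<in>UNIV. pd c (gi i a) x * g x $ a $ b) = - (\<Sum>a\<in>UNIV. gi i a x * pd c (\<lambda>y. g y $ a $ b) x)" for b
  proof -
    have "(\<Sum>a\<in>UNIV. pd c (gi i a) x * g x $ a $ b + gi i a x * pd c (\<lambda>y. g y $ a $ b) x) = 0"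
      by (rule pd_sum_mult_const[OF x smooth_entries(3) smooth_entries(1)])
        (rule matrix_inv_left[OF hermitian.invertible[OF hermitian]])
    then show ?thesis by (simp add: sum.distrib)
  qed
  have "pd c (gi i j) x = (\<Sum>a\<in>UNIV. pd c (gi i a) x * (\<Sum>b\<in>UNIV. g x $ a $ b * gi b j x))"
    by (simp add: matrix_inv_right[OF invertible])
  also have "\<dots> = (\<Sum>b\<in>UNIV. (\<Sum>a\<in>UNIV. pd c (gi i a) x * g x $ a $ b) * gi b j x)"
    unfolding sum_distrib_left sum_distrib_right by (rule trans[OF sum.swap]) (simp add: mult.assoc)
  also have "\<dots> = - (\<Sum>a\<in>UNIV. \<Sum>b\<in>UNIV. gi i a x * pd c (\<lambda>y. g y $ a $ b) x * gi b j x)"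
    unfolding z sum_negf[symmetric] sum_distrib_right by (rule trans[OF sum.swap]) simp
  finally show ?thesis .
qed

text \<open>The product rule for \<omega> with both indices raised. The derivatives of the inverse
  metric are rewritten through those of the metric so that they can cancel against Christoffel
  symbols.\<close>

lemma pd_bivector:
  assumes x: "x \<in> U"
  shows "pd i (W j k) x = (\<Sum>p\<in>UNIV. \<Sum>q\<in>UNIV. gi j p x * pd i (\<omega> p q) x * gi q k x)
        - (\<Sum>a\<in>UNIV. \<Sum>b\<in>UNIV. gi j b x * pd i (\<lambda>y. g y $ b $ a) x * W a k x)
        - (\<Sum>a\<in>UNIV. \<Sum>b\<in>UNIV. W j a x * pd i (\<lambda>y. g y $ a $ b) x * gi b k x)"
proof -
  interpret hermitian "g x" "J x" by (rule hermitian[OF x])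
  have "pd i (W j k) x = pd i (\<lambda>y. \<Sum>p\<in>UNIV. gi j p y * (\<Sum>q\<in>UNIV. \<omega> p q y * gi q k y)) x"
    by (rule pd_cong[OF open_U x])
      (simp add: hermitian.raise_form_both[OF hermitian, symmetric] sum_distrib_left mult.assoc)
  also have "\<dots> = (\<Sum>p\<in>UNIV. pd i (gi j p) x * (\<Sum>q\<in>UNIV. \<omega> p q x * gi q k x)
      + gi j p x * (\<Sum>q\<in>UNIV. pd i (\<omega> p q) x * gi q k x + \<omega> p q x * pd i (gi q k) x))"
    by (simp only: pd_sum_mult[OF x smooth_entries(3) smooth_on_sum[OF open_U smooth_on_mult[OF open_U smooth_form smooth_entries(3)]]]
        pd_sum_mult[OF x smooth_form smooth_entries(3)])
  also have "\<dots> = (\<Sum>p\<in>UNIV. \<Sum>q\<in>UNIV. gi j p x * pd i (\<omega> p q) x * gi q k x)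
      + (\<Sum>p\<in>UNIV. pd i (gi j p) x * (\<Sum>q\<in>UNIV. \<omega> p q x * gi q k x))
      + (\<Sum>q\<in>UNIV. (\<Sum>p\<in>UNIV. gi j p x * \<omega> p q x) * pd i (gi q k) x)"
  proof -
    have "(\<Sum>q\<in>UNIV. (\<Sum>p\<in>UNIV. gi j p x * \<omega> p q x) * pd i (gi q k) x)
        = (\<Sum>p\<in>UNIV. \<Sum>q\<in>UNIV. gi j p x * (\<omega> p q x * pd i (gi q k) x))"
      unfolding sum_distrib_right by (rule trans[OF sum.swap]) (simp add: mult.assoc)
    then show ?thesis
      by (simp add: distrib_left sum.distrib sum_distrib_left mult.assoc)
  qed
  also have "(\<Sum>p\<in>UNIV. pd i (gi j p) x * (\<Sum>q\<in>UNIV. \<omega> p q x * gi q k x))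
      = - (\<Sum>a\<in>UNIV. \<Sum>b\<in>UNIV. gi j b x * pd i (\<lambda>y. g y $ b $ a) x * W a k x)"
  proof -
    have "(\<Sum>p\<in>UNIV. pd i (gi j p) x * (\<Sum>q\<in>UNIV. \<omega> p q x * gi q k x))
      = - (\<Sum>p\<in>UNIV. \<Sum>b\<in>UNIV. \<Sum>a\<in>UNIV. gi j b x * pd i (\<lambda>y. g y $ b $ a) x * (gi a p x * (\<Sum>q\<in>UNIV. \<omega> p q x * gi q k x)))"
      unfolding pd_inverse_metric[OF x] by (simp add: sum_distrib_right sum_negf mult.assoc)
    also have "(\<Sum>p\<in>UNIV. \<Sum>b\<in>UNIV. \<Sum>a\<in>UNIV. gi j b x * pd i (\<lambda>y. g y $ b $ a) x * (gi a p x * (\<Sum>q\<in>UNIV. \<omega> p q x * gi q k x)))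
      = (\<Sum>b\<in>UNIV. \<Sum>a\<in>UNIV. \<Sum>p\<in>UNIV. gi j b x * pd i (\<lambda>y. g y $ b $ a) x * (gi a p x * (\<Sum>q\<in>UNIV. \<omega> p q x * gi q k x)))"
      by (rule trans[OF sum.swap]) (intro sum.cong refl sum.swap)
    also have "\<dots> = (\<Sum>b\<in>UNIV. \<Sum>a\<in>UNIV. gi j b x * pd i (\<lambda>y. g y $ b $ a) x * W a k x)"
      unfolding raise_form_both[symmetric] by (simp only: sum_distrib_left mult.assoc)
    also have "\<dots> = (\<Sum>a\<in>UNIV. \<Sum>b\<in>UNIV. gi j b x * pd i (\<lambda>y. g y $ b $ a) x * W a k x)"
      by (rule sum.swap)
    finally show ?thesis .
  qed
  also have "(\<Sum>q\<in>UNIV. (\<Sum>p\<in>UNIV. gi j p x * \<omega> p q x) * pd i (gi q k) x)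
      = - (\<Sum>a\<in>UNIV. \<Sum>b\<in>UNIV. W j a x * pd i (\<lambda>y. g y $ a $ b) x * gi b k x)"
  proof -
    have W: "W j a x = (\<Sum>q\<in>UNIV. (\<Sum>p\<in>UNIV. gi j p x * \<omega> p q x) * gi q a x)" for a
      unfolding raise_form_both[symmetric] sum_distrib_right by (rule sum.swap)
    have "(\<Sum>q\<in>UNIV. (\<Sum>p\<in>UNIV. gi j p x * \<omega> p q x) * pd i (gi q k) x)
      = - (\<Sum>q\<in>UNIV. \<Sum>a\<in>UNIV. \<Sum>b\<in>UNIV. (\<Sum>p\<in>UNIV. gi j p x * \<omega> p q x) * gi q a x * (pd i (\<lambda>y. g y $ a $ b) x * gi b k x))"
      unfolding pd_inverse_metric[OF x] by (simp only: sum_distrib_left sum_negf mult_minus_right mult.assoc)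
    also have "(\<Sum>q\<in>UNIV. \<Sum>a\<in>UNIV. \<Sum>b\<in>UNIV. (\<Sum>p\<in>UNIV. gi j p x * \<omega> p q x) * gi q a x * (pd i (\<lambda>y. g y $ a $ b) x * gi b k x))
      = (\<Sum>a\<in>UNIV. \<Sum>b\<in>UNIV. \<Sum>q\<in>UNIV. (\<Sum>p\<in>UNIV. gi j p x * \<omega> p q x) * gi q a x * (pd i (\<lambda>y. g y $ a $ b) x * gi b k x))"
      by (rule trans[OF sum.swap]) (intro sum.cong refl sum.swap)
    also have "\<dots> = (\<Sum>a\<in>UNIV. \<Sum>b\<in>UNIV. W j a x * pd i (\<lambda>y. g y $ a $ b) x * gi b k x)"
      unfolding W by (simp only: sum_distrib_right mult.assoc)
    finally show ?thesis .
  qed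
  finally show ?thesis by simp
qed

end

section \<open>The Lee form, the volume density and divergences on a domain\<close>

context hermitian_domain
begin

abbreviation form :: "real^4 \<Rightarrow> real cov2" where "form \<equiv> \<lambda>y. hermitian_form (g y) (J y)"

text \<open>The contraction that inverts wedging with \<omega>. It replaces the definite description
  in \<open>lee_form\<close> by a formula that is visibly smooth.\<close>

definition lee :: "real^4 \<Rightarrow> real^4" where
  "lee y = (\<chi> c. (\<Sum>a\<in>UNIV. \<Sum>b\<in>UNIV. W a b y * ext_d2 form y a b c) / 2)"

lemma ext_d2_form:
  assumes x: "x \<in> U"
  shows "ext_d2 form x = wedge12 (lee x) (form x)"
    and "(THE \<theta>. ext_d2 form x = wedge12 \<theta> (form x)) = lee x"
proof -
  interpret hermitian "g x" "J x" by (rule hermitian[OF x])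
  have alt: "alternating3 (ext_d2 form x)"
    unfolding alternating3_def ext_d2_def
  proof (intro allI conjI)
    fix i j k
    show "pd i (\<omega> j k) x - pd j (\<omega> i k) x + pd k (\<omega> i j) x
        = - (pd j (\<omega> i k) x - pd i (\<omega> j k) x + pd k (\<omega> j i) x)"
      by (simp add: pd_form_skew[OF x, of k j i])
    show "pd i (\<omega> j k) x - pd j (\<omega> i k) x + pd k (\<omega> i j) x
        = - (pd i (\<omega> k j) x - pd k (\<omega> i j) x + pd j (\<omega> i k) x)"
      by (simp add: pd_form_skew[OF x, of i k j])
  qed
  show "ext_d2 form x = wedge12 (lee x) (form x)"
    unfolding lee_def by (rule alternating3_eq_wedge12[OF alt])
  show "(THE \<theta>. ext_d2 form x = wedge12 \<theta> (form x)) = lee x"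
    unfolding lee_def by (rule the_wedge12[OF alt])
qed

lemma dc2_form:
  assumes x: "x \<in> U"
  shows "dc2 J form x i j k = - complex_of_real (wedge12 (lee x v* J x) (form x) i j k)"
proof -
  interpret hermitian "g x" "J x" by (rule hermitian[OF x])
  have inv: "(\<Sum>k\<in>UNIV. J y $ k $ i * (\<Sum>l\<in>UNIV. J y $ l $ j * form y k l)) = form y i j"
    and anti: "(\<Sum>l\<in>UNIV. J y $ l $ j * form y i l) = - (\<Sum>k\<in>UNIV. J y $ k $ i * form y k j)"
    if "y \<in> U" for y i j
  proof -
    interpret hermitian "g y" "J y" by (rule hermitian[OF that])
    show "(\<Sum>k\<in>UNIV. J y $ k $ i * (\<Sum>l\<in>UNIV. J y $ l $ j * form y k l)) = form y i j"
      by (simp add: form_J_right form_sum[symmetric])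
    show "(\<Sum>l\<in>UNIV. J y $ l $ j * form y i l) = - (\<Sum>k\<in>UNIV. J y $ k $ i * form y k j)"
      by (simp add: form_J_right form_J_left)
  qed
  have "dc2 J form x i j k = \<i> * (type_part3 (J x) 1 (\<lambda>i j k. complex_of_real (ext_d2 form x i j k)) i j k
      - type_part3 (J x) 2 (\<lambda>i j k. complex_of_real (ext_d2 form x i j k)) i j k)"
    by (rule dc2_type_11[where \<omega>=form and J=J, OF open_U x])
      (rule smooth_on_differentiable[OF smooth_form x] inv anti | assumption)+
  also have "\<dots> = - complex_of_real (wedge12 (lee x v* J x) (form x) i j k)"
    unfolding ext_d2_form(1)[OF x] by (rule type_part3_difference[OF wedge12_slot_J])
  finally show ?thesis .
qed

text \<open>\<open>\<partial>\<^sub>c log (sqrt (det g))\<close>, written so that its closedness needs no derivative of \<open>det\<close>.\<close>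

definition volume_form_derivative :: "real^4 \<Rightarrow> 4 \<Rightarrow> real" where
  "volume_form_derivative y c = (\<Sum>m\<in>UNIV. \<Sum>b\<in>UNIV. gi m b y * pd c (\<lambda>z. g z $ m $ b) y) / 2"

abbreviation \<kappa> where "\<kappa> \<equiv> volume_form_derivative"

lemma smooth_kappa: "smooth_on U (\<lambda>y. \<kappa> y c)"
  unfolding volume_form_derivative_def by (intro smooth_intros smooth_entries)

text \<open>The second derivatives of \<open>g\<close> commute, and the remaining term, the trace of
  a product of two first derivatives of \<open>g\<close> separated by inverse metrics, is symmetric
  in \<open>j\<close> and \<open>k\<close>.\<close>

lemma kappa_closed:
  assumes x: "x \<in> U"
  shows "pd j (\<lambda>y. \<kappa> y k) x = pd k (\<lambda>y. \<kappa> y j) x"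
proof -
  let ?dg = "\<lambda>c a b. pd c (\<lambda>z. g z $ a $ b) x"
  interpret hermitian "g x" "J x" by (rule hermitian[OF x])
  have s: "smooth_on U (pd k (\<lambda>z. g z $ m $ b))" for k m b by (intro smooth_on_pd smooth_entries)
  have e: "pd j (\<lambda>y. \<kappa> y k) x = ((\<Sum>m\<in>UNIV. \<Sum>b\<in>UNIV. pd j (gi m b) x * ?dg k m b)
      + (\<Sum>m\<in>UNIV. \<Sum>b\<in>UNIV. gi m b x * pd j (pd k (\<lambda>z. g z $ m $ b)) x)) / 2" for j k
  proof -
    have "pd j (\<lambda>y. \<kappa> y k) x
      = pd j (\<lambda>y. \<Sum>m\<in>UNIV. \<Sum>b\<in>UNIV. gi m b y * pd k (\<lambda>z. g z $ m $ b) y) x / 2"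
      unfolding volume_form_derivative_def
      by (rule pd_linear[OF bounded_linear_divide])
        (intro smooth_on_differentiable[OF _ x] smooth_intros smooth_entries)
    also have "pd j (\<lambda>y. \<Sum>m\<in>UNIV. \<Sum>b\<in>UNIV. gi m b y * pd k (\<lambda>z. g z $ m $ b) y) x
      = (\<Sum>m\<in>UNIV. pd j (\<lambda>y. \<Sum>b\<in>UNIV. gi m b y * pd k (\<lambda>z. g z $ m $ b) y) x)"
      by (rule pd_sum, simp) (intro smooth_on_differentiable[OF _ x] smooth_intros smooth_entries)
    finally show ?thesis
      by (simp only: pd_sum_mult[OF x smooth_entries(3) s] sum.distrib)
  qed
  have 1: "(\<Sum>m\<in>UNIV. \<Sum>b\<in>UNIV. gi m b x * pd j (pd k (\<lambda>z. g z $ m $ b)) x)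
    = (\<Sum>m\<in>UNIV. \<Sum>b\<in>UNIV. gi m b x * pd k (pd j (\<lambda>z. g z $ m $ b)) x)"
    by (simp only: pd_commute[OF open_U x smooth_entries(1), of j k])
  have 2: "(\<Sum>m\<in>UNIV. \<Sum>b\<in>UNIV. pd j (gi m b) x * ?dg k m b)
    = - (\<Sum>(m, b)\<in>UNIV \<times> UNIV. \<Sum>(a, c)\<in>UNIV \<times> UNIV. gi m a x * ?dg j a c * gi c b x * ?dg k m b)" for j k
    unfolding pd_inverse_metric[OF x] sum.cartesian_product[symmetric] by (simp add: sum_distrib_right sum_negf)
  have 3: "(\<Sum>(m, b)\<in>UNIV \<times> UNIV. \<Sum>(a, c)\<in>UNIV \<times> UNIV. gi m a x * ?dg j a c * gi c b x * ?dg k m b)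
    = (\<Sum>(m, b)\<in>UNIV \<times> UNIV. \<Sum>(a, c)\<in>UNIV \<times> UNIV. gi m a x * ?dg k a c * gi c b x * ?dg j m b)"
    unfolding case_prod_unfold
  proof (rule trans[OF sum.swap], intro sum.cong refl)
    fix p q :: "4 \<times> 4"
    show "gi (fst q) (fst p) x * ?dg j (fst p) (snd p) * gi (snd p) (snd q) x * ?dg k (fst q) (snd q)
        = gi (fst p) (fst q) x * ?dg k (fst q) (snd q) * gi (snd q) (snd p) x * ?dg j (fst p) (snd p)"
      unfolding sym_inv_nth[of "fst q" "fst p"] sym_inv_nth[of "snd q" "snd p"] by simp
  qed
  show ?thesis unfolding e 1 2 3 ..
qed

text \<open>\<open>V\<close> is the divergence of the bivector for the volume density with
  logarithmic derivative \<kappa>. Its own divergence vanishes because the skew \<open>W\<close>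
  meets second derivatives, the closed \<kappa> and products of \<kappa> only symmetrically.\<close>

lemma divergence_bivector_divergence:
  assumes x: "x \<in> U"
  defines "V \<equiv> \<lambda>b y. (\<Sum>a\<in>UNIV. pd a (W a b) y) + (\<Sum>a\<in>UNIV. \<kappa> y a * W a b y)"
  shows "(\<Sum>b\<in>UNIV. pd b (V b) x) + (\<Sum>b\<in>UNIV. \<kappa> x b * V b x) = 0"
proof -
  interpret hermitian "g x" "J x" by (rule hermitian[OF x])
  have s: "smooth_on U (pd c (W a b))" for a b c by (intro smooth_on_pd smooth_bivector)
  have e: "pd b (V b) x = (\<Sum>a\<in>UNIV. pd b (pd a (W a b)) x)
     + (\<Sum>a\<in>UNIV. pd b (\<lambda>y. \<kappa> y a) x * W a b x + \<kappa> x a * pd b (W a b) x)" for b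
  proof -
    have "pd b (V b) x = pd b (\<lambda>y. \<Sum>a\<in>UNIV. pd a (W a b) y) x + pd b (\<lambda>y. \<Sum>a\<in>UNIV. \<kappa> y a * W a b y) x"
      unfolding V_def
      by (rule pd_add) (intro smooth_on_differentiable[OF _ x] smooth_intros smooth_bivector smooth_kappa)+
    also have "pd b (\<lambda>y. \<Sum>a\<in>UNIV. pd a (W a b) y) x = (\<Sum>a\<in>UNIV. pd b (pd a (W a b)) x)"
      by (rule pd_sum, simp) (rule smooth_on_differentiable[OF s x])
    finally show ?thesis by (simp only: pd_sum_mult[OF x smooth_kappa smooth_bivector])
  qed
  have 1: "(\<Sum>b\<in>UNIV. \<Sum>a\<in>UNIV. pd b (pd a (W a b)) x) = 0"
  proof (rule sum_skew_zero)
    fix b a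
    have "pd b (pd a (W a b)) x = pd b (\<lambda>y. - pd a (W b a) y) x"
      by (rule pd_cong[OF open_U x]) (rule pd_bivector_skew)
    also have "\<dots> = - pd b (pd a (W b a)) x" by (rule pd_minus[OF smooth_on_differentiable[OF s x]])
    also have "pd b (pd a (W b a)) x = pd a (pd b (W b a)) x"
      by (rule pd_commute[OF open_U x smooth_bivector])
    finally show "pd b (pd a (W a b)) x = - pd a (pd b (W b a)) x" .
  qed
  have 2: "(\<Sum>b\<in>UNIV. \<Sum>a\<in>UNIV. pd b (\<lambda>y. \<kappa> y a) x * W a b x) = 0"
  proof (rule sum_skew_zero)
    fix b a show "pd b (\<lambda>y. \<kappa> y a) x * W a b x = - (pd a (\<lambda>y. \<kappa> y b) x * W b a x)"
      by (simp add: kappa_closed[OF x, of b a] skew_W[of a b])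
  qed
  have 3: "(\<Sum>b\<in>UNIV. \<Sum>a\<in>UNIV. \<kappa> x a * pd b (W a b) x) = - (\<Sum>b\<in>UNIV. \<Sum>a\<in>UNIV. \<kappa> x b * pd a (W a b) x)"
    unfolding sum_negf[symmetric]
  proof (rule trans[OF sum.swap], intro sum.cong refl)
    fix b a show "\<kappa> x b * pd a (W b a) x = - (\<kappa> x b * pd a (W a b) x)"
      by (simp add: pd_bivector_skew[OF x, of a b a])
  qed
  have 4: "(\<Sum>b\<in>UNIV. \<Sum>a\<in>UNIV. \<kappa> x b * (\<kappa> x a * W a b x)) = 0"
  proof (rule sum_skew_zero)
    fix b a show "\<kappa> x b * (\<kappa> x a * W a b x) = - (\<kappa> x a * (\<kappa> x b * W b a x))"
      by (simp add: skew_W[of a b])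
  qed
  have "(\<Sum>b\<in>UNIV. \<kappa> x b * V b x) = (\<Sum>b\<in>UNIV. \<Sum>a\<in>UNIV. \<kappa> x b * pd a (W a b) x)
      + (\<Sum>b\<in>UNIV. \<Sum>a\<in>UNIV. \<kappa> x b * (\<kappa> x a * W a b x))"
    by (simp add: V_def distrib_left sum.distrib sum_distrib_left)
  moreover have "(\<Sum>b\<in>UNIV. pd b (V b) x) = (\<Sum>b\<in>UNIV. \<Sum>a\<in>UNIV. pd b (pd a (W a b)) x)
      + (\<Sum>b\<in>UNIV. \<Sum>a\<in>UNIV. pd b (\<lambda>y. \<kappa> y a) x * W a b x)
      + (\<Sum>b\<in>UNIV. \<Sum>a\<in>UNIV. \<kappa> x a * pd b (W a b) x)"
    by (simp add: e sum.distrib)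
  ultimately show ?thesis using 1 2 3 4 by linarith
qed

section \<open>The soliton equation on a domain\<close>

lemma smooth_lee: "smooth_on U (\<lambda>y. lee y $ c)"
  unfolding lee_def vec_lambda_beta ext_d2_def
  by (intro smooth_intros smooth_bivector smooth_form)

lemma smooth_levi_civita: "smooth_on U (\<lambda>y. levi_civita g y k i j)"
  unfolding levi_civita_def by (intro smooth_intros smooth_entries)

lemma levi_civita_sym: "x \<in> U \<Longrightarrow> levi_civita g x k i j = levi_civita g x k j i"
  unfolding levi_civita_def by (simp add: pd_metric_sym[of x _ i j] add.commute)

text \<open>The constant \<epsilon> absorbs the opposite signs with which \<open>H\<close> comes
  from the two complex structures. The contraction \<open>Z\<close> of the torsion with
  \<open>W\<close> has two descriptions: differentially it is a divergence of a bivector, hence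
  divergence free; algebraically it is a multiple of \<open>W\<close> applied to the Lee
  form.\<close>

theorem soliton_gradient_orthogonal:
  assumes \<epsilon>: "\<epsilon> \<noteq> 0"
    and H: "\<And>y i j k. y \<in> U \<Longrightarrow> H y i j k = \<epsilon> * wedge12 (lee y v* J y) (form y) i j k"
    and u: "smooth_on U u"
    and soliton: "\<And>i j. ricci (bismut_plus g H) x i j + hessian (bismut_plus g H) u x i j = 0"
    and x: "x \<in> U"
  shows "(\<Sum>m\<in>UNIV. (\<Sum>c\<in>UNIV. W m c x * lee x $ c) * pd m u x) = 0"
proof -
  define T where "T k i j y = (\<Sum>l\<in>UNIV. gi k l y * H y i j l)" for k i j y
  let ?L = "\<lambda>k i j y. levi_civita g y k i j" and ?G = "\<lambda>k i j y. bismut_plus g H y k i j"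
  define Z where "Z m y = (\<Sum>j\<in>UNIV. \<Sum>k\<in>UNIV. T m j k y * W j k y)" for m y
  define V where "V b y = (\<Sum>a\<in>UNIV. pd a (W a b) y) + (\<Sum>a\<in>UNIV. \<kappa> y a * W a b y)" for b y
  have alt: "alternating3 (H y)" if y: "y \<in> U" for y
  proof -
    interpret hermitian "g y" "J y" by (rule hermitian[OF y])
    show ?thesis
      using alternating3_wedge12[of "form y" "lee y v* J y", OF skew]
      unfolding alternating3_def H[OF y] by (metis mult_minus_right)
  qed
  have sH: "smooth_on U (\<lambda>y. H y i j k)" for i j k
  proof -
    have "smooth_on U (\<lambda>y. \<epsilon> * wedge12 (lee y v* J y) (form y) i j k)"
      unfolding wedge12_def hermitian.covector_J[OF hermitian]
      by (simp only: vector_matrix_mult_def vec_lambda_beta)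
        (intro smooth_intros smooth_lee smooth_form smooth_entries)
    then show ?thesis by (rule smooth_on_cong[OF open_U, rotated]) (simp add: H)
  qed
  have sT: "smooth_on U (T k i j)" for k i j
    unfolding T_def by (intro smooth_intros smooth_entries sH)
  have G: "?G k i j y = ?L k i j y + T k i j y / 2" for k i j y
    by (simp add: bismut_plus_def T_def)
  have dG: "pd a (?G k i j) x = pd a (?L k i j) x + pd a (T k i j) x / 2" for a k i j
  proof -
    have "pd a (?G k i j) x = pd a (?L k i j) x + pd a (\<lambda>y. T k i j y / 2) x"
      unfolding G by (intro pd_add smooth_on_differentiable[OF _ x] smooth_levi_civita
          smooth_on_divide_const[OF open_U] sT)
    then show ?thesis
      by (simp add: pd_linear[OF bounded_linear_divide smooth_on_differentiable[OF sT x]])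
  qed
  have Tskew: "T k i j y = - T k j i y" if "y \<in> U" for k i j y
    unfolding T_def sum_negf[symmetric]
    using alternating3_perm(2)[OF alt[OF that], of i j] by simp
  have dT: "pd a (T k i j) x = - pd a (T k j i) x" for a k i j
  proof -
    have "pd a (T k i j) x = pd a (\<lambda>y. - T k j i y) x" by (rule pd_cong[OF open_U x Tskew])
    then show ?thesis by (simp add: pd_minus smooth_on_differentiable[OF sT x])
  qed
  have dL: "pd a (?L k i j) x = pd a (?L k j i) x" for a k i j
    by (rule pd_cong[OF open_U x levi_civita_sym])
  \<comment> \<open>The torsion has no trace because \<open>H\<close> is skew, so the trace is that
    of the Levi-Civita connection, the logarithmic derivative of the volume density.\<close>
  have trace: "(\<Sum>i\<in>UNIV. ?G i i m y) = \<kappa> y m" if y: "y \<in> U" for m y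
  proof -
    interpret hermitian "g y" "J y" by (rule hermitian[OF y])
    let ?dg = "\<lambda>c a b. pd c (\<lambda>z. g z $ a $ b) y"
    have "(\<Sum>i\<in>UNIV. T i i m y) = 0"
      unfolding T_def
    proof (rule sum_skew_zero)
      fix i l show "gi i l y * H y i m l = - (gi l i y * H y l m i)"
        using alternating3_perm(5)[OF alt[OF y], of i m l] sym_inv_nth[of i l] by simp
    qed
    moreover have "(\<Sum>i\<in>UNIV. ?L i i m y) = \<kappa> y m"
    proof -
      have "(\<Sum>i\<in>UNIV. \<Sum>l\<in>UNIV. gi i l y * (?dg i m l - ?dg l i m)) = 0"
      proof (rule sum_skew_zero)
        fix i l show "gi i l y * (?dg i m l - ?dg l i m) = - (gi l i y * (?dg l m i - ?dg i l m))"
          unfolding sym_inv_nth[of l i] pd_metric_sym[OF y, of _ m] by (simp add: algebra_simps)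
      qed
      then have "(\<Sum>i\<in>UNIV. \<Sum>l\<in>UNIV. gi i l y * (?dg i m l + ?dg m i l - ?dg l i m))
        = (\<Sum>i\<in>UNIV. \<Sum>l\<in>UNIV. gi i l y * ?dg m i l)"
        by (simp add: distrib_left right_diff_distrib sum.distrib sum_subtractf)
      then show ?thesis
        unfolding levi_civita_def volume_form_derivative_def sum_divide_distrib[symmetric] by simp
    qed
    ultimately show ?thesis by (simp add: G sum.distrib sum_divide_distrib[symmetric])
  qed
  have sG: "smooth_on U (?G k i j)" for k i j
    unfolding G by (intro smooth_intros smooth_levi_civita sT)
  have dtrace: "(\<Sum>i\<in>UNIV. pd j (?G i i k) x) = pd j (\<lambda>y. \<kappa> y k) x" for j k
  proof -
    have "pd j (\<lambda>y. \<Sum>i\<in>UNIV. ?G i i k y) x = (\<Sum>i\<in>UNIV. pd j (?G i i k) x)"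
      by (rule pd_sum, simp) (rule smooth_on_differentiable[OF sG x])
    moreover have "pd j (\<lambda>y. \<Sum>i\<in>UNIV. ?G i i k y) x = pd j (\<lambda>y. \<kappa> y k) x"
      by (rule pd_cong[OF open_U x trace])
    ultimately show ?thesis by simp
  qed
  interpret hermitian "g x" "J x" by (rule hermitian[OF x])
  have skew_eq: "(\<Sum>i\<in>UNIV. pd i (T i j k) x) + (\<Sum>m\<in>UNIV. \<kappa> x m * T m j k x)
      - (\<Sum>i\<in>UNIV. \<Sum>m\<in>UNIV. ?L i j m x * T m i k x) + (\<Sum>i\<in>UNIV. \<Sum>m\<in>UNIV. ?L i k m x * T m i j x)
      = (\<Sum>m\<in>UNIV. T m j k x * pd m u x)" for j k
  proof (rule skew_ricci_hessian[where G="\<lambda>k i j. ?G k i j x" and dG="\<lambda>a k i j. pd a (?G k i j) x"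
        and T="\<lambda>k i j. T k i j x" and dT="\<lambda>a k i j. pd a (T k i j) x"
        and L="\<lambda>k i j. ?L k i j x" and dL="\<lambda>a k i j. pd a (?L k i j) x" and h="\<lambda>j k. pd j (pd k u) x"])
    show "(\<Sum>i\<in>UNIV. pd j (?G i i k) x) = (\<Sum>i\<in>UNIV. pd k (?G i i j) x)" for j k
      unfolding dtrace by (rule kappa_closed[OF x])
    show "(\<Sum>i\<in>UNIV. pd i (?G i j k) x - pd j (?G i i k) x
          + (\<Sum>m\<in>UNIV. ?G i i m x * ?G m j k x - ?G i j m x * ?G m i k x))
        + (pd j (pd k u) x - (\<Sum>m\<in>UNIV. ?G m j k x * pd m u x)) = 0" for j k
      using soliton[of j k] by (simp only: ricci_def curvature_def hessian_def)
  qed (rule G dG levi_civita_sym[OF x] Tskew[OF x] dL dT trace[OF x] pd_commute[OF open_U x u])+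
  have contracted: "(\<Sum>i\<in>UNIV. \<Sum>j\<in>UNIV. \<Sum>k\<in>UNIV. pd i (T i j k) x * W j k x) + (\<Sum>m\<in>UNIV. \<kappa> x m * Z m x)
      - 2 * (\<Sum>j\<in>UNIV. \<Sum>k\<in>UNIV. W j k x * (\<Sum>i\<in>UNIV. \<Sum>m\<in>UNIV. ?L i j m x * T m i k x))
      = (\<Sum>m\<in>UNIV. Z m x * pd m u x)"
    by (rule skew_ricci_hessian_contracted[where T="\<lambda>k i j. T k i j x" and L="\<lambda>k i j. ?L k i j x"
          and dT="\<lambda>a k i j. pd a (T k i j) x"])
      (rule skew_W skew_eq Z_def)+
  \<comment> \<open>The Christoffel terms in \<open>contracted\<close> complete the coordinate
    derivative of \<open>W\<close> to a covariant one; its contraction with the torsion is the error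
    term, shown to vanish in \<open>B\<close>.\<close>
  have "(\<Sum>i\<in>UNIV. \<Sum>j\<in>UNIV. \<Sum>k\<in>UNIV. T i j k x * pd i (W j k) x)
      + 2 * (\<Sum>j\<in>UNIV. \<Sum>k\<in>UNIV. W j k x * (\<Sum>i\<in>UNIV. \<Sum>m\<in>UNIV. ?L i j m x * T m i k x))
      = (\<Sum>i\<in>UNIV. \<Sum>j\<in>UNIV. \<Sum>k\<in>UNIV. T i j k x * (\<Sum>p\<in>UNIV. \<Sum>q\<in>UNIV. gi j p x * pd i (\<omega> p q) x * gi q k x))"
  proof (rule torsion_bivector_derivative[where dg="\<lambda>c a b. pd c (\<lambda>z. g z $ a $ b) x" and H="H x"
        and gi="\<lambda>i j. gi i j x" and W="\<lambda>i j. W i j x" and d\<omega>="\<lambda>c a b. pd c (\<omega> a b) x"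
        and dW="\<lambda>c a b. pd c (W a b) x" and L="\<lambda>k i j. ?L k i j x" and T="\<lambda>k i j. T k i j x"])
    show "H x i j k = - H x k j i" "H x i j k = - H x j i k" for i j k
      using alternating3_perm(5)[OF alt[OF x], of i j k] alternating3_perm(2)[OF alt[OF x], of i j k]
      by simp_all
    show "?L k i j x = (\<Sum>l\<in>UNIV. gi k l x * (pd i (\<lambda>z. g z $ j $ l) x
        + pd j (\<lambda>z. g z $ i $ l) x - pd l (\<lambda>z. g z $ i $ j) x)) / 2" for k i j
      by (rule levi_civita_def)
    show "T k i j x = (\<Sum>l\<in>UNIV. gi k l x * H x i j l)" for k i j by (rule T_def)
  qed (rule sym_inv_nth pd_metric_sym[OF x] skew_W pd_bivector[OF x])+
  also have "\<dots> = 0"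
  proof (rule torsion_form_derivative_zero[where \<epsilon>=\<epsilon> and \<theta>="lee x" and T="\<lambda>k i j. T k i j x"
        and d\<omega>="\<lambda>c a b. pd c (\<omega> a b) x"])
    show "T m j k x = (\<Sum>l\<in>UNIV. gi m l x * (\<epsilon> * wedge12 (lee x v* J x) (form x) j k l))" for m j k
      by (simp add: T_def H[OF x])
    show "pd a (\<omega> b c) x - pd b (\<omega> a c) x + pd c (\<omega> a b) x = wedge12 (lee x) (form x) a b c" for a b c
      using fun_cong[OF fun_cong[OF fun_cong[OF ext_d2_form(1)[OF x]]], of a b c] by (simp add: ext_d2_def)
  qed (rule pd_form_skew[OF x])
  finally have B: "(\<Sum>i\<in>UNIV. \<Sum>j\<in>UNIV. \<Sum>k\<in>UNIV. T i j k x * pd i (W j k) x)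
      + 2 * (\<Sum>j\<in>UNIV. \<Sum>k\<in>UNIV. W j k x * (\<Sum>i\<in>UNIV. \<Sum>m\<in>UNIV. ?L i j m x * T m i k x)) = 0" .
  \<comment> \<open>Needed on all of \<open>U\<close>, since the relation is differentiated in
    \<open>dZ\<close>.\<close>
  have ZV: "Z m y = - 2 * \<epsilon> * V m y" if y: "y \<in> U" for m y
  proof -
    interpret hermitian "g y" "J y" by (rule hermitian[OF y])
    show ?thesis
      unfolding Z_def V_def
    proof (rule torsion_contraction_divergence[where \<theta>="lee y" and d\<omega>="\<lambda>c a b. pd c (\<omega> a b) y"
          and T="\<lambda>m j k. T m j k y" and dW="\<lambda>c a b. pd c (W a b) y"
          and dJ="\<lambda>c a b. pd c (\<lambda>z. J z $ a $ b) y" and dg="\<lambda>c a b. pd c (\<lambda>z. g z $ a $ b) y"])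
      show "T m j k y = (\<Sum>l\<in>UNIV. gi m l y * (\<epsilon> * wedge12 (lee y v* J y) (form y) j k l))" for m j k
        by (simp add: T_def H[OF y])
      show "pd a (\<omega> b c) y - pd b (\<omega> a c) y + pd c (\<omega> a b) y = wedge12 (lee y) (form y) a b c" for a b c
        using fun_cong[OF fun_cong[OF fun_cong[OF ext_d2_form(1)[OF y]]], of a b c] by (simp add: ext_d2_def)
      show "\<kappa> y c = (\<Sum>m\<in>UNIV. \<Sum>b\<in>UNIV. gi m b y * pd c (\<lambda>z. g z $ m $ b) y) / 2" for c
        by (rule volume_form_derivative_def)
    qed (rule pd_form[OF y] pd_J_J[OF y] pd_bivector_form[OF y])+
  qed
  have sV: "smooth_on U (V b)" for b
    unfolding V_def by (intro smooth_intros smooth_bivector smooth_kappa)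
  have dZ: "pd i (Z i) x = - 2 * \<epsilon> * pd i (V i) x" for i
  proof -
    have "pd i (Z i) x = pd i (\<lambda>y. (- 2 * \<epsilon>) * V i y) x"
      by (rule pd_cong[OF open_U x ZV])
    then show ?thesis
      by (simp only: pd_linear[OF bounded_linear_mult_right smooth_on_differentiable[OF sV x]])
  qed
  \<comment> \<open>The product rule trades the derivative of the torsion in
    \<open>contracted\<close> for a derivative of \<open>Z\<close> and the term controlled by
    \<open>B\<close>; the left side there becomes the Riemannian divergence of
    \<open>Z\<close>.\<close>
  have "pd i (Z i) x = (\<Sum>j\<in>UNIV. \<Sum>k\<in>UNIV. pd i (T i j k) x * W j k x + T i j k x * pd i (W j k) x)" for i
  proof -
    have "pd i (Z i) x = (\<Sum>j\<in>UNIV. pd i (\<lambda>y. \<Sum>k\<in>UNIV. T i j k y * W j k y) x)"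
      unfolding Z_def
      by (rule pd_sum, simp) (intro smooth_on_differentiable[OF _ x] smooth_intros sT smooth_bivector)
    then show ?thesis by (simp only: pd_sum_mult[OF x sT smooth_bivector])
  qed
  then have "(\<Sum>i\<in>UNIV. \<Sum>j\<in>UNIV. \<Sum>k\<in>UNIV. pd i (T i j k) x * W j k x)
      + (\<Sum>i\<in>UNIV. \<Sum>j\<in>UNIV. \<Sum>k\<in>UNIV. T i j k x * pd i (W j k) x) = - 2 * \<epsilon> * (\<Sum>i\<in>UNIV. pd i (V i) x)"
    by (simp only: sum.distrib[symmetric] dZ sum_distrib_left)
  moreover have "(\<Sum>m\<in>UNIV. \<kappa> x m * Z m x) = - 2 * \<epsilon> * (\<Sum>m\<in>UNIV. \<kappa> x m * V m x)"
    by (simp add: ZV[OF x] sum_distrib_left mult_ac)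
  moreover have "(\<Sum>b\<in>UNIV. pd b (V b) x) + (\<Sum>b\<in>UNIV. \<kappa> x b * V b x) = 0"
    unfolding V_def by (rule divergence_bivector_divergence[OF x])
  then have "- 2 * \<epsilon> * (\<Sum>b\<in>UNIV. pd b (V b) x) + - 2 * \<epsilon> * (\<Sum>b\<in>UNIV. \<kappa> x b * V b x) = 0"
    by (simp only: distrib_left[symmetric] mult_zero_right)
  ultimately have Zu: "(\<Sum>m\<in>UNIV. Z m x * pd m u x) = 0"
    using contracted B by linarith
  \<comment> \<open>The algebraic description of \<open>Z\<close>, which turns the vanishing pairing
    with du into the claim.\<close>
  have Z: "Z m x = 2 * \<epsilon> * (\<Sum>c\<in>UNIV. W m c x * lee x $ c)" for m
    unfolding Z_def raise_covector_J[symmetric]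
    by (rule torsion_contraction) (simp add: T_def H[OF x])
  have "2 * \<epsilon> * (\<Sum>m\<in>UNIV. (\<Sum>c\<in>UNIV. W m c x * lee x $ c) * pd m u x) = (\<Sum>m\<in>UNIV. Z m x * pd m u x)"
    by (subst sum_distrib_left) (simp only: Z mult.assoc)
  then have "2 * \<epsilon> * (\<Sum>m\<in>UNIV. (\<Sum>c\<in>UNIV. W m c x * lee x $ c) * pd m u x) = 0"
    by (simp only: Zu)
  then show ?thesis using \<epsilon> by simp
qed

end

section \<open>Generalized Kaehler-Ricci solitons\<close>

lemma hermitian_domain_chart:
  assumes "c \<in> A" "open (cimg c)" "riemannian_metric A g" "compatible_complex_structure A g J"
  shows "hermitian_domain (cimg c) (g c) (J c)"
proof
  show "open (cimg c)" by fact
  show "smooth_on (cimg c) (g c)"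
    using assms(1,3) by (simp add: riemannian_metric_def smooth_bilinear_field_def)
  show "smooth_on (cimg c) (J c)"
    using assms(1,4) by (simp add: compatible_complex_structure_def smooth_endo_field_def)
  fix x assume x: "x \<in> cimg c"
  show "Finite_Cartesian_Product.transpose (g c x) = g c x"
    "v \<noteq> 0 \<Longrightarrow> v \<bullet> (g c x *v v) > 0" for v
    using assms(1,3) x unfolding riemannian_metric_def by blast+
  show "J c x ** J c x = - mat 1" "Finite_Cartesian_Product.transpose (J c x) ** g c x ** J c x = g c x"
    using assms(1,4) x unfolding compatible_complex_structure_def by blast+
qed

lemma fundamental_form_eq: "fundamental_form g J c = (\<lambda>y. hermitian_form (g c y) (J c y))"
  by (simp add: fun_eq_iff fundamental_form_def hermitian_form_def)

lemma invertible_poisson_tensor_noncommuting: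
  assumes "invertible (poisson_tensor g I J c x)"
  shows "I c x ** J c x \<noteq> J c x ** I c x"
proof
  assume "I c x ** J c x = J c x ** I c x"
  then have "poisson_tensor g I J c x = 0"
    by (simp add: poisson_tensor_def matrix_matrix_mult_def vec_eq_iff)
  then obtain B :: "real^4^4" where "0 ** B = (mat 1 :: real^4^4)"
    using assms unfolding invertible_def by metis
  then have "(0 ** B) $ 1 $ 1 = (mat 1 :: real^4^4) $ 1 $ 1" by simp
  then show False by (simp add: matrix_matrix_mult_def mat_1_nth)
qed

text \<open>Up to sign, \<open>W\<close> applied to the Lee form is J applied to its metric dual,
  and the metric cancels the inverse metric in the gradient.\<close>

lemma (in hermitian_domain) gradient_lee_orthogonal:
  assumes "x \<in> U" "\<epsilon> \<noteq> 0"
    and "\<And>y i j k. y \<in> U \<Longrightarrow> H y i j k = \<epsilon> * wedge12 (lee y v* J y) (form y) i j k"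
    and "smooth_on U u"
    and "\<And>i j. ricci (bismut_plus g H) x i j + hessian (bismut_plus g H) u x i j = 0"
  shows "(matrix_inv (g x) *v (\<chi> i. pd i u x)) \<bullet> (g x *v (J x *v (matrix_inv (g x) *v lee x))) = 0"
proof -
  interpret hermitian "g x" "J x" by (rule hermitian[OF assms(1)])
  let ?du = "\<chi> i. pd i u x"
  have g: "(matrix_inv (g x) *v a) \<bullet> (g x *v v) = a \<bullet> v" for a v
  proof -
    have "(matrix_inv (g x) *v a) \<bullet> (g x *v v) = a \<bullet> (matrix_inv (g x) *v (g x *v v))"
      by (metis dot_lmul_matrix sym_inv transpose_matrix_vector)
    then show ?thesis
      by (simp add: matrix_vector_mul_assoc matrix_inv_mult[OF invertible])
  qed
  have "(J x *v (matrix_inv (g x) *v lee x)) $ m = - (\<Sum>c\<in>UNIV. W m c x * lee x $ c)" for m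
  proof -
    have "J x *v (matrix_inv (g x) *v lee x) = - ((matrix_inv (g x) ** transpose (J x)) *v lee x)"
      by (simp only: matrix_vector_mul_assoc inv_tJ matrix_vector_mul_lneg minus_minus)
    then show ?thesis
      by (simp add: hermitian_bivector_def matrix_vector_mult_def[of "matrix_inv (g x) ** _"])
  qed
  then have "?du \<bullet> (J x *v (matrix_inv (g x) *v lee x))
      = - (\<Sum>m\<in>UNIV. (\<Sum>c\<in>UNIV. W m c x * lee x $ c) * pd m u x)"
    by (simp add: inner_vec_def sum_negf mult.commute)
  then show ?thesis
    using soliton_gradient_orthogonal[OF assms(2,3,4,5,1)] by (simp only: g)
qed

theorem lemma4p4:
  fixes A :: "'m::{t2_space, second_countable_topology} chart set"
    and g I J :: "'m matrix_field"
    and H :: "'m chart \<Rightarrow> real^4 \<Rightarrow> real cov3"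
    and f :: "'m \<Rightarrow> real"
  assumes "smooth_atlas A"
    and "gk_ricci_soliton A g I J H f"
    and "nondegenerate_gk A g I J"
    and "soliton_rank A g I J f = 2"
  shows "\<forall>c\<in>A. \<forall>p\<in>cdom c. dim (soliton_span g I J f c p) = 2 \<longrightarrow>
           (\<lambda>v. I c (cmap c p) *v v) ` soliton_span g I J f c p
             = (\<lambda>v. J c (cmap c p) *v v) ` soliton_span g I J f c p"
proof (intro ballI impI)
  fix c p assume c: "c \<in> A" and p: "p \<in> cdom c" and dim: "dim (soliton_span g I J f c p) = 2"
  define x where "x = cmap c p"
  let ?U = "cimg c" and ?u = "f \<circ> cinv c"
  have x: "x \<in> ?U" using p by (simp add: x_def cimg_def)
  have gk: "generalized_kahler A g I J H" and f: "smooth_on ?U ?u"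
    and soliton: "\<And>y i j. y \<in> ?U \<Longrightarrow> ricci (bismut_plus (g c) (H c)) y i j
        + hessian (bismut_plus (g c) (H c)) ?u y i j = 0"
    using assms(2) c by (auto simp: gk_ricci_soliton_def smooth_function_def)
  have U: "open ?U" using assms(1) c by (simp add: smooth_atlas_def is_chart_def)
  interpret I: hermitian_domain ?U "g c" "I c"
    by (rule hermitian_domain_chart[OF c U]) (use gk in \<open>simp_all add: generalized_kahler_def\<close>)
  interpret J: hermitian_domain ?U "g c" "J c"
    by (rule hermitian_domain_chart[OF c U]) (use gk in \<open>simp_all add: generalized_kahler_def\<close>)
  have "dc2 (I c) I.form y i j k = complex_of_real (H c y i j k) \<and>
      complex_of_real (H c y i j k) = - dc2 (J c) J.form y i j k" if "y \<in> ?U" for y i j k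
    using gk[unfolded generalized_kahler_def fundamental_form_eq] c that by blast
  \<comment> \<open>\<open>dc2_form\<close> carries a minus sign, and \<open>H\<close> is the first
    d^c but minus the second; this gives the constants \<epsilon> = -1 for \<open>I\<close> and
    \<epsilon> = 1 for \<open>J\<close>.\<close>
  then have "complex_of_real (H c y i j k) = complex_of_real (- 1 * wedge12 (I.lee y v* I c y) (I.form y) i j k)"
    "complex_of_real (H c y i j k) = complex_of_real (1 * wedge12 (J.lee y v* J c y) (J.form y) i j k)"
    if "y \<in> ?U" for y i j k
    using that by (simp_all add: I.dc2_form J.dc2_form)
  then have HI: "H c y i j k = - 1 * wedge12 (I.lee y v* I c y) (I.form y) i j k"
    and HJ: "H c y i j k = 1 * wedge12 (J.lee y v* J c y) (J.form y) i j k"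
    if "y \<in> ?U" for y i j k
    using that of_real_eq_iff by blast+
  have nc: "I c x ** J c x \<noteq> J c x ** I c x"
    using assms(3) c x by (intro invertible_poisson_tensor_noncommuting[of g]) (simp add: nondegenerate_gk_def)
  define q where "q = matrix_inv (g c x) *v I.lee x"
  define w where "w = gradient g f c x"
  have w: "w = matrix_inv (g c x) *v (\<chi> i. pd i ?u x)"
    by (simp add: w_def gradient_def sharp_def)
  \<comment> \<open>The only use of nondegeneracy, through \<open>nc\<close>: the two Lee forms are
    opposite, so both soliton fields are expressed by the same vectors \<open>q\<close> and
    \<open>w\<close>.\<close>
  have q_J: "matrix_inv (g c x) *v J.lee x = - q"
    unfolding q_def
    by (rule opposite_lee_forms[OF I.hermitian[OF x] J.hermitian[OF x] nc])
      (use HI[OF x] HJ[OF x] in simp)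
  have "w \<bullet> (g c x *v (I c x *v q)) = 0"
    unfolding w q_def by (rule I.gradient_lee_orthogonal[OF x _ HI f soliton[OF x]]) simp
  moreover have "w \<bullet> (g c x *v (J c x *v q)) = 0"
  proof -
    \<comment> \<open>The dual of the Lee form of \<open>J\<close> is \<open>- q\<close>, so the
      orthogonality is obtained for \<open>- q\<close> and the sign is removed afterwards.\<close>
    have "w \<bullet> (g c x *v (J c x *v (- q))) = 0"
      unfolding w q_J[symmetric] by (rule J.gradient_lee_orthogonal[OF x _ HJ f soliton[OF x]]) simp
    then show ?thesis by (simp add: matrix_vector_mul_rneg)
  qed
  moreover have "soliton_field g I f c x = (1/2) *\<^sub>R (I c x *v (q - w))"
    by (simp add: soliton_field_def lee_form_def fundamental_form_eq I.ext_d2_form(2)[OF x] sharp_def q_def w_def)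
  moreover have "soliton_field g J f c x = (1/2) *\<^sub>R (J c x *v (- q - w))"
    by (simp add: soliton_field_def lee_form_def fundamental_form_eq J.ext_d2_form(2)[OF x] sharp_def q_J w_def)
  moreover have "dim (span {soliton_field g I f c x, soliton_field g J f c x}) = 2"
    using dim by (simp add: soliton_span_def x_def)
  ultimately have "(*v) (I c x) ` span {soliton_field g I f c x, soliton_field g J f c x}
      = (*v) (J c x) ` span {soliton_field g I f c x, soliton_field g J f c x}"
    by (rule image_span_eq[OF I.hermitian[OF x] J.hermitian[OF x]])
  then show "(\<lambda>v. I c (cmap c p) *v v) ` soliton_span g I J f c p
      = (\<lambda>v. J c (cmap c p) *v v) ` soliton_span g I J f c p"
    by (simp add: soliton_span_def x_def)
qed

end
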